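(* Let $d\ge1$ and let $\mathbb W_d(x)=\bigotimes_{j=1}^dW_j(x_j)$, $x\in[0,1]^d$, be the Brownian sheet, where $W_j$ are Wiener processes on $[0,1]$. Let the measure $\mu$ on $[0,1]^d$ be the tensor product $\mu(dx)=\bigotimes_{j=1}^d\mu_j(dx_j)$, where $\mu_j$, $j=1,\dots,d$, are degenerately self-similar measures on $[0,1]$ generated, respectively, by the sets of parameters $M_j$, $m_j$, $\delta_j$, $(\alpha^{(j)}_k)$, $(\beta^{(j)}_k)$, and put $a_j=\alpha^{(j)}_{m_j+1}-\alpha^{(j)}_{m_j}$. Then, as $\varepsilon\to0+$, $$\ln\mathbf P\{\|\mathbb W_d\|_\mu\le\varepsilon\}\sim-\frac{2^d\,\mathfrak C}{(d+1)!}\cdot\ln^{d+1}(1/\varepsilon),\qquad \mathfrak C=\prod_{j=1}^d\frac{M_j-1}{|\ln(a_j\delta_j)|}.$$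
   Context: Here $\|X\|_\mu=\big(\int_{[0,1]^d}X^2(x)\,\mu(dx)\big)^{1/2}$, and $\bigotimes_{j}W_j$ denotes the zero-mean Gaussian field with covariance $\prod_{j=1}^d\min(x_j,y_j)$. The notation $f\sim g$ means $f/g\to1$. Degenerately self-similar measure: let $M\ge2$, $0=\alpha_1<\alpha_2<\dots<\alpha_M<\alpha_{M+1}=1$, $m\in\{1,\dots,M\}$, $a=\alpha_{m+1}-\alpha_m$, and let $\delta$ and $\beta_1,\dots,\beta_M$ be real numbers such that: (i) $0<\delta<1$; (ii) $\beta_1=0$, and $\beta_M=1$ if $m<M$, while $\delta+\beta_M=1$ if $m=M$; (iii) $\beta_k<\beta_{k+1}$ for $k=1,\dots,M-1$, and, if $m<M$, $\delta\beta_M+\beta_m<\beta_{m+1}$. Then there is a unique (bounded, up to a.e. equality) function $f$ on $[0,1]$ with $\mathcal S[f]=f$, where $$\mathcal S[f](t)=\delta\cdot f(a^{-1}(t-\alpha_m))\,\chi_{]\alpha_m,\alpha_{m+1}[}(t)+\sum_{k=1}^M\beta_k\,\chi_{]\alpha_k,\alpha_{k+1}[}(t),$$ $\chi_A$ being the indicator function of $A$. The function $f$ is nondecreasing with $f(0)=0$, $f(1)=1$, and its distributional derivative $f'$ is a discrete probability measure on $[0,1]$ (whose atoms accumulate only at $\widehat x=\alpha_m/(1-a)$). This measure is called the degenerately self-similar measure generated by $M,m,\delta,(\alpha_k),(\beta_k)$. *)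

theory Defs
  imports "HOL-Probability.Probability" "HOL-Library.Landau_Symbols"
begin

section \<open>Degenerately self-similar measures\<close>

text \<open>The sequences \<open>\<alpha>\<close>, \<open>\<beta>\<close> are used only at the indices \<open>1, \<dots>, M + 1\<close> and
  \<open>1, \<dots>, M\<close>, respectively.\<close>

definition dss_params ::
  "nat \<Rightarrow> nat \<Rightarrow> real \<Rightarrow> (nat \<Rightarrow> real) \<Rightarrow> (nat \<Rightarrow> real) \<Rightarrow> bool" where
  "dss_params M m \<delta> \<alpha> \<beta> \<longleftrightarrow>
     2 \<le> M \<and> m \<in> {1..M} \<and>
     \<alpha> 1 = 0 \<and> \<alpha> (M + 1) = 1 \<and> (\<forall>k\<in>{1..M}. \<alpha> k < \<alpha> (k + 1)) \<and>
     0 < \<delta> \<and> \<delta> < 1 \<and>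
     \<beta> 1 = 0 \<and> (m < M \<longrightarrow> \<beta> M = 1) \<and> (m = M \<longrightarrow> \<delta> + \<beta> M = 1) \<and>
     (\<forall>k\<in>{1..M - 1}. \<beta> k < \<beta> (k + 1)) \<and>
     (m < M \<longrightarrow> \<delta> * \<beta> M + \<beta> m < \<beta> (m + 1))"

definition dss_operator ::
  "nat \<Rightarrow> nat \<Rightarrow> real \<Rightarrow> (nat \<Rightarrow> real) \<Rightarrow> (nat \<Rightarrow> real) \<Rightarrow> (real \<Rightarrow> real) \<Rightarrow> real \<Rightarrow> real" where
  "dss_operator M m \<delta> \<alpha> \<beta> f t =
     \<delta> * f ((t - \<alpha> m) / (\<alpha> (m + 1) - \<alpha> m)) * indicator {\<alpha> m<..<\<alpha> (m + 1)} t
     + (\<Sum>k\<in>{1..M}. \<beta> k * indicator {\<alpha> k<..<\<alpha> (k + 1)} t)"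

text \<open>The fixed-point equation is an identity of bounded functions on \<open>[0,1]\<close> modulo null sets:
  at the breakpoints \<open>\<alpha> k\<close> the operator takes the value \<open>0\<close>, so the monotone
  representative satisfies the equation only almost everywhere.\<close>

definition dss_function ::
  "nat \<Rightarrow> nat \<Rightarrow> real \<Rightarrow> (nat \<Rightarrow> real) \<Rightarrow> (nat \<Rightarrow> real) \<Rightarrow> (real \<Rightarrow> real) \<Rightarrow> bool" where
  "dss_function M m \<delta> \<alpha> \<beta> f \<longleftrightarrow>
     f \<in> borel_measurable (restrict_space borel {0..1}) \<and> bounded (f ` {0..1}) \<and>
     (AE t in lborel. t \<in> {0..1} \<longrightarrow> dss_operator M m \<delta> \<alpha> \<beta> f t = f t)"

definition test_function :: "(real \<Rightarrow> real) \<Rightarrow> bool" where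
  "test_function \<phi> \<longleftrightarrow>
     (\<forall>n t. (deriv ^^ n) \<phi> differentiable (at t)) \<and> closure {t. \<phi> t \<noteq> 0} \<subseteq> {0<..<1}"

definition distributional_derivative :: "(real \<Rightarrow> real) \<Rightarrow> real measure \<Rightarrow> bool" where
  "distributional_derivative f \<mu> \<longleftrightarrow>
     (\<forall>\<phi>. test_function \<phi> \<longrightarrow>
        (\<integral>t. \<phi> t \<partial>\<mu>) = - (LBINT t:{0..1}. f t * deriv \<phi> t))"

text \<open>Test functions on \<open>]0,1[\<close> do not see the endpoints.  Since the total mass of the
  distributional derivative on \<open>]0,1[\<close> is \<open>f 1 - f 0 = 1\<close>, requiring a probability measure
  excludes atoms at \<open>0\<close> and \<open>1\<close> and determines \<open>\<mu>\<close>.\<close>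

definition dss_measure ::
  "nat \<Rightarrow> nat \<Rightarrow> real \<Rightarrow> (nat \<Rightarrow> real) \<Rightarrow> (nat \<Rightarrow> real) \<Rightarrow> real measure \<Rightarrow> bool" where
  "dss_measure M m \<delta> \<alpha> \<beta> \<mu> \<longleftrightarrow>
     dss_params M m \<delta> \<alpha> \<beta> \<and>
     sets \<mu> = sets (restrict_space borel {0..1}) \<and> prob_space \<mu> \<and>
     (\<exists>f. dss_function M m \<delta> \<alpha> \<beta> f \<and> distributional_derivative f \<mu>)"

section \<open>The Brownian sheet\<close>

text \<open>Constants count as (degenerate) Gaussian variables; the sheet vanishes on the
  coordinate hyperplanes.\<close>

definition gaussian_rv :: "'w measure \<Rightarrow> ('w \<Rightarrow> real) \<Rightarrow> bool" where
  "gaussian_rv P Y \<longleftrightarrow>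
     Y \<in> borel_measurable P \<and>
     ((\<exists>c. AE \<omega> in P. Y \<omega> = c) \<or>
      (\<exists>c \<sigma>. 0 < \<sigma> \<and> distributed P lborel Y (normal_density c \<sigma>)))"

definition gaussian_field :: "'w measure \<Rightarrow> 'i set \<Rightarrow> ('i \<Rightarrow> 'w \<Rightarrow> real) \<Rightarrow> bool" where
  "gaussian_field P T X \<longleftrightarrow>
     (\<forall>S c. finite S \<and> S \<subseteq> T \<longrightarrow> gaussian_rv P (\<lambda>\<omega>. \<Sum>x\<in>S. c x * X x \<omega>))"

text \<open>Points of \<open>[0,1]^d\<close> are the extensional functions on \<open>{1..d}\<close> with values in
  \<open>[0,1]\<close>, i.e. the points of the product measurable spaces below.\<close>

definition unit_cube :: "nat \<Rightarrow> (nat \<Rightarrow> real) set" where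
  "unit_cube d = (\<Pi>\<^sub>E j\<in>{1..d}. {0..1})"

text \<open>Joint measurability is what gives sense to the path integrals of the field; it holds for
  every version with continuous paths.\<close>

definition brownian_sheet ::
  "nat \<Rightarrow> 'w measure \<Rightarrow> ((nat \<Rightarrow> real) \<Rightarrow> 'w \<Rightarrow> real) \<Rightarrow> bool" where
  "brownian_sheet d P X \<longleftrightarrow>
     prob_space P \<and>
     (\<lambda>(\<omega>, x). X x \<omega>)
       \<in> borel_measurable (P \<Otimes>\<^sub>M (\<Pi>\<^sub>M j\<in>{1..d}. restrict_space borel {0..1})) \<and>
     gaussian_field P (unit_cube d) X \<and>
     (\<forall>x\<in>unit_cube d. (\<integral>\<omega>. X x \<omega> \<partial>P) = 0) \<and>
     (\<forall>x\<in>unit_cube d. \<forall>y\<in>unit_cube d.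
        (\<integral>\<omega>. X x \<omega> * X y \<omega> \<partial>P) = (\<Prod>j\<in>{1..d}. min (x j) (y j)))"

text \<open>The Bochner integral is \<open>0\<close> for paths that are not square-integrable.  For the Brownian
  sheet and a probability measure these form a null set, as
  \<open>\<integral> E (X x)\<^sup>2 \<mu>(dx) = \<integral> \<Prod>j. x j \<mu>(dx) \<le> 1\<close>.\<close>

definition field_norm :: "'i measure \<Rightarrow> ('i \<Rightarrow> 'w \<Rightarrow> real) \<Rightarrow> 'w \<Rightarrow> real" where
  "field_norm \<mu> X \<omega> = sqrt (\<integral>x. (X x \<omega>)\<^sup>2 \<partial>\<mu>)"

end

theory Submission
  imports Defs "HOL-Real_Asymp.Real_Asymp"
begin

text \<open>
  The measure \<open>\<mu> j\<close> is the sum of point masses \<open>\<delta> ^ n * jump k\<close> at \<open>(S ^^ n) (\<alpha> k)\<close>, \<open>2 \<le> k \<le> M\<close>,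
  where \<open>S\<close> is the affine map of \<open>[0,1]\<close> onto the \<open>m\<close>-th interval, so the squared norm is a
  countable weighted sum of squares of jointly Gaussian variables.  Writing \<open>exp (- s\<^sup>2 y\<^sup>2 / 2)\<close> as the
  mean of \<open>exp (\<i> s g y)\<close> over a standard normal \<open>g\<close> expresses the Laplace transform of a finite part
  of the sum as a Gaussian integral of the exponential of the covariance form, which is monotone in
  the covariance with respect to the order of positive semidefinite kernels.

  In dimension one \<open>min x y\<close> dominates a diagonal kernel of order \<open>a ^ n\<close> at the atoms of level \<open>n\<close>,
  because these atoms are isolated within a distance of that order.  Conversely, moving from each
  atom to the next one on a path through the levels writes \<open>min x y\<close> as a triangular transform of
  increments whose covariance is dominated by a diagonal of order \<open>a ^ n\<close>; after weighting by the
  masses both bounds are of order \<open>(a * \<delta>) ^ n\<close>, with \<open>M - 1\<close> terms at each level.  Both comparisons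
  are compatible with tensor products.  So the Laplace transform at \<open>\<theta>\<close> is enclosed between products
  of \<open>(1 + c * \<theta> * q) powr (- 1 / 2)\<close>, with \<open>q\<close> running through the products of the numbers
  \<open>(a j * \<delta> j) ^ n j\<close>, and the logarithm of either bound is a sum over a lattice.
  Evaluation at \<open>\<theta> = \<epsilon> powr (-2)\<close>, up to a power of \<open>ln (1 / \<epsilon>)\<close>, gives the small ball
  probability.\<close>

section \<open>Positive semidefinite kernels\<close>

text \<open>The atoms of one measure accumulate at a point that is positive unless
  \<open>m = 1\<close>. There \<open>min x y\<close> is nearly constant on the deep atoms, and no
  diagonal of order \<open>a ^ n\<close> can dominate it. Hence the upper comparison has to pass to
  increments while the lower one does not, and the weights are compared a second time, in the
  coordinates of the increments. No eigenvalue is computed: a constant factor lost in a comparison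
  of kernels only adds a constant to \<open>ln \<theta>\<close>, and the result depends on the
  leading power of \<open>ln \<theta>\<close> alone. The limit constant comes from volume counting.
  The lattice sum is about \<open>D * y ^ (d + 1) / fact (d + 1)\<close> with
  \<open>y = ln \<theta>\<close> close to \<open>2 * ln (1 / \<epsilon>)\<close>, and the exponent
  \<open>- 1 / 2\<close> of each factor removes one power of 2.\<close>

definition psd :: "'i set \<Rightarrow> ('i \<Rightarrow> 'i \<Rightarrow> real) \<Rightarrow> bool" where
  "psd X A \<longleftrightarrow> (\<forall>c. 0 \<le> (\<Sum>x\<in>X. \<Sum>y\<in>X. c x * c y * A x y))"

text \<open>The conclusion of Schur's product theorem, taken as a property of a kernel. In this form
  it passes to finite products at once and can be checked directly for the kernels that occur,
  finite Gram sums and \<open>min\<close>.\<close>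

definition psd_mult :: "'i set \<Rightarrow> ('i \<Rightarrow> 'i \<Rightarrow> real) \<Rightarrow> bool" where
  "psd_mult X A \<longleftrightarrow> (\<forall>B. psd X B \<longrightarrow> psd X (\<lambda>x y. A x y * B x y))"

lemma psd_cong:
  assumes "\<And>x y. x \<in> X \<Longrightarrow> y \<in> X \<Longrightarrow> A x y = B x y"
  shows "psd X A \<longleftrightarrow> psd X B"
  unfolding psd_def using assms by (simp cong: sum.cong)

lemma psd_add: "psd X A \<Longrightarrow> psd X B \<Longrightarrow> psd X (\<lambda>x y. A x y + B x y)"
  unfolding psd_def by (auto simp: distrib_left sum.distrib)

lemma psd_zero: "psd X (\<lambda>x y. 0)"
  unfolding psd_def by simp

lemma psd_mult_prod:
  assumes "finite J" "\<And>j. j \<in> J \<Longrightarrow> psd_mult X (A j)"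
  shows "psd_mult X (\<lambda>x y. \<Prod>j\<in>J. A j x y)"
  using assms by (induct J) (auto simp: psd_mult_def mult.assoc)

text \<open>Factors are exchanged one at a time:
  \<open>B * B' - A * A' = B * (B' - A') + A' * (B - A)\<close>, where \<open>B\<close> and
  \<open>A'\<close> are multipliers. This carries the one-dimensional comparisons to the
  cube.\<close>

lemma psd_diff_prod:
  assumes "finite J"
    and "\<And>j. j \<in> J \<Longrightarrow> psd X (\<lambda>x y. B j x y - A j x y)"
    and "\<And>j. j \<in> J \<Longrightarrow> psd_mult X (A j)"
    and "\<And>j. j \<in> J \<Longrightarrow> psd_mult X (B j)"
  shows "psd X (\<lambda>x y. (\<Prod>j\<in>J. B j x y) - (\<Prod>j\<in>J. A j x y))"
  using assms
proof (induct J)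
  case empty
  then show ?case by (simp add: psd_zero)
next
  case (insert j J)
  have "psd_mult X (\<lambda>x y. \<Prod>j\<in>J. A j x y)"
    using insert by (intro psd_mult_prod) auto
  then have 1: "psd X (\<lambda>x y. (\<Prod>j\<in>J. A j x y) * (B j x y - A j x y))"
    using insert.prems(1)[of j] unfolding psd_mult_def by auto
  have "psd X (\<lambda>x y. B j x y * ((\<Prod>j\<in>J. B j x y) - (\<Prod>j\<in>J. A j x y)))"
    using insert unfolding psd_mult_def by auto
  from psd_add[OF this 1] show ?case
    by (rule back_subst[of "psd X"]) (use insert in \<open>auto simp: fun_eq_iff algebra_simps\<close>)
qed

lemma sum_quadratic_eq_gram:
  fixes e :: "'k \<Rightarrow> 'i \<Rightarrow> real"
  shows "(\<Sum>x\<in>X. \<Sum>y\<in>X. c x * c y * (\<Sum>k\<in>K. e k x * e k y)) = (\<Sum>k\<in>K. (\<Sum>x\<in>X. c x * e k x)\<^sup>2)"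
proof -
  have "(\<Sum>x\<in>X. \<Sum>y\<in>X. c x * c y * (\<Sum>k\<in>K. e k x * e k y))
      = (\<Sum>x\<in>X. \<Sum>y\<in>X. \<Sum>k\<in>K. (c x * e k x) * (c y * e k y))"
    by (simp add: sum_distrib_left ac_simps)
  also have "\<dots> = (\<Sum>k\<in>K. \<Sum>x\<in>X. \<Sum>y\<in>X. (c x * e k x) * (c y * e k y))"
    by (rule trans[OF sum.cong[OF refl sum.swap] sum.swap])
  finally show ?thesis
    by (simp add: power2_eq_square sum_product)
qed

text \<open>Each \<open>e k\<close> can be absorbed into the coefficients, so the form splits into
  forms of \<open>B\<close>, one for every \<open>k\<close>.\<close>

lemma psd_mult_gram:
  fixes e :: "'k \<Rightarrow> 'i \<Rightarrow> real"
  assumes "\<And>x y. x \<in> X \<Longrightarrow> y \<in> X \<Longrightarrow> A x y = (\<Sum>k\<in>K. e k x * e k y)"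
  shows "psd_mult X A"
  unfolding psd_mult_def
proof (intro allI impI)
  fix B assume B: "psd X B"
  show "psd X (\<lambda>x y. A x y * B x y)"
    unfolding psd_def
  proof
    fix c :: "'i \<Rightarrow> real"
    have "(\<Sum>x\<in>X. \<Sum>y\<in>X. c x * c y * (A x y * B x y))
        = (\<Sum>x\<in>X. \<Sum>y\<in>X. \<Sum>k\<in>K. (c x * e k x) * (c y * e k y) * B x y)"
      using assms by (intro sum.cong refl) (simp add: sum_distrib_left sum_distrib_right ac_simps)
    also have "\<dots> = (\<Sum>k\<in>K. \<Sum>x\<in>X. \<Sum>y\<in>X. (c x * e k x) * (c y * e k y) * B x y)"
      by (rule trans[OF sum.cong[OF refl sum.swap] sum.swap])
    also have "\<dots> \<ge> 0"
      by (rule sum_nonneg) (rule B[unfolded psd_def, rule_format])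
    finally show "0 \<le> (\<Sum>x\<in>X. \<Sum>y\<in>X. c x * c y * (A x y * B x y))" .
  qed
qed

text \<open>The map \<open>g\<close> need not be injective: coefficients at points with a common
  image are added up in \<open>c'\<close>. This is needed for coordinate projections of a product
  lattice.\<close>

lemma psd_comap:
  assumes "finite X" "finite Y" "g ` X \<subseteq> Y" "psd Y A"
  shows "psd X (\<lambda>x y. A (g x) (g y))"
  unfolding psd_def
proof
  fix c :: "'a \<Rightarrow> real"
  define c' where "c' u = (\<Sum>x\<in>{x\<in>X. g x = u}. c x)" for u
  have group: "(\<Sum>x\<in>X. c x * f (g x)) = (\<Sum>u\<in>Y. c' u * f u)" for f :: "'b \<Rightarrow> real"
  proof -
    have "(\<Sum>x\<in>X. c x * f (g x)) = (\<Sum>u\<in>Y. \<Sum>x\<in>{x\<in>X. g x = u}. c x * f (g x))"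
      using assms by (intro sum.group[symmetric])
    also have "\<dots> = (\<Sum>u\<in>Y. c' u * f u)"
      unfolding c'_def sum_distrib_right by (intro sum.cong refl) auto
    finally show ?thesis .
  qed
  have "(\<Sum>x\<in>X. \<Sum>y\<in>X. c x * c y * A (g x) (g y)) = (\<Sum>x\<in>X. c x * (\<Sum>y\<in>X. c y * A (g x) (g y)))"
    by (simp add: sum_distrib_left ac_simps)
  also have "\<dots> = (\<Sum>x\<in>X. c x * (\<Sum>v\<in>Y. c' v * A (g x) v))"
    by (intro sum.cong refl arg_cong2[where f="(*)"] group)
  also have "\<dots> = (\<Sum>u\<in>Y. c' u * (\<Sum>v\<in>Y. c' v * A u v))"
    by (rule group)
  also have "\<dots> = (\<Sum>u\<in>Y. \<Sum>v\<in>Y. c' u * c' v * A u v)"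
    by (simp add: sum_distrib_left ac_simps)
  also have "\<dots> \<ge> 0"
    using assms(4) unfolding psd_def by blast
  finally show "0 \<le> (\<Sum>x\<in>X. \<Sum>y\<in>X. c x * c y * A (g x) (g y))" .
qed

lemma has_bochner_integral_indicator_min:
  fixes s t :: real
  assumes "0 \<le> s" "0 \<le> t"
  shows "has_bochner_integral lborel (\<lambda>x. indicator {0..s} x * indicator {0..t} x :: real) (min s t)"
proof -
  have "has_bochner_integral lborel (indicator {0..min s t} :: real \<Rightarrow> real) (measure lborel {0..min s t})"
    by (intro has_bochner_integral_real_indicator) (auto simp: emeasure_lborel_Icc_eq)
  also have "measure lborel {0..min s t} = min s t"
    using assms by auto
  also have "(indicator {0..min s t} :: real \<Rightarrow> real) = (\<lambda>x. indicator {0..s} x * indicator {0..t} x)"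
    by (auto simp: indicator_def fun_eq_iff)
  finally show ?thesis .
qed

text \<open>The number \<open>min s t\<close> is the length of the intersection of
  \<open>{0..s}\<close> and \<open>{0..t}\<close>. This is a Gram representation over a continuum,
  and the argument for finite Gram sums works under the integral.\<close>

lemma psd_mult_min:
  fixes p :: "'i \<Rightarrow> real"
  assumes p: "\<And>x. x \<in> X \<Longrightarrow> 0 \<le> p x"
  shows "psd_mult X (\<lambda>x y. min (p x) (p y))"
  unfolding psd_mult_def
proof (intro allI impI)
  fix B assume B: "psd X B"
  have m: "has_bochner_integral lborel (\<lambda>t. indicator {0..p x} t * indicator {0..p y} t :: real) (min (p x) (p y))"
    if "x \<in> X" "y \<in> X" for x y
    using p that by (intro has_bochner_integral_indicator_min)
  show "psd X (\<lambda>x y. min (p x) (p y) * B x y)"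
    unfolding psd_def
  proof
    fix c :: "'i \<Rightarrow> real"
    have "has_bochner_integral lborel (\<lambda>t. \<Sum>x\<in>X. \<Sum>y\<in>X. c x * c y * ((indicator {0..p x} t * indicator {0..p y} t) * B x y))
       (\<Sum>x\<in>X. \<Sum>y\<in>X. c x * c y * (min (p x) (p y) * B x y))"
      by (intro has_bochner_integral_sum has_bochner_integral_mult_right has_bochner_integral_mult_left m)
    then have "(\<Sum>x\<in>X. \<Sum>y\<in>X. c x * c y * (min (p x) (p y) * B x y))
      = (LBINT t. \<Sum>x\<in>X. \<Sum>y\<in>X. c x * c y * ((indicator {0..p x} t * indicator {0..p y} t) * B x y))"
      by (simp add: has_bochner_integral_iff)
    also have "\<dots> \<ge> 0"
    proof (rule Bochner_Integration.integral_nonneg)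
      fix t
      have "(\<Sum>x\<in>X. \<Sum>y\<in>X. c x * c y * ((indicator {0..p x} t * indicator {0..p y} t) * B x y))
        = (\<Sum>x\<in>X. \<Sum>y\<in>X. (c x * indicator {0..p x} t) * (c y * indicator {0..p y} t) * B x y)"
        by (simp add: ac_simps)
      also have "\<dots> \<ge> 0"
        using B[unfolded psd_def, rule_format, of "\<lambda>x. c x * indicator {0..p x} t"] .
      finally show "0 \<le> (\<Sum>x\<in>X. \<Sum>y\<in>X. c x * c y * ((indicator {0..p x} t * indicator {0..p y} t) * B x y))" .
    qed
    finally show "0 \<le> (\<Sum>x\<in>X. \<Sum>y\<in>X. c x * c y * (min (p x) (p y) * B x y))" .
  qed
qed

text \<open>A Gram kernel over the fibres of \<open>g\<close>: the vector of the fibre over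
  \<open>k\<close> is \<open>sqrt (b k)\<close> times its indicator.\<close>

lemma psd_mult_comap_diag:
  assumes "finite Y" "\<And>x. x \<in> X \<Longrightarrow> g x \<in> Y" "\<And>y. y \<in> Y \<Longrightarrow> 0 \<le> b y"
  shows "psd_mult X (\<lambda>x y. if g x = g y then b (g x) else 0)"
proof (rule psd_mult_gram)
  fix x y assume xy: "x \<in> X" "y \<in> X"
  show "(if g x = g y then b (g x) else 0)
    = (\<Sum>k\<in>Y. (if g x = k then sqrt (b (g x)) else 0) * (if g y = k then sqrt (b (g y)) else 0))"
  proof -
    have "(\<Sum>k\<in>Y. (if g x = k then sqrt (b (g x)) else 0) * (if g y = k then sqrt (b (g y)) else 0))
       = (\<Sum>k\<in>Y. if g x = k then (if g x = g y then sqrt (b (g x)) * sqrt (b (g x)) else 0) else 0)"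
      by (intro sum.cong) auto
    also have "\<dots> = (if g x = g y then b (g x) else 0)"
      using assms xy by simp
    finally show ?thesis by simp
  qed
qed

section \<open>Laplace transforms of Gaussian quadratic forms\<close>

abbreviation gauss :: "'i set \<Rightarrow> ('i \<Rightarrow> real) measure" where
  "gauss X \<equiv> Pi\<^sub>M X (\<lambda>_. std_normal_distribution)"

lemma measurable_gauss_component:
  "x \<in> X \<Longrightarrow> (\<lambda>g. g x) \<in> borel_measurable (gauss X)"
  using measurable_component_singleton[of x X "\<lambda>_. std_normal_distribution"] by simp

lemma prob_space_std_normal: "prob_space std_normal_distribution"
  using real_dist_normal_dist by (simp add: real_distribution_def)

lemma prob_space_gauss: "prob_space (gauss X)"
  by (intro prob_space_PiM prob_space_std_normal)

lemma integral_iexp_std_normal: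
  "(\<integral>x. iexp (t * x) \<partial>std_normal_distribution) = of_real (exp (- t\<^sup>2 / 2))"
  using char_std_normal_distribution by (simp add: char_def fun_eq_iff)

lemma integral_gauss_prod:
  fixes f :: "'i \<Rightarrow> real \<Rightarrow> 'b::{real_normed_field,banach,second_countable_topology}"
  assumes "finite X" "\<And>x. x \<in> X \<Longrightarrow> integrable std_normal_distribution (f x)"
  shows "(\<integral>g. (\<Prod>x\<in>X. f x (g x)) \<partial>gauss X) = (\<Prod>x\<in>X. \<integral>t. f x t \<partial>std_normal_distribution)"
proof -
  interpret product_prob_space "\<lambda>_. std_normal_distribution" X
    by (intro product_prob_spaceI prob_space_std_normal)
  show ?thesis using assms by (rule product_integral_prod)
qed

lemma char_gauss:
  assumes "finite X"
  shows "(\<integral>g. iexp (\<Sum>x\<in>X. c x * g x) \<partial>gauss X) = of_real (exp (- (\<Sum>x\<in>X. (c x)\<^sup>2) / 2))"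
proof -
  interpret std: prob_space std_normal_distribution by (rule prob_space_std_normal)
  have int: "integrable std_normal_distribution (\<lambda>t. iexp (c x * t))" for x
    by (rule std.integrable_const_bound[where B=1]) auto
  have "(\<integral>g. iexp (\<Sum>x\<in>X. c x * g x) \<partial>gauss X) = (\<integral>g. (\<Prod>x\<in>X. iexp (c x * g x)) \<partial>gauss X)"
    by (simp add: exp_sum[OF assms] sum_distrib_left)
  also have "\<dots> = (\<Prod>x\<in>X. \<integral>t. iexp (c x * t) \<partial>std_normal_distribution)"
    by (rule integral_gauss_prod[OF assms int])
  also have "\<dots> = (\<Prod>x\<in>X. of_real (exp (- (c x)\<^sup>2 / 2)))"
    by (simp only: integral_iexp_std_normal)
  also have "\<dots> = of_real (exp (\<Sum>x\<in>X. - (c x)\<^sup>2 / 2))"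
    by (simp add: exp_sum[OF assms])
  finally show ?thesis by (simp add: sum_negf sum_divide_distrib)
qed

text \<open>Both sides are the mean of \<open>exp (\<i> \<Sum>x s x g x Y x)\<close> over independent \<open>Y\<close> and \<open>g\<close>:
  integrating over \<open>g\<close> first gives the left one, integrating over \<open>Y\<close> first the right one.\<close>

lemma laplace_eq_gauss:
  fixes Y :: "'i \<Rightarrow> 'w \<Rightarrow> real"
  assumes P: "prob_space P" and X: "finite X"
    and Y [measurable]: "\<And>x. x \<in> X \<Longrightarrow> Y x \<in> borel_measurable P"
    and ch: "\<And>c. (\<integral>\<omega>. iexp (\<Sum>x\<in>X. c x * Y x \<omega>) \<partial>P)
               = of_real (exp (- (\<Sum>x\<in>X. \<Sum>y\<in>X. c x * c y * K x y) / 2))"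
  shows "(\<integral>\<omega>. exp (- (\<Sum>x\<in>X. (s x * Y x \<omega>)\<^sup>2) / 2) \<partial>P)
       = (\<integral>g. exp (- (\<Sum>x\<in>X. \<Sum>y\<in>X. (s x * g x) * (s y * g y) * K x y) / 2) \<partial>gauss X)"
proof -
  interpret P: prob_space P by fact
  interpret G: prob_space "gauss X" by (rule prob_space_gauss)
  interpret PG: pair_prob_space P "gauss X" ..
  have [measurable]: "(\<lambda>z. snd z x) \<in> borel_measurable (P \<Otimes>\<^sub>M gauss X)" if "x \<in> X" for x
    using measurable_compose[OF measurable_snd measurable_gauss_component[OF that]] .
  have "(\<lambda>z. \<Sum>x\<in>X. s x * snd z x * Y x (fst z)) \<in> borel_measurable (P \<Otimes>\<^sub>M gauss X)"
    by (intro borel_measurable_sum borel_measurable_times) measurable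
  then have meas: "(\<lambda>z. iexp (\<Sum>x\<in>X. s x * snd z x * Y x (fst z))) \<in> borel_measurable (P \<Otimes>\<^sub>M gauss X)"
    by measurable
  have int: "integrable (P \<Otimes>\<^sub>M gauss X) (\<lambda>(\<omega>, g). iexp (\<Sum>x\<in>X. s x * g x * Y x \<omega>))"
    by (rule PG.integrable_const_bound[where B=1]) (use meas in \<open>auto simp: split_beta\<close>)
  have "of_real (\<integral>\<omega>. exp (- (\<Sum>x\<in>X. (s x * Y x \<omega>)\<^sup>2) / 2) \<partial>P)
      = (\<integral>\<omega>. (\<integral>g. iexp (\<Sum>x\<in>X. s x * Y x \<omega> * g x) \<partial>gauss X) \<partial>P)"
    by (simp only: char_gauss[OF X] integral_complex_of_real)
  also have "\<dots> = (\<integral>\<omega>. (\<integral>g. iexp (\<Sum>x\<in>X. s x * g x * Y x \<omega>) \<partial>gauss X) \<partial>P)"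
    by (simp only: mult.commute mult.left_commute)
  also have "\<dots> = (\<integral>g. (\<integral>\<omega>. iexp (\<Sum>x\<in>X. s x * g x * Y x \<omega>) \<partial>P) \<partial>gauss X)"
    by (rule PG.Fubini_integral[OF int, symmetric])
  also have "\<dots> = of_real (\<integral>g. exp (- (\<Sum>x\<in>X. \<Sum>y\<in>X. (s x * g x) * (s y * g y) * K x y) / 2) \<partial>gauss X)"
    by (simp only: ch integral_complex_of_real)
  finally show ?thesis by (simp only: of_real_eq_iff)
qed

lemma integral_exp_square_std_normal:
  assumes "0 \<le> (b::real)"
  shows "(\<integral>t. exp (- (b * t\<^sup>2) / 2) \<partial>std_normal_distribution) = 1 / sqrt (1 + b)"
proof -
  \<comment> \<open>Merging the quadratic term into the exponent of the density raises the precision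
    from 1 to \<open>1 + b\<close>. So the integrand is a multiple of the normal density with this
    standard deviation, and the quotient of the normalizing constants is \<open>\<sigma>\<close>
    itself.\<close>
  define \<sigma> where "\<sigma> = 1 / sqrt (1 + b)"
  have \<sigma>: "\<sigma> > 0" "\<sigma>\<^sup>2 = 1 / (1 + b)" using assms by (auto simp: \<sigma>_def power_divide)
  have "(\<integral>t. exp (- (b * t\<^sup>2) / 2) \<partial>std_normal_distribution)
     = (LBINT t. std_normal_density t * exp (- (b * t\<^sup>2) / 2))"
    by (subst integral_density) auto
  also have "\<dots> = (LBINT t. \<sigma> * normal_density 0 \<sigma> t)"
  proof (rule Bochner_Integration.integral_cong[OF refl])
    fix t :: real
    have e: "- t\<^sup>2 / 2 + - (b * t\<^sup>2) / 2 = - t\<^sup>2 / (2 * \<sigma>\<^sup>2)"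
      using assms by (simp add: \<sigma> field_simps)
    have "std_normal_density t * exp (- (b * t\<^sup>2) / 2) = 1 / sqrt (2 * pi) * exp (- t\<^sup>2 / (2 * \<sigma>\<^sup>2))"
      unfolding std_normal_density_def e[symmetric] by (simp add: exp_add[symmetric])
    also have "\<dots> = \<sigma> * normal_density 0 \<sigma> t"
      using \<sigma>(1) by (simp add: normal_density_def real_sqrt_mult)
    finally show "std_normal_density t * exp (- (b * t\<^sup>2) / 2) = \<sigma> * normal_density 0 \<sigma> t" .
  qed
  also have "\<dots> = \<sigma>" using \<sigma> by simp
  finally show ?thesis by (simp add: \<sigma>_def)
qed

lemma integral_gauss_diag:
  assumes "finite X" "\<And>x. x \<in> X \<Longrightarrow> 0 \<le> b x"
  shows "(\<integral>g. exp (- (\<Sum>x\<in>X. b x * (g x)\<^sup>2) / 2) \<partial>gauss X) = (\<Prod>x\<in>X. 1 / sqrt (1 + b x))"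
proof -
  interpret std: prob_space std_normal_distribution by (rule prob_space_std_normal)
  have int: "integrable std_normal_distribution (\<lambda>t. exp (- (b x * t\<^sup>2) / 2))" if "x \<in> X" for x
    by (rule std.integrable_const_bound[where B=1]) (use assms that in auto)
  have "(\<integral>g. exp (- (\<Sum>x\<in>X. b x * (g x)\<^sup>2) / 2) \<partial>gauss X)
     = (\<integral>g. (\<Prod>x\<in>X. exp (- (b x * (g x)\<^sup>2) / 2)) \<partial>gauss X)"
    by (simp add: exp_sum[OF assms(1), symmetric] sum_negf sum_divide_distrib)
  also have "\<dots> = (\<Prod>x\<in>X. \<integral>t. exp (- (b x * t\<^sup>2) / 2) \<partial>std_normal_distribution)"
    by (rule integral_gauss_prod[OF assms(1) int])
  also have "\<dots> = (\<Prod>x\<in>X. 1 / sqrt (1 + b x))"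
    by (intro prod.cong refl integral_exp_square_std_normal assms)
  finally show ?thesis .
qed

lemma integral_gauss_mono:
  fixes f h :: "('i \<Rightarrow> real) \<Rightarrow> real"
  assumes X: "finite X" and f: "f \<in> borel_measurable (gauss X)" and h: "h \<in> borel_measurable (gauss X)"
    and le: "\<And>g. 0 \<le> f g" "\<And>g. f g \<le> h g"
  shows "(\<integral>g. exp (- h g / 2) \<partial>gauss X) \<le> (\<integral>g. exp (- f g / 2) \<partial>gauss X)"
proof -
  interpret G: prob_space "gauss X" by (rule prob_space_gauss)
  have *: "integrable (gauss X) (\<lambda>g. exp (- f g / 2))" if "\<And>g. 0 \<le> f g" "f \<in> borel_measurable (gauss X)"
    for f :: "('i \<Rightarrow> real) \<Rightarrow> real"
  proof (rule G.integrable_const_bound[where B=1])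
    show "AE g in gauss X. norm (exp (- f g / 2)) \<le> 1"
      by (intro AE_I2) (simp add: that(1))
    show "(\<lambda>g. exp (- f g / 2)) \<in> borel_measurable (gauss X)"
      using that(2) by measurable
  qed
  have "0 \<le> h g" for g by (rule order_trans[OF le])
  moreover have "exp (- h g / 2) \<le> exp (- f g / 2)" for g
    using le(2)[of g] by simp
  ultimately show ?thesis
    by (intro integral_mono * f h le)
qed

text \<open>A smaller covariance form makes the exponential larger, and for a diagonal form the
  coordinates of \<open>g\<close> decouple.\<close>

lemma laplace_le_diag:
  assumes X: "finite X" and b: "\<And>x. x \<in> X \<Longrightarrow> 0 \<le> b x"
    and psd: "psd X (\<lambda>x y. K x y - (if x = y then b x else 0))"
  shows "(\<integral>g. exp (- (\<Sum>x\<in>X. \<Sum>y\<in>X. (s x * g x) * (s y * g y) * K x y) / 2) \<partial>gauss X)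
      \<le> (\<Prod>x\<in>X. 1 / sqrt (1 + (s x)\<^sup>2 * b x))"
proof -
  note measurable_gauss_component [measurable]
  have diag: "(\<Sum>x\<in>X. \<Sum>y\<in>X. c x * c y * (if x = y then b x else 0)) = (\<Sum>x\<in>X. b x * (c x)\<^sup>2)" for c
    using X by (simp add: if_distrib[of "\<lambda>t. _ * t"] power2_eq_square ac_simps cong: if_cong)
  have "(\<integral>g. exp (- (\<Sum>x\<in>X. \<Sum>y\<in>X. (s x * g x) * (s y * g y) * K x y) / 2) \<partial>gauss X)
      \<le> (\<integral>g. exp (- (\<Sum>x\<in>X. b x * (s x * g x)\<^sup>2) / 2) \<partial>gauss X)"
  proof (rule integral_gauss_mono[OF X])
    fix g
    show "0 \<le> (\<Sum>x\<in>X. b x * (s x * g x)\<^sup>2)" using b by (intro sum_nonneg) auto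
    show "(\<Sum>x\<in>X. b x * (s x * g x)\<^sup>2) \<le> (\<Sum>x\<in>X. \<Sum>y\<in>X. (s x * g x) * (s y * g y) * K x y)"
      using psd[unfolded psd_def, rule_format, of "\<lambda>x. s x * g x"]
      by (simp add: right_diff_distrib sum_subtractf diag)
  qed measurable
  also have "\<dots> = (\<integral>g. exp (- (\<Sum>x\<in>X. ((s x)\<^sup>2 * b x) * (g x)\<^sup>2) / 2) \<partial>gauss X)"
    by (simp add: power_mult_distrib ac_simps)
  also have "\<dots> = (\<Prod>x\<in>X. 1 / sqrt (1 + (s x)\<^sup>2 * b x))"
    using b by (intro integral_gauss_diag X) auto
  finally show ?thesis .
qed

text \<open>A Gram majorant of the covariance is itself the covariance of a linear image of a standard
  Gaussian vector, so the preceding exchange of integrals transposes it.\<close>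

lemma laplace_ge_diag:
  fixes e :: "'k \<Rightarrow> 'i \<Rightarrow> real"
  assumes X: "finite X" and Z: "finite Z" and b: "\<And>k. k \<in> Z \<Longrightarrow> 0 \<le> b k"
    and psdK: "psd X K"
    and psd: "psd X (\<lambda>x y. (\<Sum>k\<in>Z. e k x * e k y) - K x y)"
    and le: "\<And>\<xi>. (\<Sum>x\<in>X. (s x)\<^sup>2 * (\<Sum>k\<in>Z. e k x * \<xi> k)\<^sup>2) \<le> (\<Sum>k\<in>Z. b k * (\<xi> k)\<^sup>2)"
  shows "(\<Prod>k\<in>Z. 1 / sqrt (1 + b k))
    \<le> (\<integral>g. exp (- (\<Sum>x\<in>X. \<Sum>y\<in>X. (s x * g x) * (s y * g y) * K x y) / 2) \<partial>gauss X)"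
proof -
  note measurable_gauss_component [measurable]
  have "(\<Prod>k\<in>Z. 1 / sqrt (1 + b k)) = (\<integral>\<xi>. exp (- (\<Sum>k\<in>Z. b k * (\<xi> k)\<^sup>2) / 2) \<partial>gauss Z)"
    by (rule integral_gauss_diag[OF Z b, symmetric])
  also have "\<dots> \<le> (\<integral>\<xi>. exp (- (\<Sum>x\<in>X. (s x * (\<Sum>k\<in>Z. e k x * \<xi> k))\<^sup>2) / 2) \<partial>gauss Z)"
    by (intro integral_gauss_mono Z) (auto simp: power_mult_distrib intro!: le sum_nonneg)
  also have "\<dots> = (\<integral>g. exp (- (\<Sum>x\<in>X. \<Sum>y\<in>X. (s x * g x) * (s y * g y) * (\<Sum>k\<in>Z. e k x * e k y)) / 2) \<partial>gauss X)"
  proof (rule laplace_eq_gauss[OF prob_space_gauss X])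
    fix c :: "'i \<Rightarrow> real"
    have "(\<Sum>x\<in>X. c x * (\<Sum>k\<in>Z. e k x * \<xi> k)) = (\<Sum>k\<in>Z. (\<Sum>x\<in>X. c x * e k x) * \<xi> k)" for \<xi> :: "'k \<Rightarrow> real"
    proof -
      have "(\<Sum>x\<in>X. c x * (\<Sum>k\<in>Z. e k x * \<xi> k)) = (\<Sum>x\<in>X. \<Sum>k\<in>Z. c x * e k x * \<xi> k)"
        by (simp add: sum_distrib_left ac_simps)
      also have "\<dots> = (\<Sum>k\<in>Z. \<Sum>x\<in>X. c x * e k x * \<xi> k)" by (rule sum.swap)
      finally show ?thesis by (simp add: sum_distrib_right)
    qed
    then show "(\<integral>\<xi>. iexp (\<Sum>x\<in>X. c x * (\<Sum>k\<in>Z. e k x * \<xi> k)) \<partial>gauss Z)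
        = of_real (exp (- (\<Sum>x\<in>X. \<Sum>y\<in>X. c x * c y * (\<Sum>k\<in>Z. e k x * e k y)) / 2))"
      by (simp only: char_gauss[OF Z] sum_quadratic_eq_gram)
  qed measurable
  \<comment> \<open>The transposition has led from the coordinates \<open>\<xi>\<close> back to
    \<open>X\<close>, where the Gram kernel may be lowered to \<open>K\<close>.\<close>
  also have "\<dots> \<le> (\<integral>g. exp (- (\<Sum>x\<in>X. \<Sum>y\<in>X. (s x * g x) * (s y * g y) * K x y) / 2) \<partial>gauss X)"
  proof (rule integral_gauss_mono[OF X])
    fix g
    show "0 \<le> (\<Sum>x\<in>X. \<Sum>y\<in>X. (s x * g x) * (s y * g y) * K x y)"
      using psdK[unfolded psd_def, rule_format, of "\<lambda>x. s x * g x"] .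
    show "(\<Sum>x\<in>X. \<Sum>y\<in>X. (s x * g x) * (s y * g y) * K x y)
       \<le> (\<Sum>x\<in>X. \<Sum>y\<in>X. (s x * g x) * (s y * g y) * (\<Sum>k\<in>Z. e k x * e k y))"
      using psd[unfolded psd_def, rule_format, of "\<lambda>x. s x * g x"]
      by (simp add: right_diff_distrib sum_subtractf)
  qed measurable
  finally show ?thesis .
qed

section \<open>Atoms of a degenerately self-similar measure\<close>

locale dss =
  fixes M m :: nat and \<delta> :: real and \<alpha> \<beta> :: "nat \<Rightarrow> real"
  assumes params: "dss_params M m \<delta> \<alpha> \<beta>"
begin

definition a :: real where "a = \<alpha> (m + 1) - \<alpha> m"

definition S :: "real \<Rightarrow> real" where "S t = a * t + \<alpha> m"

definition pos :: "nat \<times> nat \<Rightarrow> real" where "pos u = (S ^^ fst u) (\<alpha> (snd u))"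

text \<open>Jump of the fixed point at \<open>\<alpha> k\<close>. On the \<open>m\<close>-th
  interval the scaled copy of \<open>f\<close> climbs from \<open>0\<close> to
  \<open>\<delta>\<close>, so only the rest of the difference of the \<open>\<beta>\<close> is left
  for the jump at \<open>\<alpha> (m + 1)\<close>.\<close>

definition jump :: "nat \<Rightarrow> real" where
  "jump k = \<beta> k - \<beta> (k - 1) - (if k = m + 1 then \<delta> else 0)"

definition wt :: "nat \<times> nat \<Rightarrow> real" where "wt u = \<delta> ^ fst u * jump (snd u)"

definition gap :: real where "gap = Min ((\<lambda>k. \<alpha> (k + 1) - \<alpha> k) ` {1..M})"

text \<open>Half the distance that an atom of this level keeps from all atoms of the same or deeper
  levels. The extra factor \<open>a\<close> accounts for deeper atoms inside the \<open>m\<close>-th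
  interval, whose distances to its ends are contracted by \<open>S\<close>.\<close>

definition rad :: "nat \<times> nat \<Rightarrow> real" where "rad u = a * gap / 2 * a ^ fst u"

lemma M: "2 \<le> M" and m: "1 \<le> m" "m \<le> M" and \<alpha>1: "\<alpha> 1 = 0" and \<alpha>M: "\<alpha> (M + 1) = 1"
  and \<alpha>_step: "k \<in> {1..M} \<Longrightarrow> \<alpha> k < \<alpha> (k + 1)" and \<delta>: "0 < \<delta>" "\<delta> < 1"
  and \<beta>1: "\<beta> 1 = 0" and \<beta>M: "m < M \<Longrightarrow> \<beta> M = 1" "m = M \<Longrightarrow> \<delta> + \<beta> M = 1"
  and \<beta>_step: "k \<in> {1..M - 1} \<Longrightarrow> \<beta> k < \<beta> (k + 1)"
  and \<beta>m: "m < M \<Longrightarrow> \<delta> + \<beta> m < \<beta> (m + 1)"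
  using params by (auto simp: dss_params_def)

lemma gap_le: "k \<in> {1..M} \<Longrightarrow> gap \<le> \<alpha> (k + 1) - \<alpha> k"
  unfolding gap_def by (intro Min_le) auto

lemma gap_pos: "0 < gap"
  unfolding gap_def using M \<alpha>_step by (subst Min_gr_iff) auto

lemma \<alpha>_gap:
  assumes "1 \<le> i" "i < j" "j \<le> M + 1"
  shows "\<alpha> i + gap \<le> \<alpha> j"
  using assms(2,3)
proof (induct j)
  case (Suc j)
  show ?case
  proof (cases "i = j")
    case True
    then show ?thesis using gap_le[of i] Suc.prems assms(1) by auto
  next
    case False
    then have "\<alpha> i + gap \<le> \<alpha> j" using Suc by auto
    also have "\<alpha> j \<le> \<alpha> (Suc j)" using \<alpha>_step[of j] Suc.prems assms(1) by auto
    finally show ?thesis .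
  qed
qed simp

lemma \<alpha>_mono: "1 \<le> i \<Longrightarrow> i \<le> j \<Longrightarrow> j \<le> M + 1 \<Longrightarrow> \<alpha> i \<le> \<alpha> j"
  using \<alpha>_gap[of i j] gap_pos by (cases "i = j") auto

lemma \<alpha>_bounds: "k \<in> {2..M} \<Longrightarrow> gap \<le> \<alpha> k \<and> \<alpha> k \<le> 1 - gap"
  using \<alpha>_gap[of 1 k] \<alpha>_gap[of k "M + 1"] \<alpha>1 \<alpha>M by auto

lemma \<alpha>m: "0 \<le> \<alpha> m" "\<alpha> (m + 1) \<le> 1"
  using \<alpha>_mono[of 1 m] \<alpha>_mono[of "m + 1" "M + 1"] m \<alpha>1 \<alpha>M by auto

lemma a: "0 < a" "a < 1"
proof -
  show "0 < a" using \<alpha>_step[of m] m by (auto simp: a_def)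
  show "a < 1"
  proof (cases "m = 1")
    case True
    have "\<alpha> (m + 1) - \<alpha> m < 1"
      using True \<alpha>_gap[of 2 "M + 1"] M gap_pos \<alpha>M \<alpha>1 by (auto simp: numeral_2_eq_2)
    then show ?thesis by (simp only: a_def)
  next
    case False
    then show ?thesis using \<alpha>_gap[of 1 m] m \<alpha>1 \<alpha>m gap_pos by (auto simp: a_def)
  qed
qed

section \<open>Orbits under the similarity \<open>S\<close> and separation of the atoms\<close>

lemma S_0: "S 0 = \<alpha> m" and S_1: "S 1 = \<alpha> (m + 1)"
  by (simp_all add: S_def a_def)

lemma S_strict_mono: "s < t \<Longrightarrow> S s < S t"
  using a by (simp add: S_def)

lemma S_unit: "0 < t \<Longrightarrow> t < 1 \<Longrightarrow> 0 < S t \<and> S t < 1"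
  using S_strict_mono[of 0 t] S_strict_mono[of t 1] S_0 S_1 \<alpha>m by simp

lemma S_pow_diff: "(S ^^ n) s - (S ^^ n) t = a ^ n * (s - t)"
proof (induct n)
  case (Suc n)
  have "(S ^^ Suc n) s - (S ^^ Suc n) t = a * ((S ^^ n) s - (S ^^ n) t)"
    by (simp add: S_def[of "(S ^^ n) _"] right_diff_distrib)
  then show ?case using Suc by simp
qed simp

lemma S_pow_unit: "0 < t \<Longrightarrow> t < 1 \<Longrightarrow> 0 < (S ^^ n) t \<and> (S ^^ n) t < 1"
  by (induct n) (auto dest: S_unit)

lemma pos_unit: "snd u \<in> {2..M} \<Longrightarrow> 0 < pos u \<and> pos u < 1"
  unfolding pos_def using \<alpha>_bounds[of "snd u"] gap_pos by (intro S_pow_unit) auto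

lemma rad_pos: "0 < rad u"
  using a gap_pos by (simp add: rad_def)

lemma rad_le_pos:
  assumes "snd u \<in> {2..M}"
  shows "rad u \<le> pos u"
proof -
  have ge: "a ^ n * t \<le> (S ^^ n) t" for n t
  proof (induct n)
    case (Suc n)
    have "a ^ Suc n * t \<le> a * (S ^^ n) t" using Suc a by simp
    also have "\<dots> \<le> S ((S ^^ n) t)" using \<alpha>m by (simp add: S_def[of "(S ^^ n) t"])
    finally show ?case by simp
  qed simp
  have "rad u = a ^ fst u * (a * gap / 2)" by (simp add: rad_def)
  also have "\<dots> \<le> a ^ fst u * \<alpha> (snd u)"
  proof (intro mult_left_mono)
    have "a * gap \<le> 1 * gap" using a gap_pos by (intro mult_right_mono) auto
    then show "a * gap / 2 \<le> \<alpha> (snd u)" using \<alpha>_bounds[OF assms] gap_pos by linarith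
  qed (use a in auto)
  finally show ?thesis using ge[of "fst u" "\<alpha> (snd u)"] by (simp add: pos_def)
qed

text \<open>After one step an orbit lies between \<open>\<alpha> m\<close> and
  \<open>\<alpha> (m + 1)\<close>. This interval stays away from \<open>0\<close> unless
  \<open>m = 1\<close> and from \<open>1\<close> unless \<open>m = M\<close>.\<close>

lemma orbit_gap:
  assumes k: "k \<in> {2..M}"
  shows "1 < m \<Longrightarrow> gap \<le> (S ^^ n) (\<alpha> k)" "m < M \<Longrightarrow> (S ^^ n) (\<alpha> k) \<le> 1 - gap"
proof -
  have u: "0 < (S ^^ n) (\<alpha> k) \<and> (S ^^ n) (\<alpha> k) < 1" for n
    using \<alpha>_bounds[OF k] gap_pos by (intro S_pow_unit) auto
  show "gap \<le> (S ^^ n) (\<alpha> k)" if "1 < m"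
  proof (cases n)
    case 0
    then show ?thesis using \<alpha>_bounds[OF k] by simp
  next
    case (Suc n')
    have "gap \<le> \<alpha> m" using \<alpha>_gap[of 1 m] that m \<alpha>1 by simp
    also have "\<dots> \<le> S ((S ^^ n') (\<alpha> k))" using S_strict_mono[of 0] u[of n'] S_0 by (simp add: less_imp_le)
    finally show ?thesis using Suc by simp
  qed
  show "(S ^^ n) (\<alpha> k) \<le> 1 - gap" if "m < M"
  proof (cases n)
    case 0
    then show ?thesis using \<alpha>_bounds[OF k] by simp
  next
    case (Suc n')
    have "S ((S ^^ n') (\<alpha> k)) \<le> \<alpha> (m + 1)" using S_strict_mono[of _ 1] u[of n'] S_1 by (simp add: less_imp_le)
    also have "\<dots> \<le> 1 - gap" using \<alpha>_gap[of "m + 1" "M + 1"] that \<alpha>M by simp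
    finally show ?thesis using Suc by simp
  qed
qed

text \<open>A deeper atom lies inside the \<open>m\<close>-th interval and \<open>\<alpha> k\<close>
  does not. If \<open>k \<le> m\<close>, then \<open>2 \<le> k\<close> excludes
  \<open>m = 1\<close>; otherwise \<open>k \<le> M\<close> excludes \<open>m = M\<close>. In either
  case \<open>orbit_gap\<close> bounds the distance of the preceding orbit point from the critical
  endpoint, and \<open>S\<close> shrinks that distance by \<open>a\<close>.\<close>

lemma level0_gap:
  assumes k: "k \<in> {2..M}" and l: "l \<in> {2..M}" and ne: "q > 0 \<or> k \<noteq> l"
  shows "a * gap \<le> \<bar>(S ^^ q) (\<alpha> l) - \<alpha> k\<bar>"
proof (cases q)
  case 0
  have "a * gap \<le> 1 * gap" using a gap_pos by (intro mult_right_mono) auto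
  moreover have "gap \<le> \<bar>\<alpha> l - \<alpha> k\<bar>"
    using 0 ne k l \<alpha>_gap[of k l] \<alpha>_gap[of l k] by (cases "k < l") auto
  ultimately show ?thesis using 0 by simp
next
  case (Suc q')
  let ?y = "(S ^^ q') (\<alpha> l)"
  show ?thesis
  proof (cases "k \<le> m")
    case True
    then have "gap \<le> ?y" using k by (intro orbit_gap(1) l) auto
    then have "a * gap \<le> a * ?y" using a by simp
    moreover have "\<alpha> k \<le> \<alpha> m" using True k m by (intro \<alpha>_mono) auto
    ultimately show ?thesis using Suc by (simp add: S_def)
  next
    case False
    then have "?y \<le> 1 - gap" using k by (intro orbit_gap(2) l) auto
    then have "a * ?y \<le> a * (1 - gap)" using a by simp
    moreover have "\<alpha> (m + 1) \<le> \<alpha> k" using False k m by (intro \<alpha>_mono) auto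
    ultimately show ?thesis using Suc by (simp add: S_def a_def algebra_simps)
  qed
qed

text \<open>Undoing the common power of \<open>S\<close>, which scales distances by
  \<open>a ^ fst u\<close>, moves the shallower atom to level 0. Its radius is the larger of the
  two.\<close>

lemma pos_separated:
  assumes u: "snd u \<in> {2..M}" and v: "snd v \<in> {2..M}" and ne: "u \<noteq> v"
  shows "rad u + rad v \<le> \<bar>pos u - pos v\<bar>"
proof -
  have main: "rad u + rad v \<le> \<bar>pos u - pos v\<bar>"
    if "snd u \<in> {2..M}" "snd v \<in> {2..M}" "u \<noteq> v" "fst u \<le> fst v" for u v
  proof -
    define q where "q = fst v - fst u"
    have v: "fst v = fst u + q" using that by (simp add: q_def)
    have "pos v - pos u = a ^ fst u * ((S ^^ q) (\<alpha> (snd v)) - \<alpha> (snd u))"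
      unfolding pos_def v funpow_add comp_apply by (rule S_pow_diff)
    then have "\<bar>pos u - pos v\<bar> = a ^ fst u * \<bar>(S ^^ q) (\<alpha> (snd v)) - \<alpha> (snd u)\<bar>"
      using a by (metis abs_minus_commute abs_mult abs_of_pos zero_less_power)
    also have "\<dots> \<ge> a ^ fst u * (a * gap)"
      using that a by (intro mult_left_mono level0_gap) (auto simp: q_def prod_eq_iff)
    finally have *: "a ^ fst u * (a * gap) \<le> \<bar>pos u - pos v\<bar>" .
    have "a ^ fst v \<le> a ^ fst u" using a that by (intro power_decreasing) auto
    then have "rad v \<le> rad u"
      unfolding rad_def using a gap_pos by (intro mult_left_mono) auto
    then show ?thesis using * by (simp add: rad_def ac_simps)
  qed
  show ?thesis
    using main[of u v] main[of v u] u v ne by (cases "fst u \<le> fst v") auto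
qed

lemma pos_inj: "inj_on pos (UNIV \<times> {2..M})"
proof (rule inj_onI, rule ccontr)
  fix u v assume "u \<in> UNIV \<times> {2..M}" "v \<in> UNIV \<times> {2..M}" "pos u = pos v" "u \<noteq> v"
  then show False
    using pos_separated[of u v] rad_pos[of u] rad_pos[of v] by auto
qed

section \<open>Masses of the atoms\<close>

lemma jump_pos:
  assumes "k \<in> {2..M}"
  shows "0 < jump k"
proof (cases "k = m + 1")
  case True
  then show ?thesis using \<beta>m assms by (auto simp: jump_def)
next
  case False
  have "\<beta> (k - 1) < \<beta> (k - 1 + 1)" using assms by (intro \<beta>_step) auto
  then show ?thesis using False assms by (auto simp: jump_def)
qed

lemma sum_jump:
  assumes "1 \<le> K" "K \<le> M"
  shows "(\<Sum>k\<in>{2..K}. jump k) = \<beta> K - (if m < K then \<delta> else 0)"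
  using assms
proof (induct K rule: nat_induct_at_least)
  case base
  then show ?case using \<beta>1 m by simp
next
  case (Suc n)
  have "{2..Suc n} = insert (Suc n) {2..n}" using Suc by auto
  then show ?case using Suc m by (auto simp: jump_def)
qed

text \<open>Both normalizations of \<open>\<beta> M\<close> give the same total: for
  \<open>m < M\<close> the number \<open>\<delta>\<close> is taken off at \<open>k = m + 1\<close>,
  for \<open>m = M\<close> it is already missing from \<open>\<beta> M\<close>.\<close>

lemma sum_jump_total: "(\<Sum>k\<in>{2..M}. jump k) = 1 - \<delta>"
  using sum_jump[of M] M m \<beta>M by (cases "m = M") auto

lemma wt_pos: "snd u \<in> {2..M} \<Longrightarrow> 0 < wt u"
  using jump_pos \<delta> by (simp add: wt_def)

lemma sum_wt: "(\<Sum>u\<in>{..<N} \<times> {2..M}. wt u) = 1 - \<delta> ^ N"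
proof -
  have "(\<Sum>u\<in>{..<N} \<times> {2..M}. wt u) = (\<Sum>n<N. \<delta> ^ n) * (\<Sum>k\<in>{2..M}. jump k)"
    by (simp add: sum_product sum.cartesian_product wt_def case_prod_unfold)
  also have "\<dots> = 1 - \<delta> ^ N"
    using \<delta> by (simp add: sum_jump_total sum_gp_strict)
  finally show ?thesis .
qed

end

section \<open>The one-dimensional covariance\<close>

text \<open>With truncated subtraction the exponent is the distance between \<open>n\<close> and
  \<open>j\<close>, so there is one geometric series on each side of \<open>n\<close>.\<close>

lemma sum_power_dist_le:
  fixes s :: real
  assumes s: "0 < s" "s < 1"
  shows "(\<Sum>j<N. s ^ ((n - j) + (j - n))) \<le> 2 / (1 - s)"
proof -
  let ?f = "\<lambda>j. s ^ ((n - j) + (j - n))"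
  have geom: "(\<Sum>i<K. s ^ i) \<le> 1 / (1 - s)" for K
    using s by (simp add: sum_gp_strict divide_simps)
  \<comment> \<open>The range is enlarged so that it splits at \<open>n\<close> even when
    \<open>N \<le> n\<close>; the index \<open>n\<close> is afterwards counted twice.\<close>
  have "sum ?f {..<N} \<le> sum ?f ({..<Suc n} \<union> {n..<n + N})"
    using s by (intro sum_mono2) auto
  also have "\<dots> \<le> sum ?f ({..<Suc n} \<union> {n..<n + N}) + sum ?f ({..<Suc n} \<inter> {n..<n + N})"
    using s by (simp add: sum_nonneg)
  also have "\<dots> = sum ?f {..<Suc n} + sum ?f {n..<n + N}"
    by (intro sum.union_inter) auto
  also have "sum ?f {..<Suc n} = (\<Sum>i<Suc n. s ^ (Suc n - Suc i))"
    by (intro sum.cong) auto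
  also have "\<dots> = (\<Sum>i<Suc n. s ^ i)"
    by (rule sum.nat_diff_reindex)
  also have "sum ?f {n..<n + N} = (\<Sum>i<N. s ^ i)"
    by (simp add: sum.atLeastLessThan_shift_0[of _ n] atLeast0LessThan)
  also have "(\<Sum>i<Suc n. s ^ i) + (\<Sum>i<N. s ^ i) \<le> 1 / (1 - s) + 1 / (1 - s)"
    by (intro add_mono geom)
  finally show ?thesis by simp
qed

text \<open>Schur's test. Since twice a maximum is the sum plus the distance,
  \<open>(s\<^sup>2) ^ max p q\<close> equals \<open>s ^ p * s ^ q\<close> times \<open>s\<close> to
  the distance of \<open>p\<close> and \<open>q\<close>. The first two factors go into the vector,
  and the remaining kernel has bounded row sums. The base is a square so that the decay can be
  shared in this way.\<close>

lemma max_form_le: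
  fixes s :: real and z :: "nat \<times> 'k \<Rightarrow> real"
  assumes s: "0 < s" "s < 1" and K: "finite K" and z: "\<And>k. 0 \<le> z k"
  shows "(\<Sum>k\<in>{..<N} \<times> K. \<Sum>l\<in>{..<N} \<times> K. z k * z l * (s\<^sup>2) ^ max (fst k) (fst l))
      \<le> 2 * card K / (1 - s) * (\<Sum>k\<in>{..<N} \<times> K. (s\<^sup>2) ^ fst k * (z k)\<^sup>2)"
proof -
  let ?X = "{..<N} \<times> K"
  define d where "d k l = s ^ ((fst k - fst l) + (fst l - fst k))" for k l :: "nat \<times> 'k"
  define y where "y k = z k * s ^ fst k" for k
  have [simp]: "finite ?X" using K by simp
  have term_eq: "z k * z l * (s\<^sup>2) ^ max (fst k) (fst l) = y k * y l * d k l" for k l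
  proof -
    have "2 * max (fst k) (fst l) = fst k + fst l + ((fst k - fst l) + (fst l - fst k))"
      by auto
    then have "(s\<^sup>2) ^ max (fst k) (fst l) = s ^ fst k * s ^ fst l * d k l"
      by (simp only: d_def power_mult[symmetric] power_add)
    then show ?thesis by (simp add: y_def)
  qed
  have y2: "(y k)\<^sup>2 = (s\<^sup>2) ^ fst k * (z k)\<^sup>2" for k
    by (simp add: y_def power_mult_distrib power_mult[symmetric] mult.commute)
  have le: "y k * y l * d k l \<le> ((y k)\<^sup>2 * d k l + (y l)\<^sup>2 * d l k) / 2" for k l
  proof -
    have "2 * (y k * y l) * d k l \<le> ((y k)\<^sup>2 + (y l)\<^sup>2) * d k l"
      using sum_squares_bound[of "y k" "y l"] s by (intro mult_right_mono) (auto simp: d_def)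
    moreover have "d l k = d k l" by (simp add: d_def add.commute)
    ultimately show ?thesis by (simp add: algebra_simps)
  qed
  have row: "(\<Sum>l\<in>?X. d k l) \<le> 2 * card K / (1 - s)" for k
  proof -
    have "(\<Sum>l\<in>?X. d k l) = card K * (\<Sum>j<N. s ^ ((fst k - j) + (j - fst k)))"
      by (simp add: sum.cartesian_product' d_def sum_distrib_left)
    also have "\<dots> \<le> card K * (2 / (1 - s))"
      by (intro mult_left_mono sum_power_dist_le s) auto
    finally show ?thesis by (simp add: mult.commute)
  qed
  have "(\<Sum>k\<in>?X. \<Sum>l\<in>?X. z k * z l * (s\<^sup>2) ^ max (fst k) (fst l))
      \<le> (\<Sum>k\<in>?X. \<Sum>l\<in>?X. ((y k)\<^sup>2 * d k l + (y l)\<^sup>2 * d l k) / 2)"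
    unfolding term_eq by (intro sum_mono le)
  also have "\<dots> = ((\<Sum>k\<in>?X. \<Sum>l\<in>?X. (y k)\<^sup>2 * d k l) + (\<Sum>k\<in>?X. \<Sum>l\<in>?X. (y l)\<^sup>2 * d l k)) / 2"
    by (simp add: sum_divide_distrib sum.distrib add_divide_distrib)
  also have "(\<Sum>k\<in>?X. \<Sum>l\<in>?X. (y l)\<^sup>2 * d l k) = (\<Sum>k\<in>?X. \<Sum>l\<in>?X. (y k)\<^sup>2 * d k l)"
    by (rule sum.swap)
  also have "((\<Sum>k\<in>?X. \<Sum>l\<in>?X. (y k)\<^sup>2 * d k l) + (\<Sum>k\<in>?X. \<Sum>l\<in>?X. (y k)\<^sup>2 * d k l)) / 2
     = (\<Sum>k\<in>?X. (y k)\<^sup>2 * (\<Sum>l\<in>?X. d k l))"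
    unfolding sum_distrib_left[symmetric] by simp
  also have "\<dots> \<le> (\<Sum>k\<in>?X. (y k)\<^sup>2 * (2 * card K / (1 - s)))"
    by (intro sum_mono mult_left_mono row) auto
  also have "\<dots> = 2 * card K / (1 - s) * (\<Sum>k\<in>?X. (s\<^sup>2) ^ fst k * (z k)\<^sup>2)"
    by (simp only: y2 sum_distrib_left mult.commute)
  finally show ?thesis .
qed

lemma abs_quadratic_le:
  fixes c :: "'i \<Rightarrow> real"
  assumes "\<And>k l. k \<in> X \<Longrightarrow> l \<in> X \<Longrightarrow> \<bar>A k l\<bar> \<le> B k l"
  shows "(\<Sum>k\<in>X. \<Sum>l\<in>X. c k * c l * A k l) \<le> (\<Sum>k\<in>X. \<Sum>l\<in>X. \<bar>c k\<bar> * \<bar>c l\<bar> * B k l)"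
proof (intro sum_mono)
  fix k l assume "k \<in> X" "l \<in> X"
  have "c k * c l * A k l \<le> \<bar>c k * c l * A k l\<bar>" by simp
  also have "\<dots> = \<bar>c k\<bar> * \<bar>c l\<bar> * \<bar>A k l\<bar>" by (simp add: abs_mult)
  also have "\<dots> \<le> \<bar>c k\<bar> * \<bar>c l\<bar> * B k l"
    using assms \<open>k \<in> X\<close> \<open>l \<in> X\<close> by (intro mult_left_mono) auto
  finally show "c k * c l * A k l \<le> \<bar>c k\<bar> * \<bar>c l\<bar> * B k l" .
qed

lemma sum_quadratic_transform:
  fixes T :: "'k \<Rightarrow> 'i \<Rightarrow> real"
  shows "(\<Sum>u\<in>X. \<Sum>v\<in>X. c u * c v * (\<Sum>k\<in>Z. \<Sum>l\<in>Z. T k u * T l v * D k l))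
       = (\<Sum>k\<in>Z. \<Sum>l\<in>Z. (\<Sum>u\<in>X. c u * T k u) * (\<Sum>v\<in>X. c v * T l v) * D k l)"
proof -
  have "(\<Sum>u\<in>X. \<Sum>v\<in>X. c u * c v * (\<Sum>k\<in>Z. \<Sum>l\<in>Z. T k u * T l v * D k l))
    = (\<Sum>(u, v)\<in>X \<times> X. \<Sum>(k, l)\<in>Z \<times> Z. (c u * T k u) * (c v * T l v) * D k l)"
    by (simp add: sum.cartesian_product[symmetric] sum_distrib_left ac_simps)
  also have "\<dots> = (\<Sum>(k, l)\<in>Z \<times> Z. \<Sum>(u, v)\<in>X \<times> X. (c u * T k u) * (c v * T l v) * D k l)"
    by (simp only: case_prod_unfold) (rule sum.swap)
  also have "\<dots> = (\<Sum>k\<in>Z. \<Sum>l\<in>Z. \<Sum>u\<in>X. \<Sum>v\<in>X. (c u * T k u) * (c v * T l v) * D k l)"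
    by (simp add: sum.cartesian_product[symmetric])
  also have "\<dots> = (\<Sum>k\<in>Z. \<Sum>l\<in>Z. (\<Sum>u\<in>X. c u * T k u) * (\<Sum>v\<in>X. c v * T l v) * D k l)"
    by (intro sum.cong refl) (subst sum_product, simp add: sum_distrib_right)
  finally show ?thesis .
qed

context dss
begin

section \<open>Increments along a path through the atoms, and the comparisons of kernels\<close>

definition idx :: "nat \<Rightarrow> (nat \<times> nat) set" where "idx N = {..<N} \<times> {2..M}"

lemma finite_idx [simp]: "finite (idx N)"
  by (simp add: idx_def)

lemma sum_idx: "(\<Sum>u\<in>idx N. f u) = (\<Sum>n<N. \<Sum>k\<in>{2..M}. f (n, k))"
  by (simp add: idx_def sum.cartesian_product case_prod_unfold)

text \<open>The path from the origin to the atom \<open>pos (n, k)\<close> runs through the atoms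
  \<open>pos (0, 2), \<dots>, pos (n, 2)\<close>; \<open>pred\<close> is the preceding atom on it, and \<open>chain l u\<close> tells
  whether the step that arrives at \<open>pos l\<close> is used on the way to \<open>pos u\<close>.\<close>

definition chain :: "nat \<times> nat \<Rightarrow> nat \<times> nat \<Rightarrow> real" where
  "chain l u = of_bool (if snd l = 2 then fst l \<le> fst u else l = u)"

definition pred :: "nat \<times> nat \<Rightarrow> real" where
  "pred l = (if snd l = 2 then (if fst l = 0 then 0 else pos (fst l - 1, 2)) else pos (fst l, 2))"

text \<open>The increments of \<open>h\<close> along the path to \<open>pos u\<close> add up. It is
  stated for general \<open>h\<close> because it is applied to \<open>min\<close> in each of its
  variables.\<close>

lemma telescope_chain:
  fixes h :: "real \<Rightarrow> real"
  assumes u: "u \<in> idx N" and h: "h 0 = 0"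
  shows "h (pos u) = (\<Sum>l\<in>idx N. chain l u * (h (pos l) - h (pred l)))"
proof -
  obtain n k where u': "u = (n, k)" "n < N" "k \<in> {2..M}" using u by (cases u) (auto simp: idx_def)
  let ?d = "\<lambda>l. h (pos l) - h (pred l)"
  have tel: "(\<Sum>q\<le>n. ?d (q, 2)) = h (pos (n, 2))" for n
    by (induct n) (auto simp: pred_def h)
  have "(\<Sum>l\<in>idx N. chain l u * ?d l)
      = (\<Sum>q<N. chain (q, 2) u * ?d (q, 2) + (\<Sum>k'\<in>{3..M}. chain (q, k') u * ?d (q, k')))"
  proof -
    have "{2..M} = insert 2 {3..M}" using M by auto
    then show ?thesis by (simp add: sum_idx)
  qed
  also have "\<dots> = (\<Sum>q<N. if q \<le> n then ?d (q, 2) else 0)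
       + (\<Sum>q<N. \<Sum>k'\<in>{3..M}. if q = n then if k' = k then ?d (q, k') else 0 else 0)"
    unfolding sum.distrib by (intro arg_cong2[where f="(+)"] sum.cong refl) (auto simp: chain_def u')
  also have "(\<Sum>q<N. if q \<le> n then ?d (q, 2) else 0) = (\<Sum>q\<in>{..<N} \<inter> {q. q \<le> n}. ?d (q, 2))"
    by (simp add: sum.inter_restrict)
  also have "{..<N} \<inter> {q. q \<le> n} = {..n}" using u' by auto
  also have "(\<Sum>q<N. \<Sum>k'\<in>{3..M}. if q = n then if k' = k then ?d (q, k') else 0 else 0)
      = (\<Sum>q<N. if q = n then (\<Sum>k'\<in>{3..M}. if k' = k then ?d (q, k') else 0) else 0)"
    by (intro sum.cong) auto
  also have "\<dots> = (if k \<in> {3..M} then ?d (n, k) else 0)"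
    using u' by simp
  also have "(\<Sum>q\<le>n. ?d (q, 2)) + (if k \<in> {3..M} then ?d (n, k) else 0) = h (pos u)"
    using u' tel[of n] by (cases "k = 2") (auto simp: pred_def)
  finally show ?thesis by simp
qed

text \<open>A step may link level \<open>n\<close> to level \<open>n + 1\<close>, and then both ends
  lie in the image of the unit interval under \<open>S ^^ n\<close>, of length \<open>a ^ n\<close>.
  The division by \<open>a\<close> pays for this change of level.\<close>

lemma pos_pred_diff:
  assumes "l \<in> idx N"
  shows "\<bar>pos l - pred l\<bar> \<le> a ^ fst l / a" "0 \<le> pred l"
proof -
  have two: "2 \<in> {2..M}" using M by simp
  have l: "snd l \<in> {2..M}" using assms by (auto simp: idx_def)
  show "0 \<le> pred l"
    using pos_unit[of "(_, 2)"] two by (auto simp: pred_def less_imp_le)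
  consider "snd l = 2" "fst l = 0" | n where "snd l = 2" "fst l = Suc n" | "snd l \<noteq> 2"
    using not0_implies_Suc by blast
  then show "\<bar>pos l - pred l\<bar> \<le> a ^ fst l / a"
  proof cases
    case 1
    then show ?thesis using pos_unit[OF l] a by (simp add: pred_def divide_simps mult_le_one)
  next
    case (2 n)
    have "pos l - pred l = (S ^^ n) (S (\<alpha> 2)) - (S ^^ n) (\<alpha> 2)"
      using 2 by (simp add: pred_def pos_def funpow_swap1)
    also have "\<dots> = a ^ n * (S (\<alpha> 2) - \<alpha> 2)" by (rule S_pow_diff)
    finally have "\<bar>pos l - pred l\<bar> = a ^ n * \<bar>S (\<alpha> 2) - \<alpha> 2\<bar>"
      using a by (simp add: abs_mult)
    also have "\<dots> \<le> a ^ n * 1"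
      using a \<alpha>_bounds[OF two] gap_pos S_unit[of "\<alpha> 2"] by (intro mult_left_mono) auto
    finally show ?thesis using 2 a by simp
  next
    case 3
    have "pos l - pred l = a ^ fst l * (\<alpha> (snd l) - \<alpha> 2)"
      using 3 by (simp add: pred_def pos_def S_pow_diff)
    then have "\<bar>pos l - pred l\<bar> = a ^ fst l * \<bar>\<alpha> (snd l) - \<alpha> 2\<bar>"
      using a by (simp add: abs_mult)
    also have "\<dots> \<le> a ^ fst l * 1"
      using a \<alpha>_bounds[OF two] \<alpha>_bounds[OF l] gap_pos by (intro mult_left_mono) auto
    also have "\<dots> \<le> a ^ fst l / a"
      using a by (simp add: divide_simps mult_left_le)
    finally show ?thesis .
  qed
qed

text \<open>Covariance of the increments of a Wiener process from \<open>pred k\<close> to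
  \<open>pos k\<close> and from \<open>pred l\<close> to \<open>pos l\<close>.\<close>

definition incr_cov :: "nat \<times> nat \<Rightarrow> nat \<times> nat \<Rightarrow> real" where
  "incr_cov k l = min (pos k) (pos l) - min (pos k) (pred l) - (min (pred k) (pos l) - min (pred k) (pred l))"

text \<open>Up to sign the covariance is the length of the overlap of two intervals, and the overlap
  is no longer than the shorter one; hence the maximum of the levels.\<close>

lemma incr_cov_bound:
  assumes "k \<in> idx N" "l \<in> idx N"
  shows "\<bar>incr_cov k l\<bar> \<le> a ^ max (fst k) (fst l) / a"
proof -
  have "\<bar>incr_cov k l\<bar> \<le> \<bar>pos k - pred k\<bar>" "\<bar>incr_cov k l\<bar> \<le> \<bar>pos l - pred l\<bar>"
    unfolding incr_cov_def by (auto simp: min_def abs_if)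
  then show ?thesis
    using pos_pred_diff(1)[OF assms(1)] pos_pred_diff(1)[OF assms(2)] by (auto simp: max_def)
qed

lemma min_pos_eq_chain:
  assumes u: "u \<in> idx N" and v: "v \<in> idx N"
  shows "min (pos u) (pos v) = (\<Sum>k\<in>idx N. \<Sum>l\<in>idx N. chain k u * chain l v * incr_cov k l)"
proof -
  have nn: "0 \<le> pos w" if "w \<in> idx N" for w
    using pos_unit[of w] that by (auto simp: idx_def)
  have "min (pos u) (pos v) = (\<Sum>k\<in>idx N. chain k u * (min (pos k) (pos v) - min (pred k) (pos v)))"
    using telescope_chain[OF u, of "\<lambda>t. min t (pos v)"] nn[OF v] by simp
  also have "\<dots> = (\<Sum>k\<in>idx N. chain k u * (\<Sum>l\<in>idx N. chain l v * incr_cov k l))"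
  proof (intro sum.cong refl arg_cong2[where f="(*)"])
    fix k assume k: "k \<in> idx N"
    have "min (pos k) (pos v) - min (pred k) (pos v)
       = (\<Sum>l\<in>idx N. chain l v * ((min (pos k) (pos l) - min (pred k) (pos l)) - (min (pos k) (pred l) - min (pred k) (pred l))))"
      \<comment> \<open>The second telescoping is in the other variable; \<open>h 0 = 0\<close>
        holds because both \<open>pos k\<close> and \<open>pred k\<close> are nonnegative.\<close>
      using telescope_chain[OF v, of "\<lambda>t. min (pos k) t - min (pred k) t"] nn[OF k] pos_pred_diff(2)[OF k]
      by simp
    then show "min (pos k) (pos v) - min (pred k) (pos v) = (\<Sum>l\<in>idx N. chain l v * incr_cov k l)"
      by (simp add: incr_cov_def algebra_simps)
  qed
  finally show ?thesis by (simp add: sum_distrib_left ac_simps)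
qed

text \<open>The constant of \<open>max_form_le\<close> for \<open>s = sqrt a\<close>, times the
  factor \<open>1 / a\<close> from \<open>incr_cov_bound\<close>.\<close>

definition \<Gamma> :: real where "\<Gamma> = 2 * card {2..M} / (1 - sqrt a) / a"

text \<open>Scaled so that the Gram kernel of the rows is the \<open>chain\<close> transform of the
  diagonal \<open>\<Gamma> * a ^ n\<close>.\<close>

definition maj :: "nat \<times> nat \<Rightarrow> nat \<times> nat \<Rightarrow> real" where
  "maj k u = sqrt (\<Gamma> * a ^ fst k) * chain k u"

lemma \<Gamma>_pos: "0 < \<Gamma>"
  using a M by (auto simp: \<Gamma>_def intro!: divide_pos_pos)

text \<open>The kernel \<open>min\<close> is the \<open>chain\<close> transform of
  \<open>incr_cov\<close>, and Schur's test bounds the form of \<open>incr_cov\<close> by a diagonal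
  one.\<close>

lemma cov_le_maj: "psd (idx N) (\<lambda>u v. (\<Sum>k\<in>idx N. maj k u * maj k v) - min (pos u) (pos v))"
  unfolding psd_def
proof
  fix c :: "nat \<times> nat \<Rightarrow> real"
  define C where "C k = (\<Sum>u\<in>idx N. c u * chain k u)" for k
  have "(\<Sum>u\<in>idx N. \<Sum>v\<in>idx N. c u * c v * min (pos u) (pos v))
     = (\<Sum>u\<in>idx N. \<Sum>v\<in>idx N. c u * c v * (\<Sum>k\<in>idx N. \<Sum>l\<in>idx N. chain k u * chain l v * incr_cov k l))"
    by (intro sum.cong refl) (simp only: min_pos_eq_chain)
  also have "\<dots> = (\<Sum>k\<in>idx N. \<Sum>l\<in>idx N. C k * C l * incr_cov k l)"
    unfolding sum_quadratic_transform C_def ..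
  also have "\<dots> \<le> (\<Sum>k\<in>idx N. \<Sum>l\<in>idx N. \<bar>C k\<bar> * \<bar>C l\<bar> * (a ^ max (fst k) (fst l) / a))"
    by (intro abs_quadratic_le incr_cov_bound)
  also have "\<dots> = (\<Sum>k\<in>idx N. \<Sum>l\<in>idx N. \<bar>C k\<bar> * \<bar>C l\<bar> * ((sqrt a)\<^sup>2) ^ max (fst k) (fst l)) / a"
    using a by (simp add: sum_divide_distrib)
  also have "\<dots> \<le> (2 * card {2..M} / (1 - sqrt a) * (\<Sum>k\<in>idx N. ((sqrt a)\<^sup>2) ^ fst k * \<bar>C k\<bar>\<^sup>2)) / a"
    unfolding idx_def using a by (intro divide_right_mono max_form_le) auto
  also have "\<dots> = (\<Sum>k\<in>idx N. (sqrt (\<Gamma> * a ^ fst k) * C k)\<^sup>2)"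
    using a \<Gamma>_pos by (simp add: \<Gamma>_def power_mult_distrib sum_distrib_left sum_divide_distrib ac_simps)
  also have "\<dots> = (\<Sum>u\<in>idx N. \<Sum>v\<in>idx N. c u * c v * (\<Sum>k\<in>idx N. maj k u * maj k v))"
    unfolding sum_quadratic_eq_gram C_def maj_def
    by (simp add: sum_distrib_left sum_distrib_right ac_simps)
  finally show "0 \<le> (\<Sum>u\<in>idx N. \<Sum>v\<in>idx N. c u * c v * ((\<Sum>k\<in>idx N. maj k u * maj k v) - min (pos u) (pos v)))"
    by (simp add: right_diff_distrib sum_subtractf)
qed

lemma sum_wt_tail: "(\<Sum>u\<in>{u\<in>idx N. p \<le> fst u}. wt u) \<le> \<delta> ^ p"
proof (cases "p \<le> N")
  case True
  have "idx N = idx p \<union> {u\<in>idx N. p \<le> fst u}" "idx p \<inter> {u\<in>idx N. p \<le> fst u} = {}"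
    using True by (auto simp: idx_def)
  then have "sum wt (idx N) = sum wt (idx p) + (\<Sum>u\<in>{u\<in>idx N. p \<le> fst u}. wt u)"
    by (metis (no_types, lifting) finite_Un finite_idx sum.union_disjoint)
  moreover have "0 \<le> \<delta> ^ N" using \<delta> by simp
  ultimately show ?thesis using sum_wt[of N] sum_wt[of p] by (simp only: idx_def)
next
  case False
  then have *: "{u\<in>idx N. p \<le> fst u} = {}" by (auto simp: idx_def)
  show ?thesis unfolding * using \<delta> by simp
qed

text \<open>Product of \<open>\<Gamma>\<close> and the constant of a second Schur test, with
  \<open>s = sqrt \<delta>\<close>.\<close>

definition C2 :: real where "C2 = \<Gamma> * (2 * card {2..M} / (1 - sqrt \<delta>))"

lemma C2_pos: "0 < C2"
  using \<Gamma>_pos \<delta> M by (auto simp: C2_def intro!: mult_pos_pos divide_pos_pos)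

text \<open>The transposed comparison, in the coordinates of the steps. Steps \<open>k\<close> and
  \<open>l\<close> are both used only on the way to atoms at least as deep as either, whose total
  mass is at most \<open>\<delta> ^ max (fst k) (fst l)\<close>. With the factors
  \<open>a ^ n\<close> in \<open>maj\<close>, Schur's test gives the ratio
  \<open>a * \<delta>\<close>.\<close>

lemma weighted_maj_le:
  "psd (idx N) (\<lambda>k l. (if k = l then C2 * (a * \<delta>) ^ fst k else 0) - (\<Sum>u\<in>idx N. wt u * (maj k u * maj l u)))"
  unfolding psd_def
proof
  fix c :: "nat \<times> nat \<Rightarrow> real"
  define z where "z k = sqrt (\<Gamma> * a ^ fst k) * \<bar>c k\<bar>" for k
  have cross: "\<bar>\<Sum>u\<in>idx N. wt u * (chain k u * chain l u)\<bar> \<le> ((sqrt \<delta>)\<^sup>2) ^ max (fst k) (fst l)" for k l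
  proof -
    have w: "0 \<le> wt u" if "u \<in> idx N" for u
      using wt_pos[of u] that by (auto simp: idx_def less_imp_le)
    have "\<bar>\<Sum>u\<in>idx N. wt u * (chain k u * chain l u)\<bar> = (\<Sum>u\<in>idx N. wt u * (chain k u * chain l u))"
      by (intro abs_of_nonneg sum_nonneg mult_nonneg_nonneg w) (auto simp: chain_def)
    also have "\<dots> \<le> (\<Sum>u\<in>idx N. if max (fst k) (fst l) \<le> fst u then wt u else 0)"
      using w by (intro sum_mono) (auto simp: chain_def)
    also have "\<dots> = (\<Sum>u\<in>{u\<in>idx N. max (fst k) (fst l) \<le> fst u}. wt u)"
      by (rule sum.inter_filter[symmetric]) simp
    also have "\<dots> \<le> \<delta> ^ max (fst k) (fst l)" by (rule sum_wt_tail)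
    finally show ?thesis using \<delta> by simp
  qed
  have "(\<Sum>k\<in>idx N. \<Sum>l\<in>idx N. c k * c l * (\<Sum>u\<in>idx N. wt u * (maj k u * maj l u)))
     = (\<Sum>k\<in>idx N. \<Sum>l\<in>idx N. (sqrt (\<Gamma> * a ^ fst k) * c k) * (sqrt (\<Gamma> * a ^ fst l) * c l)
          * (\<Sum>u\<in>idx N. wt u * (chain k u * chain l u)))"
    by (intro sum.cong refl) (simp add: maj_def sum_distrib_left ac_simps)
  also have "\<dots> \<le> (\<Sum>k\<in>idx N. \<Sum>l\<in>idx N. \<bar>sqrt (\<Gamma> * a ^ fst k) * c k\<bar> * \<bar>sqrt (\<Gamma> * a ^ fst l) * c l\<bar>
          * ((sqrt \<delta>)\<^sup>2) ^ max (fst k) (fst l))"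
    by (intro abs_quadratic_le cross)
  also have "\<dots> = (\<Sum>k\<in>idx N. \<Sum>l\<in>idx N. z k * z l * ((sqrt \<delta>)\<^sup>2) ^ max (fst k) (fst l))"
    using \<Gamma>_pos a by (simp add: z_def abs_mult)
  also have "\<dots> \<le> 2 * card {2..M} / (1 - sqrt \<delta>) * (\<Sum>k\<in>idx N. ((sqrt \<delta>)\<^sup>2) ^ fst k * (z k)\<^sup>2)"
    unfolding idx_def using \<delta> a \<Gamma>_pos by (intro max_form_le) (auto simp: z_def)
  also have "\<dots> = (\<Sum>k\<in>idx N. C2 * (a * \<delta>) ^ fst k * (c k)\<^sup>2)"
    using \<delta> a \<Gamma>_pos by (simp add: z_def C2_def sum_distrib_left power_mult_distrib ac_simps)
  also have "\<dots> = (\<Sum>k\<in>idx N. \<Sum>l\<in>idx N. c k * c l * (if k = l then C2 * (a * \<delta>) ^ fst k else 0))"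
    by (simp add: if_distrib[of "\<lambda>t. _ * t"] power2_eq_square ac_simps cong: if_cong)
  finally show "0 \<le> (\<Sum>k\<in>idx N. \<Sum>l\<in>idx N. c k * c l *
     ((if k = l then C2 * (a * \<delta>) ^ fst k else 0) - (\<Sum>u\<in>idx N. wt u * (maj k u * maj l u))))"
    by (simp add: right_diff_distrib sum_subtractf)
qed

text \<open>The step function \<open>\<Sum>u c u * indicator {0..pos u}\<close> jumps by \<open>c v\<close> at \<open>pos v\<close> and is
  constant on either side of it within distance \<open>rad v\<close>; one of the two values is at least
  \<open>\<bar>c v\<bar> / 2\<close> in modulus.\<close>

lemma cov_ge_diag: "psd (idx N) (\<lambda>u v. min (pos u) (pos v) - (if u = v then rad u / 2 else 0))"
  unfolding psd_def
proof
  fix c :: "nat \<times> nat \<Rightarrow> real"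
  let ?X = "idx N"
  have X: "snd u \<in> {2..M}" if "u \<in> ?X" for u using that by (auto simp: idx_def)
  have nn: "0 \<le> pos u" if "u \<in> ?X" for u using pos_unit[OF X[OF that]] by simp
  define f where "f t = (\<Sum>u\<in>?X. c u * indicator {0..pos u} t)" for t :: real
  \<comment> \<open>The value of \<open>f\<close> just to the right of \<open>pos v\<close>; just to
    the left it is \<open>A v + c v\<close>.\<close>
  define A where "A v = (\<Sum>u\<in>{u\<in>?X. pos v < pos u}. c u)" for v
  let ?L = "\<lambda>v. {pos v - rad v<..<pos v}" and ?R = "\<lambda>v. {pos v<..<pos v + rad v}"
  define g where "g v t = (A v + c v)\<^sup>2 * indicator (?L v) t + (A v)\<^sup>2 * indicator (?R v) t" for v and t :: real
  have sep: "pos u \<le> pos v - rad v \<or> pos v + rad v \<le> pos u" if "u \<in> ?X" "v \<in> ?X" "u \<noteq> v" for u v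
    using pos_separated[of u v] X[OF that(1)] X[OF that(2)] that rad_pos[of u] by auto
  have f_on: "f t = (if t \<in> ?L v then A v + c v else A v)" if v: "v \<in> ?X" and t: "t \<in> ?L v \<union> ?R v" for v t
  proof -
    have t0: "0 \<le> t" using t rad_le_pos[OF X[OF v]] rad_pos[of v] nn[OF v] by auto
    have "f t = (\<Sum>u\<in>?X. if t \<le> pos u then c u else 0)"
      unfolding f_def using t0 by (intro sum.cong) (auto simp: indicator_def)
    also have "\<dots> = (\<Sum>u\<in>?X. (if pos v < pos u then c u else 0) + (if u = v then (if t \<in> ?L v then c v else 0) else 0))"
    proof (intro sum.cong refl)
      fix u assume u: "u \<in> ?X"
      show "(if t \<le> pos u then c u else 0)
         = (if pos v < pos u then c u else 0) + (if u = v then (if t \<in> ?L v then c v else 0) else 0)"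
        using sep[OF u v] t rad_pos[of v] by (cases "u = v") auto
    qed
    also have "\<dots> = A v + (if t \<in> ?L v then c v else 0)"
      using v by (simp add: sum.distrib A_def sum.inter_filter)
    finally show ?thesis by auto
  qed
  \<comment> \<open>The intervals belonging to different atoms are disjoint by
    \<open>pos_separated\<close>, so at most one summand is nonzero at \<open>t\<close>.\<close>
  have disj: "(\<Sum>v\<in>?X. g v t) \<le> (f t)\<^sup>2" for t
  proof (cases "\<exists>v\<in>?X. t \<in> ?L v \<union> ?R v")
    case True
    then obtain v where v: "v \<in> ?X" "t \<in> ?L v \<union> ?R v" by auto
    have "g u t = 0" if "u \<in> ?X - {v}" for u
    proof -
      have "t \<notin> ?L u \<union> ?R u"
        using pos_separated[of u v] X[of u] X[OF v(1)] that v by auto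
      then show ?thesis by (simp add: g_def)
    qed
    then have "(\<Sum>u\<in>?X. g u t) = g v t"
      using v(1) by (subst sum.remove[of _ v]) (auto intro: sum.neutral)
    also have "\<dots> = (f t)\<^sup>2"
      using f_on[OF v] v(2) by (auto simp: g_def)
    finally show ?thesis by simp
  next
    case False
    then have "(\<Sum>v\<in>?X. g v t) = 0" by (intro sum.neutral) (auto simp: g_def)
    then show ?thesis by simp
  qed
  have int_f: "has_bochner_integral lborel (\<lambda>t. (f t)\<^sup>2) (\<Sum>u\<in>?X. \<Sum>v\<in>?X. c u * c v * min (pos u) (pos v))"
  proof -
    have m: "has_bochner_integral lborel (\<lambda>t. indicator {0..pos u} t * indicator {0..pos v} t :: real) (min (pos u) (pos v))"
      if "u \<in> ?X" "v \<in> ?X" for u v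
      using nn that by (intro has_bochner_integral_indicator_min)
    have "has_bochner_integral lborel (\<lambda>t. \<Sum>u\<in>?X. \<Sum>v\<in>?X. c u * c v * (indicator {0..pos u} t * indicator {0..pos v} t))
       (\<Sum>u\<in>?X. \<Sum>v\<in>?X. c u * c v * min (pos u) (pos v))"
      by (intro has_bochner_integral_sum has_bochner_integral_mult_right m)
    moreover have "(f t)\<^sup>2 = (\<Sum>u\<in>?X. \<Sum>v\<in>?X. c u * c v * (indicator {0..pos u} t * indicator {0..pos v} t))" for t
      unfolding f_def power2_eq_square sum_product
      by (intro sum.cong refl) (simp only: mult.assoc mult.left_commute mult.commute)
    ultimately show ?thesis by simp
  qed
  have int_g: "has_bochner_integral lborel (\<lambda>t. \<Sum>v\<in>?X. g v t) (\<Sum>v\<in>?X. (A v + c v)\<^sup>2 * rad v + (A v)\<^sup>2 * rad v)"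
  proof -
    have "has_bochner_integral lborel (indicator (?L v) :: real \<Rightarrow> real) (rad v)"
         "has_bochner_integral lborel (indicator (?R v) :: real \<Rightarrow> real) (rad v)" for v
      using has_bochner_integral_real_indicator[of "?L v" lborel] has_bochner_integral_real_indicator[of "?R v" lborel]
        rad_pos[of v] by auto
    then show ?thesis
      unfolding g_def by (intro has_bochner_integral_sum has_bochner_integral_add has_bochner_integral_mult_right)
  qed
  have "(\<Sum>u\<in>?X. \<Sum>v\<in>?X. c u * c v * (if u = v then rad u / 2 else 0)) = (\<Sum>v\<in>?X. rad v * ((c v)\<^sup>2 / 2))"
    by (simp add: if_distrib[of "\<lambda>t. _ * t"] power2_eq_square ac_simps cong: if_cong)
  also have "\<dots> \<le> (\<Sum>v\<in>?X. (A v + c v)\<^sup>2 * rad v + (A v)\<^sup>2 * rad v)"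
  proof (intro sum_mono)
    fix v
    \<comment> \<open>Completing the square gives half of the squared jump for the two sides
      together, whence the diagonal entry \<open>rad u / 2\<close>.\<close>
    have "(A v + c v)\<^sup>2 + (A v)\<^sup>2 - (c v)\<^sup>2 / 2 = (2 * A v + c v)\<^sup>2 / 2"
      by (simp add: power2_eq_square field_simps)
    then have "(c v)\<^sup>2 / 2 \<le> (A v + c v)\<^sup>2 + (A v)\<^sup>2"
      by (smt (verit) zero_le_power2 divide_nonneg_pos)
    then have "rad v * ((c v)\<^sup>2 / 2) \<le> rad v * ((A v + c v)\<^sup>2 + (A v)\<^sup>2)"
      using rad_pos[of v] by (intro mult_left_mono) auto
    then show "rad v * ((c v)\<^sup>2 / 2) \<le> (A v + c v)\<^sup>2 * rad v + (A v)\<^sup>2 * rad v"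
      by (simp add: algebra_simps)
  qed
  also have "\<dots> = (LBINT t. \<Sum>v\<in>?X. g v t)" using int_g by (simp add: has_bochner_integral_iff)
  also have "\<dots> \<le> (LBINT t. (f t)\<^sup>2)"
    using int_f int_g disj by (intro integral_mono) (auto simp: has_bochner_integral_iff)
  also have "\<dots> = (\<Sum>u\<in>?X. \<Sum>v\<in>?X. c u * c v * min (pos u) (pos v))"
    using int_f by (simp add: has_bochner_integral_iff)
  finally show "0 \<le> (\<Sum>u\<in>?X. \<Sum>v\<in>?X. c u * c v * (min (pos u) (pos v) - (if u = v then rad u / 2 else 0)))"
    by (simp add: right_diff_distrib sum_subtractf)
qed

text \<open>Half of \<open>rad u\<close> contributes \<open>a * gap / 4\<close>, and the masses of a
  level are bounded below through the smallest jump.\<close>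

definition C1 :: real where "C1 = a * gap / 4 * Min (jump ` {2..M})"

lemma C1_pos: "0 < C1"
proof -
  have "0 < Min (jump ` {2..M})" using M jump_pos by (subst Min_gr_iff) auto
  then show ?thesis using a gap_pos by (simp add: C1_def)
qed

lemma C1_le: "snd u \<in> {2..M} \<Longrightarrow> C1 * (a * \<delta>) ^ fst u \<le> wt u * (rad u / 2)"
proof -
  assume u: "snd u \<in> {2..M}"
  have "Min (jump ` {2..M}) \<le> jump (snd u)" using u by (intro Min_le) auto
  then have "a * gap / 4 * (a * \<delta>) ^ fst u * Min (jump ` {2..M}) \<le> a * gap / 4 * (a * \<delta>) ^ fst u * jump (snd u)"
    using a \<delta> gap_pos by (intro mult_left_mono) auto
  then show ?thesis by (simp add: C1_def wt_def rad_def power_mult_distrib ac_simps)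
qed

end

section \<open>Smooth bump functions\<close>

text \<open>A class closed under differentiation, so that derivatives of all orders exist by
  induction. The powers of \<open>1 / x\<close> belong to the base case because differentiating
  \<open>exp (- (1 / x))\<close> produces them; the rule \<open>affine\<close> also supplies scalar
  multiples.\<close>

inductive_set smooth :: "(real \<Rightarrow> real) set" where
  base: "(\<lambda>x. if 0 < x then (1 / x) ^ k * exp (- (1 / x)) else 0) \<in> smooth"
| affine: "f \<in> smooth \<Longrightarrow> (\<lambda>x. c * f (r * x + s)) \<in> smooth"
| add: "f \<in> smooth \<Longrightarrow> g \<in> smooth \<Longrightarrow> (\<lambda>x. f x + g x) \<in> smooth"
| mult: "f \<in> smooth \<Longrightarrow> g \<in> smooth \<Longrightarrow> (\<lambda>x. f x * g x) \<in> smooth"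

lemma smooth_base_deriv:
  fixes x :: real
  defines "b \<equiv> (\<lambda>k x :: real. if 0 < x then (1 / x) ^ k * exp (- (1 / x)) else 0)"
  shows "(b k has_real_derivative b (k + 2) x + (- real k) * b (k + 1) x) (at x)"
proof -
  consider "x < 0" | "x = 0" | "0 < x" by linarith
  then show ?thesis
  proof cases
    case 1
    have "((\<lambda>_. 0) has_real_derivative 0) (at x)" by simp
    then have "(b k has_real_derivative 0) (at x)"
      by (rule has_field_derivative_transform_within_open[where S="{..<0}"]) (use 1 in \<open>auto simp: b_def\<close>)
    then show ?thesis using 1 by (simp add: b_def)
  next
    case 2
    have "((\<lambda>h. (b k (0 + h) - b k 0) / h) \<longlongrightarrow> 0) (at 0)"
    proof (rule filterlim_split_at_real)
      have "\<forall>\<^sub>F h in at_left (0::real). (b k (0 + h) - b k 0) / h = 0"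
        by (auto simp: b_def eventually_at_left_field intro!: exI[of _ "-1"])
      then show "((\<lambda>h. (b k (0 + h) - b k 0) / h) \<longlongrightarrow> 0) (at_left 0)"
        by (rule tendsto_eventually)
      \<comment> \<open>The right difference quotient at the origin, written in terms of
        \<open>1 / h\<close>: the exponential beats every power.\<close>
      have "((\<lambda>h::real. (1 / h) ^ (k + 1) / exp (1 / h)) \<longlongrightarrow> 0) (at_right 0)"
        using filterlim_compose[OF tendsto_power_div_exp_0[of "k + 1"] filterlim_inverse_at_top_right]
        by (simp only: inverse_eq_divide)
      moreover have "\<forall>\<^sub>F h in at_right (0::real). (1 / h) ^ (k + 1) / exp (1 / h) = (b k (0 + h) - b k 0) / h"
        by (auto simp: b_def eventually_at_right_field exp_minus divide_simps intro!: exI[of _ 1])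
      ultimately show "((\<lambda>h. (b k (0 + h) - b k 0) / h) \<longlongrightarrow> 0) (at_right 0)"
        by (rule Lim_transform_eventually)
    qed
    moreover have "b (k + 2) x + (- real k) * b (k + 1) x = 0" using 2 by (simp add: b_def)
    ultimately show ?thesis using 2 by (simp only: DERIV_def)
  next
    case 3
    have "((\<lambda>x. (1 / x) ^ k * exp (- (1 / x))) has_real_derivative
       (1 / x) ^ (k + 2) * exp (- (1 / x)) + (- real k) * ((1 / x) ^ (k + 1) * exp (- (1 / x)))) (at x)"
    proof -
      have inv: "((\<lambda>x. 1 / x) has_real_derivative - ((1 / x) * (1 / x))) (at x)"
        using 3 by (auto intro!: derivative_eq_intros simp: power2_eq_square)
      have pow: "((\<lambda>x. (1 / x) ^ k) has_real_derivative - real k * (1 / x) ^ (k + 1)) (at x)"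
      proof (cases k)
        case (Suc n)
        show ?thesis
          using DERIV_power_Suc[OF inv, of n] unfolding Suc
          by (rule DERIV_cong) (simp add: algebra_simps add_divide_distrib diff_divide_distrib)
      qed simp
      show ?thesis
        using DERIV_mult[OF pow DERIV_fun_exp[OF DERIV_minus[OF inv]]]
        by (rule DERIV_cong) (simp add: algebra_simps)
    qed
    then have "(b k has_real_derivative
       (1 / x) ^ (k + 2) * exp (- (1 / x)) + (- real k) * ((1 / x) ^ (k + 1) * exp (- (1 / x)))) (at x)"
      by (rule has_field_derivative_transform_within_open[where S="{0<..}"]) (use 3 in \<open>auto simp: b_def\<close>)
    then show ?thesis using 3 by (simp add: b_def)
  qed
qed

lemma smooth_deriv:
  assumes "f \<in> smooth"
  shows "\<exists>f'\<in>smooth. \<forall>x. (f has_real_derivative f' x) (at x)"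
  using assms
proof induct
  case (base k)
  let ?b = "\<lambda>k x :: real. if 0 < x then (1 / x) ^ k * exp (- (1 / x)) else 0"
  have "(\<lambda>x. ?b (k + 2) x + (- real k) * ?b (k + 1) (1 * x + 0)) \<in> smooth"
    by (intro smooth.intros)
  moreover have "\<forall>x. (?b k has_real_derivative ?b (k + 2) x + (- real k) * ?b (k + 1) (1 * x + 0)) (at x)"
    by (simp only: mult_1_left add_0_right smooth_base_deriv simp_thms)
  ultimately show ?case by (intro bexI)
next
  case (affine f c r s)
  then obtain f' where f': "f' \<in> smooth" "\<And>x. (f has_real_derivative f' x) (at x)" by auto
  have "((\<lambda>x. c * f (r * x + s)) has_real_derivative c * r * f' (r * x + s)) (at x)" for x
  proof -
    have "((\<lambda>x. f (r * x + s)) has_real_derivative f' (r * x + s) * r) (at x)"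
      by (rule DERIV_chain'[OF _ f'(2)]) (auto intro!: derivative_eq_intros)
    from DERIV_cmult[OF this, of c] show ?thesis by (simp add: ac_simps)
  qed
  then show ?case using smooth.affine[OF f'(1), of "c * r" r s] by (intro bexI) auto
next
  case (add f g)
  then obtain f' g' where "f' \<in> smooth" "\<And>x. (f has_real_derivative f' x) (at x)"
    "g' \<in> smooth" "\<And>x. (g has_real_derivative g' x) (at x)" by auto
  then show ?case
    by (intro bexI[of _ "\<lambda>x. f' x + g' x"] smooth.add) (auto intro!: derivative_eq_intros)
next
  case (mult f g)
  then obtain f' g' where "f' \<in> smooth" "\<And>x. (f has_real_derivative f' x) (at x)"
    "g' \<in> smooth" "\<And>x. (g has_real_derivative g' x) (at x)" by auto
  then show ?case using mult
    by (intro bexI[of _ "\<lambda>x. f' x * g x + f x * g' x"] smooth.intros) (auto intro!: derivative_eq_intros)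
qed

lemma smooth_deriv_iterate: "f \<in> smooth \<Longrightarrow> (deriv ^^ n) f \<in> smooth"
proof (induct n)
  case (Suc n)
  then obtain f' where f': "f' \<in> smooth" "\<And>x. ((deriv ^^ n) f has_real_derivative f' x) (at x)"
    using smooth_deriv by blast
  then have "deriv ((deriv ^^ n) f) = f'" by (intro ext DERIV_imp_deriv)
  then show ?case using f' by simp
qed simp

lemma test_functionI:
  assumes "f \<in> smooth" "0 < u" "v < 1" "\<And>x. f x \<noteq> 0 \<Longrightarrow> u \<le> x \<and> x \<le> v"
  shows "test_function f"
  unfolding test_function_def
proof
  show "\<forall>n t. (deriv ^^ n) f differentiable at t"
  proof (intro allI)
    fix n t
    obtain f' where "\<forall>x. ((deriv ^^ n) f has_real_derivative f' x) (at x)"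
      using smooth_deriv smooth_deriv_iterate[OF assms(1)] by blast
    then show "(deriv ^^ n) f differentiable at t"
      by (auto simp: real_differentiable_def)
  qed
  have "closure {x. f x \<noteq> 0} \<subseteq> {u..v}"
    by (rule closure_minimal) (use assms in auto)
  then show "closure {t. f t \<noteq> 0} \<subseteq> {0<..<1}" using assms by auto
qed

text \<open>The factor \<open>Suc i\<close> flattens both exponents, so the bumps tend to the
  indicator of the open interval while their supports stay in \<open>{u..v}\<close>.\<close>

definition bump :: "real \<Rightarrow> real \<Rightarrow> nat \<Rightarrow> real \<Rightarrow> real" where
  "bump u v i x = (if u < x \<and> x < v then exp (- (1 / (real (Suc i) * (x - u)))) * exp (- (1 / (real (Suc i) * (v - x)))) else 0)"

lemma bump_smooth: "bump u v i \<in> smooth"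
proof -
  let ?b = "\<lambda>x :: real. if 0 < x then (1 / x) ^ 0 * exp (- (1 / x)) else 0"
  let ?n = "real (Suc i)"
  have "(\<lambda>x. (1 * ?b (?n * x + (- ?n * u))) * (1 * ?b (- ?n * x + ?n * v))) \<in> smooth"
    by (intro smooth.intros)
  also have "(\<lambda>x. (1 * ?b (?n * x + (- ?n * u))) * (1 * ?b (- ?n * x + ?n * v))) = bump u v i"
  proof
    fix x
    have 1: "?n * x + (- ?n * u) = ?n * (x - u)" "- ?n * x + ?n * v = ?n * (v - x)"
      by (simp_all add: algebra_simps)
    show "(1 * ?b (?n * x + (- ?n * u))) * (1 * ?b (- ?n * x + ?n * v)) = bump u v i x"
      unfolding 1 bump_def by (auto simp: zero_less_mult_iff)
  qed
  finally show ?thesis .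
qed

lemma bump_test: "0 < u \<Longrightarrow> v < 1 \<Longrightarrow> test_function (bump u v i)"
  by (rule test_functionI[OF bump_smooth]) (auto simp: bump_def split: if_splits)

lemma bump_bounds: "0 \<le> bump u v i x" "bump u v i x \<le> indicator {u<..<v} x"
proof -
  show "0 \<le> bump u v i x" by (simp add: bump_def)
  have "exp (- (1 / (real (Suc i) * (x - u)))) * exp (- (1 / (real (Suc i) * (v - x)))) \<le> 1 * 1"
    if "u < x" "x < v"
    using that by (intro mult_mono) auto
  then show "bump u v i x \<le> indicator {u<..<v} x" by (auto simp: bump_def)
qed

lemma bump_tendsto:
  assumes "u < x" "x < v"
  shows "(\<lambda>i. bump u v i x) \<longlonglongrightarrow> 1"
proof -
  have *: "(\<lambda>i. exp (- (1 / (real (Suc i) * c)))) \<longlonglongrightarrow> 1" if "c > 0" for c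
  proof -
    have "(\<lambda>i. - (1 / real (Suc i) * (1 / c))) \<longlonglongrightarrow> - (0 * (1 / c))"
      by (intro tendsto_intros LIMSEQ_inverse_real_of_nat[unfolded inverse_eq_divide])
    then have "(\<lambda>i. exp (- (1 / (real (Suc i) * c)))) \<longlonglongrightarrow> exp (- (0 * (1 / c)))"
      by (intro tendsto_exp) simp
    then show ?thesis by simp
  qed
  have "(\<lambda>i. exp (- (1 / (real (Suc i) * (x - u)))) * exp (- (1 / (real (Suc i) * (v - x))))) \<longlonglongrightarrow> 1 * 1"
    using assms by (intro tendsto_mult *) auto
  then show ?thesis using assms by (simp add: bump_def)
qed

lemma test_function_deriv:
  assumes "test_function \<phi>"
  shows "(\<phi> has_real_derivative deriv \<phi> t) (at t)" "isCont (deriv \<phi>) t" "\<phi> 1 = 0"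
proof -
  have d: "(deriv ^^ n) \<phi> differentiable at t" for n t
    using assms by (auto simp: test_function_def)
  show "(\<phi> has_real_derivative deriv \<phi> t) (at t)"
    using d[of 0 t] by (simp add: DERIV_deriv_iff_real_differentiable)
  show "isCont (deriv \<phi>) t"
    using d[of 1 t] by (simp add: differentiable_imp_continuous_within)
  show "\<phi> 1 = 0"
  proof (rule ccontr)
    assume "\<phi> 1 \<noteq> 0"
    then have "1 \<in> closure {t. \<phi> t \<noteq> 0}" using closure_subset by fastforce
    then show False using assms by (auto simp: test_function_def)
  qed
qed

section \<open>Identification of the measure\<close>

context dss
begin

section \<open>The distribution function of the atoms\<close>

definition cdf_level :: "nat \<Rightarrow> real \<Rightarrow> real" where
  "cdf_level n t = \<delta> ^ n * (\<Sum>k\<in>{2..M}. jump k * indicator {pos (n, k)..} t)"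

text \<open>The candidate for the fixed point, arranged by levels so that \<open>S\<close> acts on
  it as a shift of the index.\<close>

definition dss_cdf :: "real \<Rightarrow> real" where
  "dss_cdf t = (\<Sum>n. cdf_level n t)"

lemma cdf_level_nonneg: "0 \<le> cdf_level n t"
  unfolding cdf_level_def using \<delta> jump_pos by (intro mult_nonneg_nonneg sum_nonneg) (auto simp: less_imp_le)

lemma cdf_level_le: "cdf_level n t \<le> (1 - \<delta>) * \<delta> ^ n"
proof -
  have "(\<Sum>k\<in>{2..M}. jump k * indicator {pos (n, k)..} t) \<le> (\<Sum>k\<in>{2..M}. jump k)"
    using jump_pos by (intro sum_mono) (auto simp: indicator_def less_imp_le)
  then have "\<delta> ^ n * (\<Sum>k\<in>{2..M}. jump k * indicator {pos (n, k)..} t) \<le> \<delta> ^ n * (1 - \<delta>)"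
    unfolding sum_jump_total using \<delta> by (intro mult_left_mono) auto
  then show ?thesis by (simp add: cdf_level_def mult.commute)
qed

lemma geometric_sums: "(\<lambda>n. (1 - \<delta>) * \<delta> ^ n) sums 1"
  using sums_mult[OF geometric_sums[of \<delta>], of "1 - \<delta>"] \<delta> by simp

lemma summable_cdf: "summable (\<lambda>n. cdf_level n t)"
  by (rule summable_comparison_test'[OF sums_summable[OF geometric_sums], of 0])
     (use cdf_level_nonneg cdf_level_le in auto)

lemma dss_cdf_bounds: "0 \<le> dss_cdf t" "dss_cdf t \<le> 1"
proof -
  show "0 \<le> dss_cdf t"
    unfolding dss_cdf_def by (intro suminf_nonneg summable_cdf cdf_level_nonneg)
  have "dss_cdf t \<le> (\<Sum>n. (1 - \<delta>) * \<delta> ^ n)"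
    unfolding dss_cdf_def by (intro suminf_le summable_cdf cdf_level_le sums_summable[OF geometric_sums])
  then show "dss_cdf t \<le> 1" using sums_unique[OF geometric_sums] by simp
qed

lemma dss_cdf_0: "t \<le> 0 \<Longrightarrow> dss_cdf t = 0"
proof -
  assume t: "t \<le> 0"
  have "cdf_level n t = 0" for n
  proof -
    have "(\<Sum>k\<in>{2..M}. jump k * indicator {pos (n, k)..} t) = 0"
    proof (rule sum.neutral, rule ballI)
      fix k assume "k \<in> {2..M}"
      then show "jump k * indicator {pos (n, k)..} t = 0"
        using t pos_unit[of "(n, k)"] by (simp add: indicator_def)
    qed
    then show ?thesis by (simp add: cdf_level_def)
  qed
  then show ?thesis by (simp add: dss_cdf_def)
qed

lemma dss_cdf_1: "1 \<le> t \<Longrightarrow> dss_cdf t = 1"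
proof -
  assume t: "1 \<le> t"
  have "cdf_level n t = (1 - \<delta>) * \<delta> ^ n" for n
  proof -
    have "(\<Sum>k\<in>{2..M}. jump k * indicator {pos (n, k)..} t) = (\<Sum>k\<in>{2..M}. jump k)"
      using t pos_unit[of "(n, _)"] by (intro sum.cong refl) (force simp: indicator_def)
    then show ?thesis by (simp add: cdf_level_def sum_jump_total)
  qed
  then show ?thesis using sums_unique[OF geometric_sums] by (simp add: dss_cdf_def)
qed

text \<open>Levels from 1 on form the copy of \<open>dss_cdf\<close> scaled by
  \<open>\<delta>\<close>. To the right of the \<open>m\<close>-th interval this copy equals
  \<open>\<delta>\<close> and restores what \<open>jump (m + 1)\<close> had subtracted.\<close>

lemma dss_cdf_eq:
  assumes k: "k \<in> {1..M}" and t: "\<alpha> k < t" "t < \<alpha> (k + 1)"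
  shows "dss_cdf t = \<beta> k + (if k = m then \<delta> * dss_cdf ((t - \<alpha> m) / a) else 0)"
proof -
  have "cdf_level (Suc n) t = \<delta> * cdf_level n ((t - \<alpha> m) / a)" for n
  proof -
    have "pos (Suc n, k) \<le> t \<longleftrightarrow> pos (n, k) \<le> (t - \<alpha> m) / a" for k
      using a by (simp add: pos_def S_def[of "(S ^^ n) _"] field_simps)
    then have "(indicator {pos (Suc n, k)..} t :: real) = indicator {pos (n, k)..} ((t - \<alpha> m) / a)" for k
      by (simp add: indicator_def)
    then show ?thesis by (simp add: cdf_level_def)
  qed
  then have "dss_cdf t = cdf_level 0 t + \<delta> * dss_cdf ((t - \<alpha> m) / a)"
    unfolding dss_cdf_def using suminf_split_head[OF summable_cdf, of t] suminf_mult[OF summable_cdf, of \<delta>] by simp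
  also have "cdf_level 0 t = \<beta> k - (if m < k then \<delta> else 0)"
  proof -
    have "cdf_level 0 t = (\<Sum>l\<in>{2..M}. jump l * indicator {pos (0, l)..} t)"
      by (simp only: cdf_level_def power_0 mult_1_left)
    also have "\<dots> = (\<Sum>l\<in>{2..M}. if l \<in> {2..k} then jump l else 0)"
    proof (intro sum.cong refl)
      fix l assume l: "l \<in> {2..M}"
      have "\<alpha> l \<le> t \<longleftrightarrow> l \<le> k"
        using \<alpha>_mono[of l k] \<alpha>_mono[of "k + 1" l] l k t by (cases "l \<le> k") auto
      then show "jump l * indicator {pos (0, l)..} t = (if l \<in> {2..k} then jump l else 0)"
        using l by (auto simp: pos_def indicator_def)
    qed
    also have "\<dots> = (\<Sum>l\<in>{2..M} \<inter> {2..k}. jump l)"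
      by (rule sum.inter_restrict[symmetric]) simp
    also have "{2..M} \<inter> {2..k} = {2..k}" using k by auto
    finally show ?thesis using sum_jump[of k] k by auto
  qed
  also have "dss_cdf ((t - \<alpha> m) / a) = (if m < k then 1 else if k = m then dss_cdf ((t - \<alpha> m) / a) else 0)"
  proof -
    consider "k < m" | "k = m" | "m < k" by linarith
    then show ?thesis
    proof cases
      case 1
      then have "t \<le> \<alpha> m" using \<alpha>_mono[of "k + 1" m] m k t by auto
      then have "(t - \<alpha> m) / a \<le> 0" using a by (simp add: divide_simps)
      then show ?thesis using 1 dss_cdf_0 by simp
    next
      case 3
      then have "\<alpha> (m + 1) \<le> t" using \<alpha>_mono[of "m + 1" k] m k t by auto
      then have "1 \<le> (t - \<alpha> m) / a" using a by (simp add: a_def field_simps)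
      then show ?thesis using 3 dss_cdf_1 by simp
    qed simp
  qed
  finally show ?thesis by auto
qed

lemma dss_operator_eq:
  assumes k: "k \<in> {1..M}" and t: "\<alpha> k < t" "t < \<alpha> (k + 1)"
  shows "dss_operator M m \<delta> \<alpha> \<beta> f t = \<beta> k + (if k = m then \<delta> * f ((t - \<alpha> m) / a) else 0)"
proof -
  have ind: "indicator {\<alpha> l<..<\<alpha> (l + 1)} t = (if l = k then 1 else 0 :: real)" if l: "l \<in> {1..M}" for l
    using \<alpha>_mono[of "l + 1" k] \<alpha>_mono[of "k + 1" l] l k t
    by (cases l k rule: linorder_cases) (auto simp: indicator_def)
  have "(\<Sum>l\<in>{1..M}. \<beta> l * indicator {\<alpha> l<..<\<alpha> (l + 1)} t) = (\<Sum>l\<in>{1..M}. if l = k then \<beta> l else 0)"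
    by (intro sum.cong refl) (simp only: ind, simp)
  also have "\<dots> = \<beta> k" using k by simp
  finally show ?thesis
    unfolding dss_operator_def using ind[of m] m by (auto simp: a_def)
qed

lemma dss_cdf_measurable [measurable]: "dss_cdf \<in> borel_measurable borel"
proof -
  have "(\<lambda>t. \<Sum>n. cdf_level n t) \<in> borel_measurable borel"
    unfolding cdf_level_def by measurable
  also have "(\<lambda>t. \<Sum>n. cdf_level n t) = dss_cdf" by (intro ext dss_cdf_def[symmetric])
  finally show ?thesis .
qed

section \<open>Uniqueness of the fixed point\<close>

lemma dss_function_measurable:
  assumes "dss_function M m \<delta> \<alpha> \<beta> f"
  shows "(\<lambda>t. indicator {0..1} t * f t) \<in> borel_measurable borel"
proof -
  have "f \<in> borel_measurable (restrict_space borel {0..1})"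
    using assms by (simp only: dss_function_def)
  then have "(\<lambda>t. indicator {0..1} t *\<^sub>R f t) \<in> borel_measurable borel"
    by (subst (asm) borel_measurable_restrict_space_iff) auto
  then show ?thesis by simp
qed

lemma breakpoint_cover:
  assumes "t \<in> {0..1}" "t \<notin> \<alpha> ` {1..M+1}"
  shows "\<exists>k\<in>{1..M}. \<alpha> k < t \<and> t < \<alpha> (k + 1)"
proof -
  define k where "k = Max {k\<in>{1..M}. \<alpha> k \<le> t}"
  have fin: "finite {k\<in>{1..M}. \<alpha> k \<le> t}" by simp
  have "1 \<in> {k\<in>{1..M}. \<alpha> k \<le> t}" using assms M \<alpha>1 by auto
  then have "k \<in> {k\<in>{1..M}. \<alpha> k \<le> t}" unfolding k_def by (intro Max_in[OF fin]) blast
  then have k: "k \<in> {1..M}" "\<alpha> k \<le> t" by auto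
  have "t < \<alpha> (k + 1)"
  proof (rule ccontr)
    assume "\<not> t < \<alpha> (k + 1)"
    show False
    proof (cases "k = M")
      case True
      then show False using \<open>\<not> t < \<alpha> (k + 1)\<close> assms \<alpha>M by (auto simp: image_iff)
    next
      case False
      then have "k + 1 \<le> k" unfolding k_def
        using \<open>\<not> t < \<alpha> (k + 1)\<close> k by (intro Max_ge[OF fin]) (auto simp: k_def)
      then show False by simp
    qed
  qed
  moreover have "\<alpha> k \<noteq> t" using assms k by auto
  ultimately show ?thesis using k by (intro bexI[of _ k]) auto
qed

text \<open>The difference of two fixed points is contracted by the factor \<open>\<delta>\<close> in the sup norm.\<close>

lemma dss_function_AE_eq:
  assumes f: "dss_function M m \<delta> \<alpha> \<beta> f"
  shows "AE t in lborel. indicator {0..1} t * f t = indicator {0..1} t * dss_cdf t"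
proof -
  define h where "h t = indicator {0..1} t * f t - indicator {0..1} t * dss_cdf t" for t :: real
  have fm [measurable]: "(\<lambda>t. indicator {0..1} t * f t) \<in> borel_measurable borel"
    by (rule dss_function_measurable[OF f])
  have hm [measurable]: "h \<in> borel_measurable borel" unfolding h_def by measurable
  obtain B where "\<forall>y\<in>f ` {0..1}. norm y \<le> B"
    using f unfolding dss_function_def bounded_iff by blast
  then have B: "\<bar>f t\<bar> \<le> B" if "t \<in> {0..1}" for t
    using that by auto
  have hB: "\<bar>h t\<bar> \<le> B + 1" for t
  proof (cases "t \<in> {0..1}")
    case True
    then show ?thesis using B[OF True] dss_cdf_bounds[of t] by (auto simp: h_def)
  next
    case False
    have "0 \<le> B" using B[of 0] by auto
    then show ?thesis using False by (auto simp: h_def)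
  qed
  have "AE t in lborel. t \<notin> \<alpha> ` {1..M+1}"
    by (intro AE_not_in countable_imp_null_set_lborel countable_finite) simp
  moreover have "AE t in lborel. t \<in> {0..1} \<longrightarrow> dss_operator M m \<delta> \<alpha> \<beta> f t = f t"
    using f by (simp add: dss_function_def)
  ultimately have contr: "AE t in lborel. \<bar>h t\<bar> \<le> \<delta> * \<bar>h (- \<alpha> m / a + (1 / a) * t)\<bar>"
  proof eventually_elim
    case (elim t)
    show ?case
    proof (cases "t \<in> {0..1}")
      case True
      then obtain k where k: "k \<in> {1..M}" "\<alpha> k < t" "t < \<alpha> (k + 1)"
        using breakpoint_cover elim by blast
      have arg: "(t - \<alpha> m) / a = - \<alpha> m / a + (1 / a) * t" by (simp add: diff_divide_distrib)
      have "h t = dss_operator M m \<delta> \<alpha> \<beta> f t - dss_cdf t" using True elim by (simp add: h_def)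
      also have "\<dots> = (if k = m then \<delta> * (f ((t - \<alpha> m) / a) - dss_cdf ((t - \<alpha> m) / a)) else 0)"
        unfolding dss_operator_eq[OF k] dss_cdf_eq[OF k] by (simp add: right_diff_distrib)
      finally have h: "h t = \<dots>" .
      show ?thesis
      proof (cases "k = m")
        case km: True
        have "(t - \<alpha> m) / a \<in> {0..1}" using k a km by (auto simp: a_def field_simps)
        then have "h t = \<delta> * h ((t - \<alpha> m) / a)" using h km by (simp add: h_def)
        then show ?thesis using \<delta> by (simp add: arg abs_mult)
      next
        case False
        then show ?thesis using h \<delta> by simp
      qed
    next
      case False
      then show ?thesis using \<delta> by (simp add: h_def)
    qed
  qed
  have "AE t in lborel. \<bar>h t\<bar> \<le> \<delta> ^ n * (B + 1)" for n
  proof (induct n)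
    case 0
    then show ?case using hB by simp
  next
    case (Suc n)
    have "AE t in lborel. \<bar>h (- \<alpha> m / a + (1 / a) * t)\<bar> \<le> \<delta> ^ n * (B + 1)"
      \<comment> \<open>The bound for \<open>h\<close> is known only almost everywhere; it may be
        evaluated at the rescaled point because preimages of null sets under an affine bijection are
        null.\<close>
      using a by (intro AE_borel_affine[where P="\<lambda>t. \<bar>h t\<bar> \<le> \<delta> ^ n * (B + 1)"] Suc) auto
    with contr show ?case
    proof eventually_elim
      case (elim t)
      have "\<bar>h t\<bar> \<le> \<delta> * (\<delta> ^ n * (B + 1))"
        using elim \<delta> by (intro order_trans[OF elim(1)] mult_left_mono) auto
      then show ?case by simp
    qed
  qed
  then have "AE t in lborel. \<forall>n. \<bar>h t\<bar> \<le> \<delta> ^ n * (B + 1)" by (simp add: AE_all_countable)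
  then show ?thesis
  proof eventually_elim
    case (elim t)
    have "(\<lambda>n. \<delta> ^ n * (B + 1)) \<longlonglongrightarrow> 0 * (B + 1)"
      using \<delta> by (intro tendsto_mult LIMSEQ_power_zero tendsto_const) auto
    then have "\<bar>h t\<bar> \<le> 0 * (B + 1)"
      by (rule LIMSEQ_le_const) (use elim in auto)
    then show ?case by (simp add: h_def)
  qed
qed

section \<open>Recovering the atoms from the distributional derivative\<close>

lemma integral_step_deriv:
  assumes \<phi>: "test_function \<phi>" and x: "0 \<le> x" "x \<le> 1"
  shows "has_bochner_integral lborel (\<lambda>t. indicator {0..1} t * (indicator {x..} t * deriv \<phi> t)) (- \<phi> x)"
proof -
  have "has_bochner_integral lborel (\<lambda>t. deriv \<phi> t * indicator {x..1} t) (\<phi> 1 - \<phi> x)"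
    using x test_function_deriv[OF \<phi>] by (intro has_bochner_integral_FTC_Icc_real) auto
  moreover have "(\<lambda>t. deriv \<phi> t * indicator {x..1} t) = (\<lambda>t. indicator {0..1} t * (indicator {x..} t * deriv \<phi> t))"
    using x by (auto simp: fun_eq_iff indicator_def)
  ultimately show ?thesis using test_function_deriv(3)[OF \<phi>] by simp
qed

text \<open>By dominated convergence over the levels, the right side is the sum of
  \<open>wt v * \<phi> (pos v)\<close> over all atoms. One term is kept, since nonnegative
  \<open>\<phi>\<close> are enough for lower bounds on masses.\<close>

lemma integral_dss_cdf_deriv_ge:
  assumes \<phi>: "test_function \<phi>" and nn: "\<And>t. 0 \<le> \<phi> t" and u: "snd u \<in> {2..M}"
  shows "wt u * \<phi> (pos u) \<le> - (LBINT t. indicator {0..1} t * (dss_cdf t * deriv \<phi> t))"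
proof -
  let ?g = "\<lambda>N t. indicator {0..1} t * ((\<Sum>n<N. cdf_level n t) * deriv \<phi> t)"
  have cont: "continuous_on UNIV (deriv \<phi>)"
    using test_function_deriv(2)[OF \<phi>] by (simp add: continuous_at_imp_continuous_on)
  then have [measurable]: "deriv \<phi> \<in> borel_measurable borel"
    by (rule borel_measurable_continuous_onI)
  have "bounded (deriv \<phi> ` {0..1})"
    by (intro compact_imp_bounded compact_continuous_image continuous_on_subset[OF cont]) auto
  then obtain B where "\<forall>y\<in>deriv \<phi> ` {0..1}. norm y \<le> B"
    unfolding bounded_iff by blast
  then have B: "\<bar>deriv \<phi> t\<bar> \<le> B" if "t \<in> {0..1}" for t
    using that by auto
  have level: "has_bochner_integral lborel (?g N) (\<Sum>n<N. \<Sum>k\<in>{2..M}. wt (n, k) * - \<phi> (pos (n, k)))" for N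
  proof -
    have "has_bochner_integral lborel (\<lambda>t. \<Sum>n<N. \<Sum>k\<in>{2..M}. wt (n, k) * (indicator {0..1} t * (indicator {pos (n, k)..} t * deriv \<phi> t)))
      (\<Sum>n<N. \<Sum>k\<in>{2..M}. wt (n, k) * - \<phi> (pos (n, k)))"
      using pos_unit by (intro has_bochner_integral_sum has_bochner_integral_mult_right integral_step_deriv \<phi>)
        (auto simp: less_imp_le)
    moreover have "(\<Sum>n<N. \<Sum>k\<in>{2..M}. wt (n, k) * (indicator {0..1} t * (indicator {pos (n, k)..} t * deriv \<phi> t))) = ?g N t" for t
      by (simp only: cdf_level_def wt_def sum_distrib_left sum_distrib_right fst_conv snd_conv mult_ac)
    ultimately show ?thesis by simp
  qed
  have lim: "(\<lambda>N. LBINT t. ?g N t) \<longlonglongrightarrow> (LBINT t. indicator {0..1} t * (dss_cdf t * deriv \<phi> t))"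
  proof (rule integral_dominated_convergence[where w="\<lambda>t. B * indicator {0..1} t"])
    show "?g N \<in> borel_measurable lborel" for N
      using level[of N] by (auto dest: has_bochner_integral_integrable)
    show "integrable lborel (\<lambda>t::real. B * indicator {0..1} t)"
      by (intro integrable_mult_right integrable_real_indicator) (auto simp: emeasure_lborel_Icc_eq)
    show "AE t in lborel. (\<lambda>N. ?g N t) \<longlonglongrightarrow> indicator {0..1} t * (dss_cdf t * deriv \<phi> t)"
      unfolding dss_cdf_def by (intro AE_I2 tendsto_intros summable_LIMSEQ summable_cdf)
    show "AE t in lborel. norm (?g N t) \<le> B * indicator {0..1} t" for N
    proof (intro AE_I2)
      fix t
      have "(\<Sum>n<N. cdf_level n t) \<le> dss_cdf t"
        unfolding dss_cdf_def by (intro sum_le_suminf summable_cdf) (auto intro: cdf_level_nonneg)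
      then have "\<bar>\<Sum>n<N. cdf_level n t\<bar> \<le> 1"
        using dss_cdf_bounds[of t] sum_nonneg[of "{..<N}" "\<lambda>n. cdf_level n t"] cdf_level_nonneg by (auto simp: abs_if)
      then have "t \<in> {0..1} \<Longrightarrow> \<bar>\<Sum>n<N. cdf_level n t\<bar> * \<bar>deriv \<phi> t\<bar> \<le> 1 * B"
        using B by (intro mult_mono) auto
      then show "norm (?g N t) \<le> B * indicator {0..1} t" by (auto simp: indicator_def abs_mult)
    qed
  qed measurable
  have "wt u * \<phi> (pos u) \<le> - (LBINT t. ?g N t)" if "fst u < N" for N
  proof -
    have "wt u * \<phi> (pos u) \<le> (\<Sum>v\<in>idx N. wt v * \<phi> (pos v))"
      using that u by (intro member_le_sum) (auto simp: idx_def mem_Times_iff intro!: mult_nonneg_nonneg[OF less_imp_le[OF wt_pos] nn])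
    also have "\<dots> = - (LBINT t. ?g N t)"
      using level[of N] by (simp add: has_bochner_integral_iff sum_idx sum_negf)
    finally show ?thesis .
  qed
  then show ?thesis
    using tendsto_minus[OF lim] by (intro LIMSEQ_le_const) (auto intro!: exI[of _ "Suc (fst u)"])
qed

text \<open>Bumps inside an interval around the atom bound the mass of the interval from below; then
  the intervals shrink to the atom.\<close>

lemma measure_atom_ge:
  assumes \<mu>: "dss_measure M m \<delta> \<alpha> \<beta> \<mu>" and u: "snd u \<in> {2..M}"
  shows "wt u \<le> measure \<mu> {pos u}"
proof -
  interpret prob_space \<mu> using \<mu> by (simp add: dss_measure_def)
  obtain f where f: "dss_function M m \<delta> \<alpha> \<beta> f" and d: "distributional_derivative f \<mu>"
    using \<mu> by (auto simp: dss_measure_def)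
  have sets_\<mu> [measurable_cong]: "sets \<mu> = sets (restrict_space borel {0..1})"
    using \<mu> by (simp add: dss_measure_def)
  have fm: "(\<lambda>t. indicator {0..1} t * f t) \<in> borel_measurable borel"
    by (rule dss_function_measurable[OF f])
  have space: "space \<mu> = {0..1}" using sets_eq_imp_space_eq[OF sets_\<mu>] by (simp add: space_restrict_space)
  have sub: "{s<..<t} \<in> sets \<mu>" if "0 \<le> s" "t \<le> 1" for s t :: real
    unfolding sets_\<mu> using that by (subst sets_restrict_space_iff) auto
  have interval: "wt u \<le> measure \<mu> {s<..<t}" if st: "0 < s" "s < pos u" "pos u < t" "t < 1" for s t
  proof -
    have "wt u * bump s t i (pos u) \<le> measure \<mu> {s<..<t}" for i
    proof -
      have \<phi>: "test_function (bump s t i)" using st by (intro bump_test) auto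
      have [measurable]: "deriv (bump s t i) \<in> borel_measurable borel"
        using test_function_deriv(2)[OF \<phi>]
        by (intro borel_measurable_continuous_onI) (simp add: continuous_at_imp_continuous_on)
      have "isCont (bump s t i) x" for x
        using test_function_deriv(1)[OF \<phi>] by (rule DERIV_isCont)
      then have [measurable]: "bump s t i \<in> borel_measurable borel"
        by (intro borel_measurable_continuous_onI) (simp add: continuous_at_imp_continuous_on)
      then have bm: "bump s t i \<in> borel_measurable \<mu>"
        by (simp add: measurable_cong_sets[OF sets_\<mu> refl] measurable_restrict_space1)
      have "wt u * bump s t i (pos u) \<le> - (LBINT x. indicator {0..1} x * (dss_cdf x * deriv (bump s t i) x))"
        by (intro integral_dss_cdf_deriv_ge \<phi> u bump_bounds)
      also have "(LBINT x. indicator {0..1} x * (dss_cdf x * deriv (bump s t i) x))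
         = (LBINT x. (indicator {0..1} x * f x) * deriv (bump s t i) x)"
      proof (rule integral_cong_AE)
        show "AE x in lborel. indicator {0..1} x * (dss_cdf x * deriv (bump s t i) x) = (indicator {0..1} x * f x) * deriv (bump s t i) x"
          using dss_function_AE_eq[OF f] by eventually_elim (simp only: mult.assoc[symmetric])
      qed (use fm in measurable)
      also have "\<dots> = (LBINT x:{0..1}. f x * deriv (bump s t i) x)"
        by (simp add: set_lebesgue_integral_def ac_simps)
      also have "- \<dots> = (\<integral>x. bump s t i x \<partial>\<mu>)"
        using d \<phi> by (simp add: distributional_derivative_def)
      also have "\<dots> \<le> (\<integral>x. indicator {s<..<t} x \<partial>\<mu>)"
      proof (rule integral_mono)
        show "integrable \<mu> (bump s t i)"
        proof (rule integrable_const_bound[where B=1])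
          have "bump s t i x \<le> 1" for x
            by (rule order_trans[OF bump_bounds(2)]) (simp add: indicator_def)
          then show "AE x in \<mu>. norm (bump s t i x) \<le> 1" using bump_bounds(1)[of s t i] by simp
        qed (rule bm)
        show "integrable \<mu> (indicator {s<..<t} :: real \<Rightarrow> real)"
          using sub st by (intro integrable_real_indicator) (auto simp: emeasure_eq_measure)
      qed (rule bump_bounds)
      also have "\<dots> = measure \<mu> {s<..<t}" using sub st by simp
      finally show ?thesis by simp
    qed
    moreover have "(\<lambda>i. wt u * bump s t i (pos u)) \<longlonglongrightarrow> wt u * 1"
      using st by (intro tendsto_intros bump_tendsto)
    ultimately show ?thesis by (intro LIMSEQ_le_const2[of _ "wt u"]) auto
  qed
  \<comment> \<open>The distances of \<open>pos u\<close> to both \<open>0\<close> and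
    \<open>1\<close> are scaled by the same factor. Starting with \<open>1 / 2\<close> instead of
    \<open>1\<close> keeps the endpoints strictly between \<open>0\<close> and
    \<open>1\<close>.\<close>
  define A where "A i = {pos u * (1 - 1 / real (Suc (Suc i)))<..<pos u + (1 - pos u) / real (Suc (Suc i))}" for i
  have p: "0 < pos u" "pos u < 1" using pos_unit[OF u] by auto
  have A: "0 < pos u * (1 - 1 / real (Suc (Suc i)))" "pos u * (1 - 1 / real (Suc (Suc i))) < pos u"
     "pos u < pos u + (1 - pos u) / real (Suc (Suc i))" "pos u + (1 - pos u) / real (Suc (Suc i)) < 1" for i
  proof -
    define e where "e = 1 / real (Suc (Suc i))"
    have "0 < e" "e < 1" by (auto simp: e_def)
    then have "0 < pos u * (1 - e)" "0 < pos u * e" "0 < (1 - pos u) * e" "0 < (1 - pos u) * (1 - e)"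
      using p by auto
    moreover have "(1 - pos u) / real (Suc (Suc i)) = (1 - pos u) * e" by (simp add: e_def)
    ultimately show "0 < pos u * (1 - 1 / real (Suc (Suc i)))" "pos u * (1 - 1 / real (Suc (Suc i))) < pos u"
     "pos u < pos u + (1 - pos u) / real (Suc (Suc i))" "pos u + (1 - pos u) / real (Suc (Suc i)) < 1"
      unfolding e_def[symmetric] by (simp_all add: algebra_simps)
  qed
  have "(\<lambda>i. measure \<mu> (A i)) \<longlonglongrightarrow> measure \<mu> (\<Inter>i. A i)"
  proof (rule finite_Lim_measure_decseq)
    have "A i \<in> sets \<mu>" for i
      unfolding A_def by (intro sub less_imp_le A)
    then show "range A \<subseteq> sets \<mu>" by blast
    show "decseq A"
    proof (rule decseq_SucI)
      fix i
      have *: "1 / real (Suc (Suc (Suc i))) \<le> 1 / real (Suc (Suc i))" by (simp add: divide_simps)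
      have "pos u * (1 - 1 / real (Suc (Suc i))) \<le> pos u * (1 - 1 / real (Suc (Suc (Suc i))))"
        using * p by (intro mult_left_mono) auto
      moreover have "(1 - pos u) * (1 / real (Suc (Suc (Suc i)))) \<le> (1 - pos u) * (1 / real (Suc (Suc i)))"
        using * p by (intro mult_left_mono) auto
      ultimately show "A (Suc i) \<subseteq> A i" unfolding A_def by auto
    qed
  qed
  moreover have "(\<Inter>i. A i) = {pos u}"
  proof
    show "{pos u} \<subseteq> (\<Inter>i. A i)" using A by (auto simp: A_def)
    show "(\<Inter>i. A i) \<subseteq> {pos u}"
    proof
      fix x assume x: "x \<in> (\<Inter>i. A i)"
      have l: "(\<lambda>i. 1 / real (Suc (Suc i))) \<longlonglongrightarrow> 0"
        using LIMSEQ_ignore_initial_segment[OF LIMSEQ_inverse_real_of_nat, of 1] by (simp add: inverse_eq_divide)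
      have "(\<lambda>i. pos u * (1 - 1 / real (Suc (Suc i)))) \<longlonglongrightarrow> pos u * (1 - 0)"
        by (intro tendsto_intros l)
      then have "pos u * (1 - 0) \<le> x"
        by (rule LIMSEQ_le_const2) (use x in \<open>auto simp: A_def less_imp_le\<close>)
      moreover have "(\<lambda>i. pos u + (1 - pos u) * (1 / real (Suc (Suc i)))) \<longlonglongrightarrow> pos u + (1 - pos u) * 0"
        by (intro tendsto_intros l)
      then have "x \<le> pos u + (1 - pos u) * 0"
        by (rule LIMSEQ_le_const) (use x in \<open>auto simp: A_def less_imp_le\<close>)
      ultimately show "x \<in> {pos u}" by simp
    qed
  qed
  ultimately have "(\<lambda>i. measure \<mu> (A i)) \<longlonglongrightarrow> measure \<mu> {pos u}" by simp
  moreover have "wt u \<le> measure \<mu> (A i)" for i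
    unfolding A_def by (intro interval A)
  ultimately show ?thesis by (intro LIMSEQ_le_const) blast+
qed

text \<open>The lower bounds for the atoms already add up to 1, the total mass. So none of them can
  be strict, and nothing is left outside the atoms.\<close>

lemma dss_measure_atoms:
  assumes \<mu>: "dss_measure M m \<delta> \<alpha> \<beta> \<mu>"
  shows "snd u \<in> {2..M} \<Longrightarrow> measure \<mu> {pos u} = wt u"
    and "AE x in \<mu>. \<exists>N. x \<in> pos ` idx N"
proof -
  interpret prob_space \<mu> using \<mu> by (simp add: dss_measure_def)
  have sets_\<mu>: "sets \<mu> = sets (restrict_space borel {0..1})"
    using \<mu> by (simp add: dss_measure_def)
  have sing: "{pos u} \<in> sets \<mu>" if "snd u \<in> {2..M}" for u
    unfolding sets_\<mu> using pos_unit[OF that] by (subst sets_restrict_space_iff) auto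
  have fin: "pos ` idx N \<in> sets \<mu>" for N
  proof -
    have "(\<Union>u\<in>idx N. {pos u}) \<in> sets \<mu>" by (intro sets.finite_UN sing) (auto simp: idx_def)
    also have "(\<Union>u\<in>idx N. {pos u}) = pos ` idx N" by auto
    finally show ?thesis .
  qed
  have total: "measure \<mu> (pos ` idx N) = (\<Sum>u\<in>idx N. measure \<mu> {pos u})" for N
  proof -
    have inj: "inj_on pos (idx N)" by (rule inj_on_subset[OF pos_inj]) (auto simp: idx_def)
    have "measure \<mu> (\<Union>u\<in>idx N. {pos u}) = (\<Sum>u\<in>idx N. measure \<mu> {pos u})"
      using inj by (intro measure_finite_Union)
        (auto simp: disjoint_family_on_def emeasure_eq_measure intro!: sing dest: inj_onD, auto simp: idx_def)
    moreover have "(\<Union>u\<in>idx N. {pos u}) = pos ` idx N" by auto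
    ultimately show ?thesis by simp
  qed
  show "measure \<mu> {pos u} = wt u" if u: "snd u \<in> {2..M}"
  proof -
    have "measure \<mu> {pos u} - wt u \<le> \<delta> ^ N" if N: "fst u < N" for N
    proof -
      \<comment> \<open>The excess of one atom is at most the joint excess of the first
        \<open>N\<close> levels, as every excess is nonnegative.\<close>
      have "measure \<mu> {pos u} - wt u \<le> (\<Sum>v\<in>idx N. measure \<mu> {pos v} - wt v)"
        using N u by (intro member_le_sum) (auto simp: idx_def mem_Times_iff intro!: measure_atom_ge[OF \<mu>])
      also have "\<dots> = measure \<mu> (pos ` idx N) - (1 - \<delta> ^ N)"
        using sum_wt[of N, folded idx_def] by (simp add: sum_subtractf total)
      also have "\<dots> \<le> \<delta> ^ N" by simp
      finally show ?thesis .
    qed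
    moreover have "(\<lambda>N. \<delta> ^ N) \<longlonglongrightarrow> 0" using \<delta> by (intro LIMSEQ_power_zero) auto
    ultimately have "measure \<mu> {pos u} - wt u \<le> 0"
      by (intro LIMSEQ_le_const[of "\<lambda>N. \<delta> ^ N"]) (auto intro!: exI[of _ "Suc (fst u)"])
    then show ?thesis using measure_atom_ge[OF \<mu> u] by simp
  qed
  have meas: "(\<Union>N. pos ` idx N) \<in> sets \<mu>" using fin by auto
  have "1 - \<delta> ^ N \<le> measure \<mu> (\<Union>N. pos ` idx N)" for N
  proof -
    have "1 - \<delta> ^ N = (\<Sum>u\<in>idx N. wt u)" using sum_wt by (simp add: idx_def)
    also have "\<dots> \<le> measure \<mu> (pos ` idx N)"
      unfolding total by (intro sum_mono measure_atom_ge[OF \<mu>]) (auto simp: idx_def)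
    also have "\<dots> \<le> measure \<mu> (\<Union>N. pos ` idx N)"
      using meas by (intro finite_measure_mono) auto
    finally show ?thesis .
  qed
  moreover have "(\<lambda>N. 1 - \<delta> ^ N) \<longlonglongrightarrow> 1 - 0"
    using \<delta> by (intro tendsto_intros LIMSEQ_power_zero) auto
  ultimately have "1 - 0 \<le> measure \<mu> (\<Union>N. pos ` idx N)" by (intro LIMSEQ_le_const2) auto
  then have "measure \<mu> (\<Union>N. pos ` idx N) = 1" by (intro antisym) auto
  then have "AE x in \<mu>. x \<in> (\<Union>N. pos ` idx N)" using meas by (simp add: prob_eq_1)
  then show "AE x in \<mu>. \<exists>N. x \<in> pos ` idx N" by simp
qed

end

section \<open>Lattice sums of iterated primitives\<close>

text \<open>\<open>exp_poly (Suc p)\<close> is the primitive of \<open>exp_poly p\<close> that vanishes at \<open>-\<infinity>\<close>, and likewise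
  \<open>pos_pow\<close>.  Hence summation over an arithmetic progression raises the index by one, up to a
  shift of the argument.\<close>

definition exp_poly :: "nat \<Rightarrow> real \<Rightarrow> real" where
  "exp_poly p y = (if y \<le> 0 then exp y else (\<Sum>i\<le>p. y ^ i / fact i))"

definition pos_pow :: "nat \<Rightarrow> real \<Rightarrow> real" where
  "pos_pow p y = max y 0 ^ p / fact p"

lemma exp_poly_nonneg: "0 \<le> exp_poly p y"
  unfolding exp_poly_def by (auto intro!: sum_nonneg)

lemma pos_pow_nonneg: "0 \<le> pos_pow p y"
  unfolding pos_pow_def by auto

lemma power_Suc_diff_bounds:
  fixes u y :: real
  assumes "0 \<le> u" "u \<le> y"
  shows "real (Suc p) * (y - u) * u ^ p \<le> y ^ Suc p - u ^ Suc p"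
    and "y ^ Suc p - u ^ Suc p \<le> real (Suc p) * (y - u) * y ^ p"
proof -
  have eq: "y ^ Suc p - u ^ Suc p = (y - u) * (\<Sum>i<Suc p. y ^ i * u ^ (p - i))"
    by (rule diff_power_eq_sum)
  have "(\<Sum>i<Suc p. u ^ p) \<le> (\<Sum>i<Suc p. y ^ i * u ^ (p - i))"
  proof (intro sum_mono)
    fix i assume "i \<in> {..<Suc p}"
    then have "u ^ p = u ^ i * u ^ (p - i)" by (simp add: power_add[symmetric])
    also have "\<dots> \<le> y ^ i * u ^ (p - i)" using assms by (intro mult_right_mono power_mono) auto
    finally show "u ^ p \<le> y ^ i * u ^ (p - i)" .
  qed
  then have "(y - u) * (real (Suc p) * u ^ p) \<le> (y - u) * (\<Sum>i<Suc p. y ^ i * u ^ (p - i))"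
    using assms by (intro mult_left_mono) auto
  then show "real (Suc p) * (y - u) * u ^ p \<le> y ^ Suc p - u ^ Suc p"
    unfolding eq by (simp only: mult.assoc mult.left_commute)
  have "(\<Sum>i<Suc p. y ^ i * u ^ (p - i)) \<le> (\<Sum>i<Suc p. y ^ p)"
  proof (intro sum_mono)
    fix i assume "i \<in> {..<Suc p}"
    then have "y ^ p = y ^ i * y ^ (p - i)" by (simp add: power_add[symmetric])
    moreover have "y ^ i * u ^ (p - i) \<le> y ^ i * y ^ (p - i)"
      using assms by (intro mult_left_mono power_mono) auto
    ultimately show "y ^ i * u ^ (p - i) \<le> y ^ p" by simp
  qed
  then have "(y - u) * (\<Sum>i<Suc p. y ^ i * u ^ (p - i)) \<le> (y - u) * (real (Suc p) * y ^ p)"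
    using assms by (intro mult_left_mono) auto
  then show "y ^ Suc p - u ^ Suc p \<le> real (Suc p) * (y - u) * y ^ p"
    unfolding eq by (simp only: mult.assoc mult.left_commute)
qed

text \<open>The right side is the integral of the increasing function \<open>exp_poly p\<close> over
  an interval of length \<open>l\<close> that starts at \<open>y\<close>.\<close>

lemma exp_poly_step:
  assumes l: "0 \<le> l"
  shows "l * exp_poly p y \<le> exp_poly (Suc p) (y + l) - exp_poly (Suc p) y"
proof -
  consider "y + l \<le> 0" | "y \<le> 0" "0 < y + l" | "0 < y" by linarith
  then show ?thesis
  proof cases
    case 1
    have "exp y * (1 + l) \<le> exp y * exp l"
      by (intro mult_left_mono exp_ge_add_one_self) auto
    then show ?thesis using 1 l by (simp add: exp_poly_def exp_add algebra_simps)
  next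
    case 2
    have e: "(1 - y) * exp y \<le> 1"
    proof -
      have "(1 - y) * exp y \<le> exp (- y) * exp y"
        using exp_ge_add_one_self[of "- y"] by (intro mult_right_mono) auto
      then show ?thesis by (simp add: exp_minus)
    qed
    \<comment> \<open>Here the two branches of the definition meet. The bounds
      \<open>1 - y \<le> 1 + l\<close> and \<open>(1 - y) * exp y \<le> 1\<close> settle the
      constant and linear terms of the polynomial; the other terms are nonnegative.\<close>
    have "(1 - y) * (1 - exp y) \<le> (1 + l) * (1 - exp y)"
      using 2 by (intro mult_right_mono) auto
    then have "l * exp y \<le> 1 + (y + l) - exp y" using e by (simp add: algebra_simps)
    moreover have "1 + (y + l) \<le> (\<Sum>i\<le>Suc p. (y + l) ^ i / fact i)"
    proof -
      have "(\<Sum>i\<in>{..1}. (y + l) ^ i / fact i) \<le> (\<Sum>i\<le>Suc p. (y + l) ^ i / fact i)"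
        using 2 by (intro sum_mono2) auto
      then show ?thesis by simp
    qed
    ultimately show ?thesis using 2 by (simp add: exp_poly_def)
  next
    case 3
    have "l * (\<Sum>i\<le>p. y ^ i / fact i) = (\<Sum>i\<le>p. l * (y ^ i / fact i))"
      by (rule sum_distrib_left)
    also have "\<dots> \<le> (\<Sum>i\<le>p. (y + l) ^ Suc i / fact (Suc i) - y ^ Suc i / fact (Suc i))"
    proof (intro sum_mono)
      fix i
      have "l * (y ^ i / fact i) = real (Suc i) * (y + l - y) * y ^ i / fact (Suc i)"
        by (simp add: divide_simps)
      also have "\<dots> \<le> ((y + l) ^ Suc i - y ^ Suc i) / fact (Suc i)"
        using 3 l by (intro divide_right_mono power_Suc_diff_bounds) auto
      finally show "l * (y ^ i / fact i) \<le> (y + l) ^ Suc i / fact (Suc i) - y ^ Suc i / fact (Suc i)"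
        by (simp only: diff_divide_distrib)
    qed
    also have "\<dots> = (\<Sum>i\<le>Suc p. (y + l) ^ i / fact i) - (\<Sum>i\<le>Suc p. y ^ i / fact i)"
      by (subst (1 2) sum.atMost_Suc_shift) (simp add: sum_subtractf)
    finally show ?thesis using 3 l by (simp add: exp_poly_def del: sum.atMost_Suc)
  qed
qed

text \<open>The mirror image of \<open>exp_poly_step\<close>: the integral of an increasing function
  is at most \<open>l\<close> times its value at the right end.\<close>

lemma pos_pow_step:
  assumes l: "0 \<le> l"
  shows "pos_pow (Suc p) y - pos_pow (Suc p) (y - l) \<le> l * pos_pow p y"
proof (cases "0 \<le> y")
  case True
  define u where "u = max (y - l) 0"
  have u: "0 \<le> u" "u \<le> y" "y - u \<le> l" using True l by (auto simp: u_def)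
  have "pos_pow (Suc p) y - pos_pow (Suc p) (y - l) = (y ^ Suc p - u ^ Suc p) / fact (Suc p)"
    using True by (simp add: pos_pow_def u_def diff_divide_distrib)
  also have "\<dots> \<le> (real (Suc p) * (y - u) * y ^ p) / fact (Suc p)"
    using u by (intro divide_right_mono power_Suc_diff_bounds) auto
  also have "\<dots> = (y - u) * (y ^ p / fact p)" by (simp add: divide_simps)
  also have "\<dots> \<le> l * (y ^ p / fact p)"
    using u True by (intro mult_right_mono) auto
  finally show ?thesis using True by (simp add: pos_pow_def)
next
  case False
  then have "pos_pow (Suc p) y = 0" by (simp add: pos_pow_def)
  then show ?thesis
    using pos_pow_nonneg[of "Suc p" "y - l"] pos_pow_nonneg[of p y] l
    by (smt (verit) mult_nonneg_nonneg)
qed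

text \<open>Every term is compared with the integral over the interval to its right, which costs the
  shift by \<open>l\<close>. The telescoped remainder is dropped, so the bound is free of
  \<open>N\<close>.\<close>

lemma sum_exp_poly_le:
  assumes l: "0 < l"
  shows "(\<Sum>n<N. exp_poly p (y - real n * l)) \<le> exp_poly (Suc p) (y + l) / l"
proof -
  have "l * (\<Sum>n<N. exp_poly p (y - real n * l))
      \<le> (\<Sum>n<N. exp_poly (Suc p) (y + l - real n * l) - exp_poly (Suc p) (y + l - real (Suc n) * l))"
    unfolding sum_distrib_left
  proof (intro sum_mono)
    fix n
    show "l * exp_poly p (y - real n * l)
      \<le> exp_poly (Suc p) (y + l - real n * l) - exp_poly (Suc p) (y + l - real (Suc n) * l)"
      using exp_poly_step[of l p "y - real n * l"] l by (simp add: algebra_simps)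
  qed
  also have "\<dots> = exp_poly (Suc p) (y + l) - exp_poly (Suc p) (y + l - real N * l)"
    by (subst sum_lessThan_telescope') simp
  also have "\<dots> \<le> exp_poly (Suc p) (y + l)" using exp_poly_nonneg by simp
  finally show ?thesis using l by (simp add: field_simps)
qed

text \<open>Every term is compared with the integral over the interval to its left, so no shift
  occurs. The condition on \<open>N\<close> makes the telescoped remainder vanish.\<close>

lemma sum_pos_pow_ge:
  assumes l: "0 < l" and N: "y \<le> real N * l"
  shows "pos_pow (Suc p) y / l \<le> (\<Sum>n<N. pos_pow p (y - real n * l))"
proof -
  have "pos_pow (Suc p) y = pos_pow (Suc p) y - pos_pow (Suc p) (y - real N * l)"
    using N by (simp add: pos_pow_def)
  also have "\<dots> = (\<Sum>n<N. pos_pow (Suc p) (y - real n * l) - pos_pow (Suc p) (y - real (Suc n) * l))"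
    by (subst sum_lessThan_telescope') simp
  also have "\<dots> \<le> (\<Sum>n<N. l * pos_pow p (y - real n * l))"
  proof (intro sum_mono)
    fix n
    show "pos_pow (Suc p) (y - real n * l) - pos_pow (Suc p) (y - real (Suc n) * l) \<le> l * pos_pow p (y - real n * l)"
      using pos_pow_step[of l p "y - real n * l"] l by (simp add: algebra_simps)
  qed
  finally show ?thesis using l by (simp add: sum_distrib_left[symmetric] field_simps)
qed

lemma sum_PiE_insert:
  assumes "j \<notin> J"
  shows "(\<Sum>i\<in>Pi\<^sub>E (insert j J) A. f i) = (\<Sum>x\<in>A j. \<Sum>i\<in>Pi\<^sub>E J A. f (i(j := x)))"
proof -
  have "(\<Sum>i\<in>Pi\<^sub>E (insert j J) A. f i) = (\<Sum>z\<in>A j \<times> Pi\<^sub>E J A. f ((snd z)(j := fst z)))"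
    unfolding PiE_insert_eq
    by (subst sum.reindex[OF inj_combinator[OF assms]]) (simp add: case_prod_unfold)
  then show ?thesis by (simp add: sum.cartesian_product')
qed

text \<open>Each coordinate contributes \<open>card (K j)\<close> copies of an arithmetic
  progression of step \<open>l j\<close>: a factor \<open>card (K j) / l j\<close>, one more
  integration and a shift by \<open>l j\<close>.\<close>

lemma lattice_sum_exp_poly_le:
  fixes K :: "'j \<Rightarrow> 'k set"
  assumes J: "finite J" and l: "\<And>j. j \<in> J \<Longrightarrow> 0 < l j"
  shows "(\<Sum>i\<in>(\<Pi>\<^sub>E j\<in>J. {..<N} \<times> K j). exp_poly 1 (y - (\<Sum>j\<in>J. real (fst (i j)) * l j)))
       \<le> (\<Prod>j\<in>J. real (card (K j)) / l j) * exp_poly (Suc (card J)) (y + (\<Sum>j\<in>J. l j))"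
  using J l
proof (induct J arbitrary: y)
  case empty
  then show ?case by simp
next
  case (insert j J)
  let ?A = "\<lambda>j. {..<N} \<times> K j"
  define C where "C = (\<Prod>j\<in>J. real (card (K j)) / l j)"
  have C: "0 \<le> C" unfolding C_def using insert.prems by (intro prod_nonneg) (auto simp: less_imp_le)
  have upd: "(\<Sum>k\<in>J. real (fst ((i(j := x)) k)) * l k) = (\<Sum>k\<in>J. real (fst (i k)) * l k)" for i x
    using insert.hyps by (intro sum.cong) auto
  have "(\<Sum>i\<in>Pi\<^sub>E (insert j J) ?A. exp_poly 1 (y - (\<Sum>k\<in>insert j J. real (fst (i k)) * l k)))
      = (\<Sum>x\<in>?A j. \<Sum>i\<in>Pi\<^sub>E J ?A. exp_poly 1 ((y - real (fst x) * l j) - (\<Sum>k\<in>J. real (fst (i k)) * l k)))"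
    using insert.hyps by (simp add: sum_PiE_insert upd diff_diff_add del: fun_upd_apply) simp
  also have "\<dots> \<le> (\<Sum>x\<in>?A j. C * exp_poly (Suc (card J)) ((y - real (fst x) * l j) + sum l J))"
    unfolding C_def using insert.prems by (intro sum_mono insert.hyps(3)) auto
  also have "\<dots> = card (K j) * C * (\<Sum>n<N. exp_poly (Suc (card J)) (y + sum l J - real n * l j))"
    by (simp add: sum.cartesian_product' sum_distrib_left algebra_simps)
  also have "\<dots> \<le> card (K j) * C * (exp_poly (Suc (Suc (card J))) (y + sum l J + l j) / l j)"
    using C insert.prems by (intro mult_left_mono sum_exp_poly_le) auto
  also have "\<dots> = (\<Prod>j\<in>insert j J. real (card (K j)) / l j) * exp_poly (Suc (card (insert j J))) (y + sum l (insert j J))"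
    using insert.hyps by (simp add: C_def add_ac)
  finally show ?case .
qed

text \<open>Fixing a coordinate only lowers the argument, so one \<open>N\<close> serves the whole
  induction.\<close>

lemma lattice_sum_pos_pow_ge:
  fixes K :: "'j \<Rightarrow> 'k set"
  assumes J: "finite J" and l: "\<And>j. j \<in> J \<Longrightarrow> 0 < l j" and N: "\<And>j. j \<in> J \<Longrightarrow> y \<le> real N * l j"
  shows "(\<Prod>j\<in>J. real (card (K j)) / l j) * pos_pow (Suc (card J)) y
       \<le> (\<Sum>i\<in>(\<Pi>\<^sub>E j\<in>J. {..<N} \<times> K j). pos_pow 1 (y - (\<Sum>j\<in>J. real (fst (i j)) * l j)))"
  using J l N
proof (induct J arbitrary: y)
  case empty
  then show ?case by simp
next
  case (insert j J)
  let ?A = "\<lambda>j. {..<N} \<times> K j"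
  define C where "C = (\<Prod>j\<in>J. real (card (K j)) / l j)"
  have C: "0 \<le> C" unfolding C_def using insert.prems by (intro prod_nonneg) (auto simp: less_imp_le)
  have upd: "(\<Sum>k\<in>J. real (fst ((i(j := x)) k)) * l k) = (\<Sum>k\<in>J. real (fst (i k)) * l k)" for i x
    using insert.hyps by (intro sum.cong) auto
  have "(\<Prod>j\<in>insert j J. real (card (K j)) / l j) * pos_pow (Suc (card (insert j J))) y
      = card (K j) * C * (pos_pow (Suc (Suc (card J))) y / l j)"
    using insert.hyps by (simp add: C_def)
  also have "\<dots> \<le> card (K j) * C * (\<Sum>n<N. pos_pow (Suc (card J)) (y - real n * l j))"
    using C insert.prems by (intro mult_left_mono sum_pos_pow_ge) auto
  also have "\<dots> = (\<Sum>x\<in>?A j. C * pos_pow (Suc (card J)) (y - real (fst x) * l j))"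
    by (simp add: sum.cartesian_product' sum_distrib_left algebra_simps)
  also have "\<dots> \<le> (\<Sum>x\<in>?A j. \<Sum>i\<in>Pi\<^sub>E J ?A. pos_pow 1 ((y - real (fst x) * l j) - (\<Sum>k\<in>J. real (fst (i k)) * l k)))"
    unfolding C_def
  proof (intro sum_mono insert.hyps(3))
    fix x k assume "x \<in> ?A j" "k \<in> J"
    have "y \<le> real N * l k" "0 < l j" using insert.prems \<open>k \<in> J\<close> by auto
    moreover from this have "0 \<le> real (fst x) * l j" by simp
    ultimately show "y - real (fst x) * l j \<le> real N * l k" by linarith
  qed (use insert.prems in auto)
  also have "\<dots> = (\<Sum>i\<in>Pi\<^sub>E (insert j J) ?A. pos_pow 1 (y - (\<Sum>k\<in>insert j J. real (fst (i k)) * l k)))"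
    using insert.hyps by (simp add: sum_PiE_insert upd diff_diff_add del: fun_upd_apply) simp
  finally show ?case .
qed

lemma ln_one_plus_exp_bounds:
  "pos_pow 1 y \<le> ln (1 + exp y)" "ln (1 + exp y) \<le> exp_poly 1 y"
proof -
  have "ln 1 \<le> ln (1 + exp y)" "ln (exp y) \<le> ln (1 + exp y)"
    by (subst ln_le_cancel_iff; simp add: add_pos_pos)+
  then show "pos_pow 1 y \<le> ln (1 + exp y)" by (simp add: pos_pow_def)
  show "ln (1 + exp y) \<le> exp_poly 1 y"
  proof (cases "y \<le> 0")
    case True
    then show ?thesis using ln_add_one_self_le_self[of "exp y"] by (simp add: exp_poly_def)
  next
    case False
    have "1 + exp y = exp y * (1 + exp (- y))" by (simp add: distrib_left exp_minus)
    moreover have "0 < 1 + exp (- y)" by (simp add: add_pos_pos)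
    ultimately have "ln (1 + exp y) = y + ln (1 + exp (- y))"
      by (simp only: ln_mult_pos exp_gt_zero ln_exp)
    also have "\<dots> \<le> y + exp (- y)" using ln_add_one_self_le_self[of "exp (- y)"] by simp
    also have "\<dots> \<le> y + 1" using False by simp
    finally show ?thesis using False by (simp add: exp_poly_def)
  qed
qed

text \<open>The leading term is kept exactly, and the lower ones are hidden in a shift of the
  argument that the asymptotics do not see. Coefficients are compared with the binomial ones by
  \<open>fact k \<le> k ^ k\<close>.\<close>

lemma exp_poly_le_power:
  assumes y: "0 < y"
  shows "exp_poly p y \<le> (y + real p) ^ p / fact p"
proof -
  have "y ^ i / fact i \<le> of_nat (p choose i) * y ^ i * real p ^ (p - i) / fact p" if "i \<le> p" for i
  proof -
    have "fact (p - i) \<le> real p ^ (p - i)"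
    proof -
      have "fact (p - i) \<le> (real (p - i)) ^ (p - i)"
        using fact_le_power[of "p - i", where ?'a = real] by simp
      also have "\<dots> \<le> real p ^ (p - i)" by (intro power_mono) auto
      finally show ?thesis .
    qed
    then have "y ^ i / fact i * 1 \<le> y ^ i / fact i * (real p ^ (p - i) / fact (p - i))"
      using y by (intro mult_left_mono) auto
    also have "\<dots> = of_nat (p choose i) * y ^ i * real p ^ (p - i) / fact p"
      using that by (simp add: binomial_fact)
    finally show ?thesis by simp
  qed
  then have "(\<Sum>i\<le>p. y ^ i / fact i) \<le> (\<Sum>i\<le>p. of_nat (p choose i) * y ^ i * real p ^ (p - i) / fact p)"
    by (intro sum_mono) auto
  then show ?thesis
    using y by (simp add: exp_poly_def binomial_ring sum_divide_distrib)
qed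

section \<open>From Laplace transforms to small ball probabilities\<close>

lemma ln_small_ball_asymp:
  fixes p :: "real \<Rightarrow> real"
  assumes D: "0 < D" and n: "0 < n"
    and upper: "\<And>\<epsilon>. 0 < \<epsilon> \<Longrightarrow> \<epsilon> < 1 \<Longrightarrow> p \<epsilon> \<le> exp (1 - D * pos_pow n (2 * ln (1 / \<epsilon>) + c1) / 2)"
    and lower: "\<And>\<epsilon> \<theta>. 0 < \<epsilon> \<Longrightarrow> 0 < \<theta> \<Longrightarrow> exp (- D * exp_poly n (ln \<theta> + c2) / 2) - exp (- \<theta> * \<epsilon>\<^sup>2) \<le> p \<epsilon>"
  shows "(\<lambda>\<epsilon>. ln (p \<epsilon>)) \<sim>[at_right 0] (\<lambda>\<epsilon>. - (2 ^ (n - 1) * D / fact n) * ln (1 / \<epsilon>) ^ n)"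
proof -
  define B where "B = 2 ^ (n - 1) * D / fact n"
  have B: "0 < B" using D by (simp add: B_def)
  have B2: "D / (2 * fact n) * 2 ^ n = B"
    using n by (cases n) (auto simp: B_def)
  define q1 where "q1 L = D * ((2 * L + c1) ^ n / fact n) / 2 - 1" for L
  \<comment> \<open>The summand \<open>ln 2\<close> pays for keeping only half of the lower bound
    for the Laplace transform, the other half absorbing
    \<open>exp (- \<theta> * \<epsilon>\<^sup>2)\<close>. In \<open>q1\<close> the summand
    \<open>- 1\<close> is the factor \<open>exp 1\<close> of the hypothesis
    \<open>upper\<close>.\<close>
  define q2 where "q2 L = D * ((2 * L + real (n + 1) * ln L + c2 + real n) ^ n / fact n) / 2 + ln 2" for L
  have base1: "((\<lambda>L. (2 * L + c1) / L) \<longlongrightarrow> 2) at_top" by real_asymp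
  have base2: "((\<lambda>L. (2 * L + real (n + 1) * ln L + c2 + real n) / L) \<longlongrightarrow> 2) at_top" by real_asymp
  have inv: "((\<lambda>L::real. c / L ^ n) \<longlongrightarrow> 0) at_top" for c
    using n by (intro tendsto_divide_0[OF tendsto_const] filterlim_at_top_imp_at_infinity filterlim_pow_at_top filterlim_ident)
  have lim1: "((\<lambda>L. q1 L / L ^ n) \<longlongrightarrow> B) at_top"
  proof -
    have "((\<lambda>L. D / (2 * fact n) * ((2 * L + c1) / L) ^ n - 1 / L ^ n) \<longlongrightarrow> D / (2 * fact n) * 2 ^ n - 0) at_top"
      by (intro tendsto_intros base1 inv)
    then show ?thesis unfolding B2 by (simp add: q1_def diff_divide_distrib power_divide mult_ac)
  qed
  have lim2: "((\<lambda>L. q2 L / L ^ n) \<longlongrightarrow> B) at_top"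
  proof -
    have "((\<lambda>L. D / (2 * fact n) * ((2 * L + real (n + 1) * ln L + c2 + real n) / L) ^ n + ln 2 / L ^ n) \<longlongrightarrow> D / (2 * fact n) * 2 ^ n + 0) at_top"
      by (intro tendsto_intros base2 inv)
    then show ?thesis unfolding B2 by (simp add: q2_def add_divide_distrib[of _ "ln 2"] power_divide mult_ac)
  qed
  have L: "filterlim (\<lambda>\<epsilon>::real. ln (1 / \<epsilon>)) at_top (at_right 0)" by real_asymp
  have ev1: "\<forall>\<^sub>F \<epsilon> in at_right 0. (0::real) < \<epsilon> \<and> \<epsilon> < 1"
    by (auto simp: eventually_at_right_field intro!: exI[of _ 1])
  have evL: "\<forall>\<^sub>F L in at_top. (1::real) < L \<and> 0 < 2 * L + c1 \<and> 0 < 2 * L + real (n + 1) * ln L + c2 \<and> q2 L < L ^ (n + 1)"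
  proof (intro eventually_conj)
    show "\<forall>\<^sub>F L::real in at_top. 1 < L" by real_asymp
    show "\<forall>\<^sub>F L in at_top. 0 < 2 * L + c1" by real_asymp
    show "\<forall>\<^sub>F L in at_top. 0 < 2 * L + real (n + 1) * ln L + c2" by real_asymp
    have "\<forall>\<^sub>F L in at_top. q2 L / L ^ n < B + 1"
      using lim2 by (rule order_tendstoD) simp
    moreover have "\<forall>\<^sub>F L in at_top. max 1 (B + 1) < L" by (rule eventually_gt_at_top)
    ultimately show "\<forall>\<^sub>F L in at_top. q2 L < L ^ (n + 1)"
    proof eventually_elim
      case (elim L)
      then have "q2 L < (B + 1) * L ^ n" by (simp add: divide_simps)
      also have "\<dots> \<le> L * L ^ n" using elim by (intro mult_right_mono) auto
      finally show ?case by simp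
    qed
  qed
  have bounds: "\<forall>\<^sub>F \<epsilon> in at_right 0. q1 (ln (1 / \<epsilon>)) \<le> - ln (p \<epsilon>) \<and> - ln (p \<epsilon>) \<le> q2 (ln (1 / \<epsilon>))"
    using ev1 eventually_compose_filterlim[OF evL L]
  proof eventually_elim
    case (elim \<epsilon>)
    define L where "L = ln (1 / \<epsilon>)"
    have L: "1 < L" "0 < 2 * L + c1" "0 < 2 * L + real (n + 1) * ln L + c2" "q2 L < L ^ (n + 1)" and \<epsilon>: "0 < \<epsilon>" "\<epsilon> < 1"
      using elim by (auto simp: L_def)
    \<comment> \<open>The subtracted term becomes \<open>exp (- (L ^ (n + 1)))\<close>, which is
      negligible against a bound whose exponent has order \<open>L ^ n\<close>. The price is a
      summand \<open>real (n + 1) * ln L\<close> in \<open>ln \<theta>\<close>, of lower order than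
      \<open>L\<close>.\<close>
    define \<theta> where "\<theta> = L ^ (n + 1) / \<epsilon>\<^sup>2"
    have \<theta>: "0 < \<theta>" "\<theta> * \<epsilon>\<^sup>2 = L ^ (n + 1)" using L \<epsilon> by (auto simp: \<theta>_def)
    have ln\<theta>: "ln \<theta> = 2 * L + real (n + 1) * ln L"
    proof -
      have "ln \<theta> = ln (L ^ (n + 1)) - ln (\<epsilon>\<^sup>2)"
        unfolding \<theta>_def using L \<epsilon> by (intro ln_divide_pos) auto
      moreover have "ln (L ^ (n + 1)) = real (n + 1) * ln L" by (rule ln_realpow)
      moreover have "ln (\<epsilon>\<^sup>2) = 2 * ln \<epsilon>" using \<epsilon> ln_realpow[of \<epsilon> 2] by simp
      moreover have "L = - ln \<epsilon>" using \<epsilon> by (simp add: L_def ln_divide_pos)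
      ultimately show ?thesis by simp
    qed
    have "exp (- q2 L) = exp (- (D * ((2 * L + real (n + 1) * ln L + c2 + real n) ^ n / fact n) / 2)) / 2"
      by (simp add: q2_def exp_diff exp_minus)
    also have "\<dots> \<le> exp (- D * exp_poly n (ln \<theta> + c2) / 2) / 2"
      using mult_left_mono[OF exp_poly_le_power[OF L(3), of n], of D] D unfolding ln\<theta> by simp
    finally have 1: "2 * exp (- q2 L) \<le> exp (- D * exp_poly n (ln \<theta> + c2) / 2)" by simp
    have "exp (- \<theta> * \<epsilon>\<^sup>2) \<le> exp (- q2 L)" using L \<theta> by simp
    then have low: "exp (- q2 L) \<le> p \<epsilon>" using lower[OF \<epsilon>(1) \<theta>(1)] 1 by linarith
    then have pos: "0 < p \<epsilon>" by (smt (verit) exp_gt_zero)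
    have "- q2 L \<le> ln (p \<epsilon>)" using low pos by (simp add: ln_ge_iff)
    moreover have "ln (p \<epsilon>) \<le> - q1 L"
    proof -
      have "p \<epsilon> \<le> exp (- q1 L)"
        using upper[OF \<epsilon>] L(2) by (simp add: q1_def pos_pow_def L_def)
      then have "ln (p \<epsilon>) \<le> ln (exp (- q1 L))" using pos by (subst ln_le_cancel_iff) auto
      then show ?thesis by simp
    qed
    ultimately show ?case by (simp add: L_def)
  qed
  have "((\<lambda>\<epsilon>. - ln (p \<epsilon>) / ln (1 / \<epsilon>) ^ n) \<longlongrightarrow> B) (at_right 0)"
  proof (rule tendsto_sandwich)
    show "((\<lambda>\<epsilon>. q1 (ln (1 / \<epsilon>)) / ln (1 / \<epsilon>) ^ n) \<longlongrightarrow> B) (at_right 0)"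
      by (rule filterlim_compose[OF lim1 L])
    show "((\<lambda>\<epsilon>. q2 (ln (1 / \<epsilon>)) / ln (1 / \<epsilon>) ^ n) \<longlongrightarrow> B) (at_right 0)"
      by (rule filterlim_compose[OF lim2 L])
    show "\<forall>\<^sub>F \<epsilon> in at_right 0. q1 (ln (1 / \<epsilon>)) / ln (1 / \<epsilon>) ^ n \<le> - ln (p \<epsilon>) / ln (1 / \<epsilon>) ^ n"
      using bounds ev1 by eventually_elim (intro divide_right_mono, auto)
    show "\<forall>\<^sub>F \<epsilon> in at_right 0. - ln (p \<epsilon>) / ln (1 / \<epsilon>) ^ n \<le> q2 (ln (1 / \<epsilon>)) / ln (1 / \<epsilon>) ^ n"
      using bounds ev1 by eventually_elim (intro divide_right_mono, auto)
  qed
  from tendsto_divide[OF this tendsto_const, of B]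
  have "((\<lambda>\<epsilon>. ln (p \<epsilon>) / (- B * ln (1 / \<epsilon>) ^ n)) \<longlongrightarrow> 1) (at_right 0)"
    using B by (simp add: field_simps)
  then show ?thesis
    unfolding B_def by (rule asymp_equivI')
qed

section \<open>Gaussian fields\<close>

lemma gaussian_rv_moments:
  assumes P: "prob_space P" and Y: "gaussian_rv P Y"
  shows "integrable P Y" "integrable P (\<lambda>\<omega>. (Y \<omega>)\<^sup>2)"
    and "(\<integral>\<omega>. Y \<omega> \<partial>P) = 0 \<Longrightarrow> (\<integral>\<omega>. iexp (Y \<omega>) \<partial>P) = of_real (exp (- (\<integral>\<omega>. (Y \<omega>)\<^sup>2 \<partial>P) / 2))"
proof -
  interpret prob_space P by fact
  have Ym [measurable]: "Y \<in> borel_measurable P" using Y by (simp add: gaussian_rv_def)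
  consider c where "AE \<omega> in P. Y \<omega> = c" | c \<sigma> where "0 < \<sigma>" "distributed P lborel Y (normal_density c \<sigma>)"
    using Y by (auto simp: gaussian_rv_def)
  then have "integrable P Y \<and> integrable P (\<lambda>\<omega>. (Y \<omega>)\<^sup>2) \<and> ((\<integral>\<omega>. Y \<omega> \<partial>P) = 0 \<longrightarrow>
    (\<integral>\<omega>. iexp (Y \<omega>) \<partial>P) = of_real (exp (- (\<integral>\<omega>. (Y \<omega>)\<^sup>2 \<partial>P) / 2)))"
  proof cases
    case (1 c)
    have eq: "(\<integral>\<omega>. g (Y \<omega>) \<partial>P) = g c" if [measurable]: "g \<in> borel_measurable borel"
      for g :: "real \<Rightarrow> 'b::{banach,second_countable_topology}"
    proof -
      have "(\<integral>\<omega>. g (Y \<omega>) \<partial>P) = (\<integral>\<omega>. g c \<partial>P)"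
        using 1 by (intro integral_cong_AE) auto
      then show ?thesis by (simp add: prob_space)
    qed
    have "integrable P Y"
      by (rule integrable_const_bound[where B="\<bar>c\<bar>"]) (use 1 in auto)
    moreover have "integrable P (\<lambda>\<omega>. (Y \<omega>)\<^sup>2)"
      by (rule integrable_const_bound[where B="c\<^sup>2"]) (use 1 in auto)
    ultimately show ?thesis
      using eq[of "\<lambda>y. y"] eq[of "\<lambda>y. y\<^sup>2"] eq[of iexp] by simp
  next
    case (2 c \<sigma>)
    define Z where "Z \<omega> = (Y \<omega> - c) / \<sigma>" for \<omega>
    have "distributed P lborel Z std_normal_density"
      using 2 normal_standard_normal_convert[of \<sigma> Y c] by (simp add: Z_def[abs_def])
    then have dist: "distr P lborel Z = std_normal_distribution" and Zm [measurable]: "Z \<in> borel_measurable P"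
      by (auto simp: distributed_def)
    have YZ: "Y \<omega> = \<sigma> * Z \<omega> + c" for \<omega> using 2 by (simp add: Z_def)
    have intZ: "integrable P (\<lambda>\<omega>. Z \<omega> ^ k)" for k
    proof -
      have "integrable (distr P lborel Z) (\<lambda>x. x ^ k)"
        unfolding dist by (rule integrable_std_normal_distribution_moment)
      then show ?thesis by (subst (asm) integrable_distr_eq) auto
    qed
    have 1: "integrable P Y"
      unfolding YZ using intZ[of 1] by simp
    have 3: "integrable P (\<lambda>\<omega>. (Y \<omega>)\<^sup>2)"
      unfolding YZ power2_sum using intZ[of 1] intZ[of 2] by (simp add: power_mult_distrib)
    have ex: "expectation Y = c" by (rule normal_distributed_expectation[OF 2])
    have "(\<integral>\<omega>. iexp (Y \<omega>) \<partial>P) = of_real (exp (- (\<integral>\<omega>. (Y \<omega>)\<^sup>2 \<partial>P) / 2))" if "expectation Y = 0"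
    proof -
      have c: "c = 0" using ex that by simp
      have "(\<integral>\<omega>. (Y \<omega>)\<^sup>2 \<partial>P) = \<sigma>\<^sup>2"
        using normal_distributed_variance[OF 2] ex c by simp
      moreover have "(\<integral>\<omega>. iexp (Y \<omega>) \<partial>P) = (\<integral>x. iexp (\<sigma> * x) \<partial>distr P lborel Z)"
        by (subst integral_distr) (auto simp: YZ c)
      ultimately show ?thesis unfolding dist integral_iexp_std_normal by simp
    qed
    then show ?thesis using 1 3 by simp
  qed
  then show "integrable P Y" "integrable P (\<lambda>\<omega>. (Y \<omega>)\<^sup>2)"
    and "(\<integral>\<omega>. Y \<omega> \<partial>P) = 0 \<Longrightarrow> (\<integral>\<omega>. iexp (Y \<omega>) \<partial>P) = of_real (exp (- (\<integral>\<omega>. (Y \<omega>)\<^sup>2 \<partial>P) / 2))"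
    by auto
qed

text \<open>A linear combination of the field is again Gaussian, so its mean and variance determine
  the value; the variance is the covariance form.\<close>

lemma gaussian_field_char:
  assumes P: "prob_space P" and X: "gaussian_field P T X" and S: "finite S" "S \<subseteq> T"
    and mean: "\<And>x. x \<in> T \<Longrightarrow> (\<integral>\<omega>. X x \<omega> \<partial>P) = 0"
  shows "(\<integral>\<omega>. iexp (\<Sum>x\<in>S. c x * X x \<omega>) \<partial>P)
     = of_real (exp (- (\<Sum>x\<in>S. \<Sum>y\<in>S. c x * c y * (\<integral>\<omega>. X x \<omega> * X y \<omega> \<partial>P)) / 2))"
    and "x \<in> T \<Longrightarrow> integrable P (\<lambda>\<omega>. (X x \<omega>)\<^sup>2)" and "x \<in> T \<Longrightarrow> X x \<in> borel_measurable P"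
proof -
  interpret prob_space P by fact
  have rv: "gaussian_rv P (X x)" if "x \<in> T" for x
    using X[unfolded gaussian_field_def, rule_format, of "{x}" "\<lambda>_. 1"] that by simp
  have m [measurable]: "X x \<in> borel_measurable P" if "x \<in> T" for x
    using rv[OF that] by (simp add: gaussian_rv_def)
  have int: "integrable P (X x)" and int2: "integrable P (\<lambda>\<omega>. (X x \<omega>)\<^sup>2)" if "x \<in> T" for x
    using gaussian_rv_moments[OF P rv[OF that]] by auto
  show "integrable P (\<lambda>\<omega>. (X x \<omega>)\<^sup>2)" "X x \<in> borel_measurable P" if "x \<in> T"
    using int2 m that by auto
  have intxy: "integrable P (\<lambda>\<omega>. X x \<omega> * X y \<omega>)" if "x \<in> T" "y \<in> T" for x y
  proof (rule Bochner_Integration.integrable_bound)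
    show "integrable P (\<lambda>\<omega>. (X x \<omega>)\<^sup>2 + (X y \<omega>)\<^sup>2)" using int2 that by auto
    show "(\<lambda>\<omega>. X x \<omega> * X y \<omega>) \<in> borel_measurable P" using m that by auto
    have "\<bar>s * t\<bar> \<le> s\<^sup>2 + t\<^sup>2" for s t :: real
    proof -
      have "0 \<le> \<bar>s\<bar> * \<bar>t\<bar>" by simp
      moreover have "2 * \<bar>s\<bar> * \<bar>t\<bar> \<le> s\<^sup>2 + t\<^sup>2"
        using sum_squares_bound[of "\<bar>s\<bar>" "\<bar>t\<bar>"] by simp
      ultimately show ?thesis unfolding abs_mult by linarith
    qed
    then show "AE \<omega> in P. norm (X x \<omega> * X y \<omega>) \<le> norm ((X x \<omega>)\<^sup>2 + (X y \<omega>)\<^sup>2)" by simp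
  qed
  have Y: "gaussian_rv P (\<lambda>\<omega>. \<Sum>x\<in>S. c x * X x \<omega>)"
    using X S by (simp add: gaussian_field_def)
  have "(\<integral>\<omega>. (\<Sum>x\<in>S. c x * X x \<omega>) \<partial>P) = (\<Sum>x\<in>S. c x * (\<integral>\<omega>. X x \<omega> \<partial>P))"
    using S int by (subst Bochner_Integration.integral_sum) auto
  also have "\<dots> = 0" using S mean by (intro sum.neutral) auto
  finally have "(\<integral>\<omega>. iexp (\<Sum>x\<in>S. c x * X x \<omega>) \<partial>P) = of_real (exp (- (\<integral>\<omega>. (\<Sum>x\<in>S. c x * X x \<omega>)\<^sup>2 \<partial>P) / 2))"
    by (rule gaussian_rv_moments(3)[OF P Y])
  also have "(\<integral>\<omega>. (\<Sum>x\<in>S. c x * X x \<omega>)\<^sup>2 \<partial>P) = (\<integral>\<omega>. (\<Sum>x\<in>S. \<Sum>y\<in>S. c x * c y * (X x \<omega> * X y \<omega>)) \<partial>P)"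
    by (intro Bochner_Integration.integral_cong refl) (simp add: power2_eq_square sum_product ac_simps)
  also have "\<dots> = (\<Sum>x\<in>S. \<Sum>y\<in>S. \<integral>\<omega>. c x * c y * (X x \<omega> * X y \<omega>) \<partial>P)"
  proof -
    have ii: "integrable P (\<lambda>\<omega>. c x * c y * (X x \<omega> * X y \<omega>))" if "x \<in> S" "y \<in> S" for x y
      using intxy[of x y] that S by (intro integrable_mult_right) auto
    have "(\<integral>\<omega>. (\<Sum>x\<in>S. \<Sum>y\<in>S. c x * c y * (X x \<omega> * X y \<omega>)) \<partial>P)
        = (\<Sum>x\<in>S. \<integral>\<omega>. (\<Sum>y\<in>S. c x * c y * (X x \<omega> * X y \<omega>)) \<partial>P)"
      by (intro Bochner_Integration.integral_sum Bochner_Integration.integrable_sum ii)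
    also have "\<dots> = (\<Sum>x\<in>S. \<Sum>y\<in>S. \<integral>\<omega>. c x * c y * (X x \<omega> * X y \<omega>) \<partial>P)"
      by (intro sum.cong refl Bochner_Integration.integral_sum ii)
    finally show ?thesis .
  qed
  also have "\<dots> = (\<Sum>x\<in>S. \<Sum>y\<in>S. c x * c y * (\<integral>\<omega>. X x \<omega> * X y \<omega> \<partial>P))"
    by simp
  finally show "(\<integral>\<omega>. iexp (\<Sum>x\<in>S. c x * X x \<omega>) \<partial>P)
     = of_real (exp (- (\<Sum>x\<in>S. \<Sum>y\<in>S. c x * c y * (\<integral>\<omega>. X x \<omega> * X y \<omega> \<partial>P)) / 2))" .
qed

lemma prod_inverse_sqrt_eq_exp:
  assumes "finite X" "\<And>x. x \<in> X \<Longrightarrow> 0 \<le> b x"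
  shows "(\<Prod>x\<in>X. 1 / sqrt (1 + b x)) = exp (- (\<Sum>x\<in>X. ln (1 + b x)) / 2)"
proof -
  have "1 / sqrt (1 + b x) = exp (- ln (1 + b x) / 2)" if "x \<in> X" for x
    using assms(2)[OF that] by (simp add: exp_minus powr_half_sqrt[symmetric] powr_def inverse_eq_divide)
  then have "(\<Prod>x\<in>X. 1 / sqrt (1 + b x)) = (\<Prod>x\<in>X. exp (- ln (1 + b x) / 2))"
    by (intro prod.cong) auto
  also have "\<dots> = exp (\<Sum>x\<in>X. - ln (1 + b x) / 2)"
    by (simp add: exp_sum[OF assms(1)])
  finally show ?thesis by (simp add: sum_negf sum_divide_distrib)
qed

section \<open>The Brownian sheet on a product of atomic measures\<close>

text \<open>The constants \<open>c1\<close>, \<open>c2\<close> and the kernels \<open>\<kappa>\<close>, \<open>e\<close> enclose the operators with kernel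
  \<open>sqrt (w u) * min (pos u) (pos v) * sqrt (w v)\<close> between geometric sequences of ratio \<open>r\<close>.\<close>

locale atomic_sheet =
  fixes d :: nat and J :: "nat set" and P :: "'w measure" and W :: "(nat \<Rightarrow> real) \<Rightarrow> 'w \<Rightarrow> real"
    and M :: "nat \<Rightarrow> nat" and \<mu> :: "nat \<Rightarrow> real measure"
    and pos w \<kappa> :: "nat \<Rightarrow> nat \<times> nat \<Rightarrow> real"
    and e :: "nat \<Rightarrow> nat \<Rightarrow> nat \<times> nat \<Rightarrow> nat \<times> nat \<Rightarrow> real"
    and c1 c2 r :: "nat \<Rightarrow> real"
  assumes J: "J = {1..d}"
    and sheet: "brownian_sheet d P W"
    and M: "j \<in> J \<Longrightarrow> 2 \<le> M j"
    and prob: "j \<in> J \<Longrightarrow> prob_space (\<mu> j)"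
    and sets_\<mu>: "j \<in> J \<Longrightarrow> sets (\<mu> j) = sets (restrict_space borel {0..1})"
    and inj: "j \<in> J \<Longrightarrow> inj_on (pos j) (UNIV \<times> {2..M j})"
    and pos: "j \<in> J \<Longrightarrow> snd u \<in> {2..M j} \<Longrightarrow> pos j u \<in> {0..1}"
    and atom: "j \<in> J \<Longrightarrow> snd u \<in> {2..M j} \<Longrightarrow> measure (\<mu> j) {pos j u} = w j u"
    and w: "j \<in> J \<Longrightarrow> snd u \<in> {2..M j} \<Longrightarrow> 0 < w j u"
    and \<kappa>: "j \<in> J \<Longrightarrow> 0 \<le> \<kappa> j u"
    and c1_le: "j \<in> J \<Longrightarrow> snd u \<in> {2..M j} \<Longrightarrow> c1 j * r j ^ fst u \<le> w j u * \<kappa> j u"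
    and atomic: "j \<in> J \<Longrightarrow> AE x in \<mu> j. \<exists>N. x \<in> pos j ` ({..<N} \<times> {2..M j})"
    and lower: "j \<in> J \<Longrightarrow> psd ({..<N} \<times> {2..M j})
        (\<lambda>u v. min (pos j u) (pos j v) - (if u = v then \<kappa> j u else 0))"
    and upper: "j \<in> J \<Longrightarrow> psd ({..<N} \<times> {2..M j})
        (\<lambda>u v. (\<Sum>k\<in>{..<N} \<times> {2..M j}. e j N k u * e j N k v) - min (pos j u) (pos j v))"
    and weighted: "j \<in> J \<Longrightarrow> psd ({..<N} \<times> {2..M j})
        (\<lambda>k l. (if k = l then c2 j * r j ^ fst k else 0) - (\<Sum>u\<in>{..<N} \<times> {2..M j}. w j u * (e j N k u * e j N l u)))"
    and c: "j \<in> J \<Longrightarrow> 0 < c1 j" "j \<in> J \<Longrightarrow> 0 < c2 j"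
    and r: "j \<in> J \<Longrightarrow> 0 < r j" "j \<in> J \<Longrightarrow> r j < 1"
begin

abbreviation "I N j \<equiv> {..<N} \<times> {2..M j}"

definition X :: "nat \<Rightarrow> (nat \<Rightarrow> nat \<times> nat) set" where "X N = (\<Pi>\<^sub>E j\<in>J. I N j)"

definition pt :: "(nat \<Rightarrow> nat \<times> nat) \<Rightarrow> nat \<Rightarrow> real" where "pt i = (\<lambda>j\<in>J. pos j (i j))"

definition wt :: "(nat \<Rightarrow> nat \<times> nat) \<Rightarrow> real" where "wt i = (\<Prod>j\<in>J. w j (i j))"

definition geo :: "(nat \<Rightarrow> nat \<times> nat) \<Rightarrow> real" where "geo i = (\<Prod>j\<in>J. r j ^ fst (i j))"

definition Q :: "(nat \<Rightarrow> real) measure" where "Q = Pi\<^sub>M J \<mu>"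

definition VN :: "nat \<Rightarrow> 'w \<Rightarrow> real" where "VN N \<omega> = (\<Sum>i\<in>X N. wt i * (W (pt i) \<omega>)\<^sup>2)"

definition V :: "'w \<Rightarrow> real" where "V \<omega> = (\<integral>x. (W x \<omega>)\<^sup>2 \<partial>Q)"

abbreviation "cov i i' \<equiv> (\<Prod>j\<in>J. min (pos j (i j)) (pos j (i' j)))"

section \<open>The values of the sheet at the lattice points\<close>

lemma finite_J [simp]: "finite J" and card_J [simp]: "card J = d"
  using J by auto

lemma unit_cube_J: "unit_cube d = (\<Pi>\<^sub>E j\<in>J. {0..1})"
  using J by (simp add: unit_cube_def)

lemma sheet_mean: "x \<in> unit_cube d \<Longrightarrow> (\<integral>\<omega>. W x \<omega> \<partial>P) = 0"
  and sheet_cov: "x \<in> unit_cube d \<Longrightarrow> y \<in> unit_cube d \<Longrightarrow>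
      (\<integral>\<omega>. W x \<omega> * W y \<omega> \<partial>P) = (\<Prod>j\<in>J. min (x j) (y j))"
  and sheet_gaussian: "gaussian_field P (unit_cube d) W"
  and prob_P: "prob_space P"
  and sheet_joint: "(\<lambda>(\<omega>, x). W x \<omega>) \<in> borel_measurable (P \<Otimes>\<^sub>M Pi\<^sub>M J (\<lambda>_. restrict_space borel {0..1}))"
  using sheet[unfolded brownian_sheet_def, folded J] by blast+

lemma finite_X [simp]: "finite (X N)"
  unfolding X_def by (intro finite_PiE) auto

lemma X_mem: "i \<in> X N \<Longrightarrow> j \<in> J \<Longrightarrow> i j \<in> I N j"
  unfolding X_def by (rule PiE_mem)

lemma X_image: "j \<in> J \<Longrightarrow> (\<lambda>i. i j) ` X N \<subseteq> I N j"
  using X_mem by blast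

lemma X_snd: "i \<in> X N \<Longrightarrow> j \<in> J \<Longrightarrow> snd (i j) \<in> {2..M j}"
  using X_mem[of i N j] by (auto simp: mem_Times_iff)

lemma X_eq_iff: "i \<in> X N \<Longrightarrow> i' \<in> X N \<Longrightarrow> i = i' \<longleftrightarrow> (\<forall>j\<in>J. i j = i' j)"
  unfolding X_def by (auto intro: PiE_ext)

lemma pt_cube: "i \<in> X N \<Longrightarrow> pt i \<in> unit_cube d"
  unfolding pt_def unit_cube_J by (intro restrict_PiE_iff[THEN iffD2] ballI pos X_snd)

lemma pt_inj: "inj_on pt (X N)"
proof (rule inj_onI)
  fix i i' assume i: "i \<in> X N" "i' \<in> X N" "pt i = pt i'"
  have "i j = i' j" if j: "j \<in> J" for j
  proof (rule inj_onD[OF inj[OF j]])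
    show "pos j (i j) = pos j (i' j)" using fun_cong[OF i(3), of j] j by (simp add: pt_def)
  qed (use X_snd[OF i(1) j] X_snd[OF i(2) j] in \<open>auto simp: mem_Times_iff\<close>)
  then show "i = i'" using X_eq_iff[OF i(1,2)] by blast
qed

lemma wt_pos: "i \<in> X N \<Longrightarrow> 0 < wt i"
  unfolding wt_def by (intro prod_pos ballI w X_snd)

lemma geo_pos: "0 < geo i"
  unfolding geo_def by (intro prod_pos ballI zero_less_power r)

lemma W_measurable: "x \<in> unit_cube d \<Longrightarrow> W x \<in> borel_measurable P"
  and W_square_integrable: "x \<in> unit_cube d \<Longrightarrow> integrable P (\<lambda>\<omega>. (W x \<omega>)\<^sup>2)"
  using gaussian_field_char(2,3)[OF prob_P sheet_gaussian, of "{}"] sheet_mean by auto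

text \<open>The Gaussian property is indexed by points of the cube, the sums by lattice indices.
  Injectivity of \<open>pt\<close> transports the coefficients.\<close>

lemma sheet_char:
  "(\<integral>\<omega>. iexp (\<Sum>i\<in>X N. c i * W (pt i) \<omega>) \<partial>P)
     = of_real (exp (- (\<Sum>i\<in>X N. \<Sum>i'\<in>X N. c i * c i' * cov i i') / 2))"
proof -
  define c' where "c' x = c (the_inv_into (X N) pt x)" for x
  have c': "c' (pt i) = c i" if "i \<in> X N" for i
    using that by (simp add: c'_def the_inv_into_f_f[OF pt_inj])
  have re: "(\<Sum>i\<in>X N. f (pt i)) = (\<Sum>x\<in>pt ` X N. f x)" for f :: "(nat \<Rightarrow> real) \<Rightarrow> real"
    using pt_inj by (simp add: sum.reindex)
  have cov: "(\<integral>\<omega>. W (pt i) \<omega> * W (pt i') \<omega> \<partial>P) = cov i i'" if "i \<in> X N" "i' \<in> X N" for i i'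
    using sheet_cov[OF pt_cube[OF that(1)] pt_cube[OF that(2)]] by (simp add: pt_def)
  have "(\<integral>\<omega>. iexp (\<Sum>i\<in>X N. c i * W (pt i) \<omega>) \<partial>P) = (\<integral>\<omega>. iexp (\<Sum>x\<in>pt ` X N. c' x * W x \<omega>) \<partial>P)"
    unfolding re[symmetric] by (simp add: c' cong: sum.cong)
  also have "\<dots> = of_real (exp (- (\<Sum>x\<in>pt ` X N. \<Sum>y\<in>pt ` X N. c' x * c' y * (\<integral>\<omega>. W x \<omega> * W y \<omega> \<partial>P)) / 2))"
    using pt_cube by (intro gaussian_field_char(1)[OF prob_P sheet_gaussian] sheet_mean) auto
  also have "(\<Sum>x\<in>pt ` X N. \<Sum>y\<in>pt ` X N. c' x * c' y * (\<integral>\<omega>. W x \<omega> * W y \<omega> \<partial>P))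
      = (\<Sum>i\<in>X N. \<Sum>i'\<in>X N. c i * c i' * cov i i')"
    unfolding re[symmetric] by (intro sum.cong refl) (simp add: c' cov)
  finally show ?thesis .
qed

lemma laplace_VN:
  assumes \<theta>: "0 \<le> \<theta>"
  shows "(\<integral>\<omega>. exp (- \<theta> * VN N \<omega>) \<partial>P)
     = (\<integral>g. exp (- (\<Sum>i\<in>X N. \<Sum>i'\<in>X N. (sqrt (2 * \<theta> * wt i) * g i) * (sqrt (2 * \<theta> * wt i') * g i') * cov i i') / 2) \<partial>gauss (X N))"
proof -
  \<comment> \<open>The factor 2 offsets the half in the exponent of
    \<open>laplace_eq_gauss\<close>.\<close>
  have "(\<Sum>i\<in>X N. (sqrt (2 * \<theta> * wt i) * W (pt i) \<omega>)\<^sup>2) = 2 * \<theta> * VN N \<omega>" for \<omega>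
    unfolding VN_def sum_distrib_left
  proof (intro sum.cong refl)
    fix i assume "i \<in> X N"
    then have "0 \<le> 2 * \<theta> * wt i" using \<theta> wt_pos by (simp add: less_imp_le)
    then show "(sqrt (2 * \<theta> * wt i) * W (pt i) \<omega>)\<^sup>2 = 2 * \<theta> * (wt i * (W (pt i) \<omega>)\<^sup>2)"
      by (simp add: power_mult_distrib)
  qed
  then have "(\<integral>\<omega>. exp (- \<theta> * VN N \<omega>) \<partial>P) = (\<integral>\<omega>. exp (- (\<Sum>i\<in>X N. (sqrt (2 * \<theta> * wt i) * W (pt i) \<omega>)\<^sup>2) / 2) \<partial>P)"
    by simp
  also have "\<dots> = (\<integral>g. exp (- (\<Sum>i\<in>X N. \<Sum>i'\<in>X N. (sqrt (2 * \<theta> * wt i) * g i) * (sqrt (2 * \<theta> * wt i') * g i') * cov i i') / 2) \<partial>gauss (X N))"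
    by (rule laplace_eq_gauss[OF prob_P finite_X W_measurable[OF pt_cube] sheet_char])
  finally show ?thesis .
qed

section \<open>Comparison of kernels on the product lattice\<close>

lemma prod_diag:
  assumes "i \<in> X N" "i' \<in> X N"
  shows "(\<Prod>j\<in>J. if i j = i' j then f j (i j) else 0) = (if i = i' then (\<Prod>j\<in>J. f j (i j)) else (0::real))"
proof (cases "i = i'")
  case False
  then obtain j where "j \<in> J" "i j \<noteq> i' j" using X_eq_iff[OF assms] by blast
  then have "(\<Prod>j\<in>J. if i j = i' j then f j (i j) else 0) = 0"
    by (intro prod_zero) auto
  then show ?thesis using False by simp
qed simp

lemma mult_min: "j \<in> J \<Longrightarrow> psd_mult (X N) (\<lambda>i i'. min (pos j (i j)) (pos j (i' j)))"
  by (rule psd_mult_min) (use pos X_snd in auto)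

text \<open>A kernel that is diagonal in a single coordinate is only block diagonal on the lattice;
  the product over all coordinates is diagonal.\<close>

lemma psd_cov_diag: "psd (X N) (\<lambda>i i'. cov i i' - (if i = i' then (\<Prod>j\<in>J. \<kappa> j (i j)) else 0))"
proof -
  have "psd (X N) (\<lambda>i i'. cov i i' - (\<Prod>j\<in>J. if i j = i' j then \<kappa> j (i j) else 0))"
  proof (rule psd_diff_prod)
    fix j assume j: "j \<in> J"
    show "psd (X N) (\<lambda>i i'. min (pos j (i j)) (pos j (i' j)) - (if i j = i' j then \<kappa> j (i j) else 0))"
      by (rule psd_comap[OF finite_X _ X_image[OF j] lower[OF j]]) simp
    show "psd_mult (X N) (\<lambda>i i'. if i j = i' j then \<kappa> j (i j) else 0)"
      by (rule psd_mult_comap_diag[of "I N j", OF _ X_mem[OF _ j] \<kappa>[OF j]]) simp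
  qed (auto intro: mult_min)
  then show ?thesis
    by (rule psd_cong[THEN iffD1, rotated]) (simp add: prod_diag)
qed

definition E :: "nat \<Rightarrow> (nat \<Rightarrow> nat \<times> nat) \<Rightarrow> (nat \<Rightarrow> nat \<times> nat) \<Rightarrow> real" where
  "E N k i = (\<Prod>j\<in>J. e j N (k j) (i j))"

lemma psd_majorant: "psd (X N) (\<lambda>i i'. (\<Sum>k\<in>X N. E N k i * E N k i') - cov i i')"
proof -
  have "psd (X N) (\<lambda>i i'. (\<Prod>j\<in>J. \<Sum>k\<in>I N j. e j N k (i j) * e j N k (i' j)) - cov i i')"
  proof (rule psd_diff_prod)
    fix j assume j: "j \<in> J"
    show "psd (X N) (\<lambda>i i'. (\<Sum>k\<in>I N j. e j N k (i j) * e j N k (i' j)) - min (pos j (i j)) (pos j (i' j)))"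
      by (rule psd_comap[OF finite_X _ X_image[OF j] upper[OF j]]) simp
    show "psd_mult (X N) (\<lambda>i i'. \<Sum>k\<in>I N j. e j N k (i j) * e j N k (i' j))"
      by (rule psd_mult_gram) simp
  qed (auto intro: mult_min)
  \<comment> \<open>Expanding the product of sums identifies the tensor product of the Gram kernels
    with the Gram kernel of \<open>E N\<close>.\<close>
  moreover have "(\<Prod>j\<in>J. \<Sum>k\<in>I N j. e j N k (i j) * e j N k (i' j)) = (\<Sum>k\<in>X N. E N k i * E N k i')" for i i'
    by (subst prod_sum_PiE) (auto simp: X_def E_def prod.distrib)
  ultimately show ?thesis by simp
qed

text \<open>The left side is the form of the tensor product of the kernels in
  \<open>weighted\<close>, so it is again a comparison of products; its diagonal bound is
  \<open>geo\<close> up to the constants \<open>c2\<close>.\<close>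

lemma weighted_majorant_le:
  "(\<Sum>i\<in>X N. wt i * (\<Sum>k\<in>X N. E N k i * \<xi> k)\<^sup>2) \<le> (\<Sum>k\<in>X N. ((\<Prod>j\<in>J. c2 j) * geo k) * (\<xi> k)\<^sup>2)"
proof -
  let ?H = "\<lambda>j k l. \<Sum>u\<in>I N j. w j u * (e j N k u * e j N l u)"
  have "psd (X N) (\<lambda>k l. (\<Prod>j\<in>J. if k j = l j then c2 j * r j ^ fst (k j) else 0) - (\<Prod>j\<in>J. ?H j (k j) (l j)))"
  proof (rule psd_diff_prod)
    fix j assume j: "j \<in> J"
    show "psd (X N) (\<lambda>k l. (if k j = l j then c2 j * r j ^ fst (k j) else 0) - ?H j (k j) (l j))"
      by (rule psd_comap[OF finite_X _ X_image[OF j] weighted[OF j]]) simp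
    show "psd_mult (X N) (\<lambda>k l. if k j = l j then c2 j * r j ^ fst (k j) else 0)"
      using psd_mult_comap_diag[where Y="I N j" and X="X N" and g="\<lambda>k. k j" and b="\<lambda>u. c2 j * r j ^ fst u"]
        X_mem[OF _ j] c(2)[OF j] r(1)[OF j] by (auto simp: less_imp_le)
    show "psd_mult (X N) (\<lambda>k l. ?H j (k j) (l j))"
    proof (rule psd_mult_gram)
      fix k l
      show "?H j (k j) (l j) = (\<Sum>u\<in>I N j. (sqrt (w j u) * e j N (k j) u) * (sqrt (w j u) * e j N (l j) u))"
      proof (intro sum.cong refl)
        fix u assume "u \<in> I N j"
        then have "sqrt (w j u) * sqrt (w j u) = w j u" using w[OF j, of u] by (auto simp: mem_Times_iff)
        then show "w j u * (e j N (k j) u * e j N (l j) u) = sqrt (w j u) * e j N (k j) u * (sqrt (w j u) * e j N (l j) u)"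
          by (metis mult.assoc mult.left_commute)
      qed
    qed
  qed simp
  from this[unfolded psd_def, rule_format, of \<xi>]
  have "(\<Sum>k\<in>X N. \<Sum>l\<in>X N. \<xi> k * \<xi> l * (\<Prod>j\<in>J. ?H j (k j) (l j)))
     \<le> (\<Sum>k\<in>X N. \<Sum>l\<in>X N. \<xi> k * \<xi> l * (\<Prod>j\<in>J. if k j = l j then c2 j * r j ^ fst (k j) else 0))"
    by (simp add: right_diff_distrib sum_subtractf)
  also have "\<dots> = (\<Sum>k\<in>X N. \<Sum>l\<in>X N. \<xi> k * \<xi> l * (if k = l then (\<Prod>j\<in>J. c2 j) * geo k else 0))"
    by (intro sum.cong refl) (simp add: prod_diag[of _ N _ "\<lambda>j u. c2 j * r j ^ fst u"] prod.distrib geo_def)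
  also have "\<dots> = (\<Sum>k\<in>X N. ((\<Prod>j\<in>J. c2 j) * geo k) * (\<xi> k)\<^sup>2)"
    by (simp add: if_distrib[of "\<lambda>t. _ * t"] power2_eq_square ac_simps cong: if_cong)
  also have "(\<Sum>k\<in>X N. \<Sum>l\<in>X N. \<xi> k * \<xi> l * (\<Prod>j\<in>J. ?H j (k j) (l j)))
     = (\<Sum>k\<in>X N. \<Sum>l\<in>X N. \<xi> k * \<xi> l * (\<Sum>i\<in>X N. (sqrt (wt i) * E N k i) * (sqrt (wt i) * E N l i)))"
  proof (intro sum.cong refl arg_cong2[where f="(*)"])
    fix k l
    have "(\<Prod>j\<in>J. ?H j (k j) (l j)) = (\<Sum>i\<in>X N. wt i * (E N k i * E N l i))"
      by (subst prod_sum_PiE) (auto simp: X_def E_def wt_def prod.distrib)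
    also have "\<dots> = (\<Sum>i\<in>X N. (sqrt (wt i) * E N k i) * (sqrt (wt i) * E N l i))"
    proof (intro sum.cong refl)
      fix i assume "i \<in> X N"
      then have "sqrt (wt i) * sqrt (wt i) = wt i" using wt_pos by (simp add: less_imp_le)
      then show "wt i * (E N k i * E N l i) = (sqrt (wt i) * E N k i) * (sqrt (wt i) * E N l i)"
        by (metis mult.assoc mult.left_commute)
    qed
    finally show "(\<Prod>j\<in>J. ?H j (k j) (l j)) = \<dots>" .
  qed
  also have "\<dots> = (\<Sum>i\<in>X N. (\<Sum>k\<in>X N. \<xi> k * (sqrt (wt i) * E N k i))\<^sup>2)"
    by (rule sum_quadratic_eq_gram)
  also have "\<dots> = (\<Sum>i\<in>X N. wt i * (\<Sum>k\<in>X N. E N k i * \<xi> k)\<^sup>2)"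
  proof (intro sum.cong refl)
    fix i assume "i \<in> X N"
    have "(\<Sum>k\<in>X N. \<xi> k * (sqrt (wt i) * E N k i)) = sqrt (wt i) * (\<Sum>k\<in>X N. E N k i * \<xi> k)"
      by (simp add: sum_distrib_left ac_simps)
    then show "(\<Sum>k\<in>X N. \<xi> k * (sqrt (wt i) * E N k i))\<^sup>2 = wt i * (\<Sum>k\<in>X N. E N k i * \<xi> k)\<^sup>2"
      using wt_pos[OF \<open>i \<in> X N\<close>] by (simp add: power_mult_distrib)
  qed
  finally show ?thesis .
qed

text \<open>A volume constant: asymptotically \<open>D * y ^ d / fact d\<close> counts the lattice
  indices \<open>i\<close> with \<open>geo i \<ge> exp (- y)\<close>.\<close>

definition D :: real where "D = (\<Prod>j\<in>J. real (card {2..M j}) / (- ln (r j)))"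

lemma sum_ln_geo:
  assumes "0 < \<theta>"
  shows "ln (1 + \<theta> * geo i) = ln (1 + exp (ln \<theta> - (\<Sum>j\<in>J. real (fst (i j)) * (- ln (r j)))))"
proof -
  have "geo i = exp (\<Sum>j\<in>J. real (fst (i j)) * ln (r j))"
    unfolding geo_def exp_sum[OF finite_J]
    by (intro prod.cong refl) (simp add: exp_of_nat_mult r)
  then have "\<theta> * geo i = exp (ln \<theta> + (\<Sum>j\<in>J. real (fst (i j)) * ln (r j)))"
    using assms by (simp add: exp_add)
  then show ?thesis by (simp add: sum_negf)
qed

lemma neg_ln_r: "j \<in> J \<Longrightarrow> 0 < - ln (r j)"
  using r[of j] by simp

text \<open>The bound does not involve \<open>N\<close>, which permits the passage to the full sum.
  The shift collects the comparison constants and the shifts of the lattice sum.\<close>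

lemma laplace_VN_ge:
  assumes \<theta>: "0 < \<theta>"
  shows "exp (- D * exp_poly (Suc d) (ln \<theta> + (ln (2 * (\<Prod>j\<in>J. c2 j)) + (\<Sum>j\<in>J. - ln (r j)))) / 2)
    \<le> (\<integral>\<omega>. exp (- \<theta> * VN N \<omega>) \<partial>P)"
proof -
  define C where "C = 2 * (\<Prod>j\<in>J. c2 j)"
  have C: "0 < C" unfolding C_def using c by (intro mult_pos_pos prod_pos) auto
  have "(\<Sum>i\<in>X N. ln (1 + \<theta> * C * geo i)) \<le> (\<Sum>i\<in>X N. exp_poly 1 (ln (\<theta> * C) - (\<Sum>j\<in>J. real (fst (i j)) * (- ln (r j)))))"
    using \<theta> C by (intro sum_mono) (simp only: sum_ln_geo mult_pos_pos ln_one_plus_exp_bounds)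
  also have "\<dots> \<le> D * exp_poly (Suc (card J)) (ln (\<theta> * C) + (\<Sum>j\<in>J. - ln (r j)))"
    unfolding X_def D_def by (rule lattice_sum_exp_poly_le[OF finite_J neg_ln_r])
  also have "ln (\<theta> * C) = ln \<theta> + ln C" using \<theta> C by (simp add: ln_mult_pos)
  finally have "exp (- D * exp_poly (Suc d) (ln \<theta> + (ln C + (\<Sum>j\<in>J. - ln (r j)))) / 2)
      \<le> exp (- (\<Sum>i\<in>X N. ln (1 + \<theta> * C * geo i)) / 2)"
    by (simp add: add_ac)
  also have "\<dots> = (\<Prod>i\<in>X N. 1 / sqrt (1 + \<theta> * C * geo i))"
    using \<theta> C geo_pos by (intro prod_inverse_sqrt_eq_exp[symmetric]) (auto simp: less_imp_le)
  also have "\<dots> \<le> (\<integral>\<omega>. exp (- \<theta> * VN N \<omega>) \<partial>P)"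
    unfolding laplace_VN[OF less_imp_le[OF \<theta>]]
  proof (rule laplace_ge_diag[where e="E N"])
    \<comment> \<open>As a multiplier, \<open>cov\<close> is applied to the constant kernel
      1.\<close>
    show "psd (X N) (\<lambda>i i'. cov i i')"
    proof -
      have "psd (X N) (\<lambda>_ _. 1)"
        unfolding psd_def by (auto simp: sum_product[symmetric])
      moreover have "psd_mult (X N) (\<lambda>i i'. cov i i')"
        by (intro psd_mult_prod mult_min) auto
      ultimately show ?thesis unfolding psd_mult_def by force
    qed
    show "psd (X N) (\<lambda>i i'. (\<Sum>k\<in>X N. E N k i * E N k i') - cov i i')" by (rule psd_majorant)
    fix \<xi> :: "(nat \<Rightarrow> nat \<times> nat) \<Rightarrow> real"
    have "(\<Sum>i\<in>X N. (sqrt (2 * \<theta> * wt i))\<^sup>2 * (\<Sum>k\<in>X N. E N k i * \<xi> k)\<^sup>2)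
        = 2 * \<theta> * (\<Sum>i\<in>X N. wt i * (\<Sum>k\<in>X N. E N k i * \<xi> k)\<^sup>2)"
      unfolding sum_distrib_left using \<theta> wt_pos by (intro sum.cong refl) (simp add: less_imp_le)
    also have "\<dots> \<le> 2 * \<theta> * (\<Sum>k\<in>X N. ((\<Prod>j\<in>J. c2 j) * geo k) * (\<xi> k)\<^sup>2)"
      using \<theta> by (intro mult_left_mono weighted_majorant_le) auto
    also have "\<dots> = (\<Sum>k\<in>X N. \<theta> * C * geo k * (\<xi> k)\<^sup>2)"
      by (simp add: sum_distrib_left C_def ac_simps)
    finally show "(\<Sum>i\<in>X N. (sqrt (2 * \<theta> * wt i))\<^sup>2 * (\<Sum>k\<in>X N. E N k i * \<xi> k)\<^sup>2)
        \<le> (\<Sum>k\<in>X N. \<theta> * C * geo k * (\<xi> k)\<^sup>2)" .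
  qed (use \<theta> C geo_pos in \<open>auto simp: less_imp_le\<close>)
  finally show ?thesis by (simp add: C_def)
qed

text \<open>Here \<open>N\<close> depends on \<open>\<theta>\<close>: it must reach the depth beyond
  which \<open>pos_pow\<close> vanishes. One such \<open>N\<close> is enough, because
  \<open>VN N\<close> stays below \<open>V\<close> almost surely.\<close>

lemma laplace_VN_le:
  assumes \<theta>: "0 < \<theta>"
  shows "\<exists>N. (\<integral>\<omega>. exp (- \<theta> * VN N \<omega>) \<partial>P) \<le> exp (- D * pos_pow (Suc d) (ln \<theta> + ln (\<Prod>j\<in>J. c1 j)) / 2)"
proof -
  define C where "C = (\<Prod>j\<in>J. c1 j)"
  have C: "0 < C" unfolding C_def using c by (intro prod_pos) auto
  have "\<exists>N. \<forall>j\<in>J. ln \<theta> + ln C \<le> real N * (- ln (r j))"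
  proof -
    have "\<exists>n. ln \<theta> + ln C \<le> real n * (- ln (r j))" if "j \<in> J" for j
      using reals_Archimedean3[OF neg_ln_r[OF that]] less_imp_le by blast
    then obtain n where n: "\<And>j. j \<in> J \<Longrightarrow> ln \<theta> + ln C \<le> real (n j) * (- ln (r j))" by metis
    have "ln \<theta> + ln C \<le> real (\<Sum>j\<in>J. n j) * (- ln (r j))" if j: "j \<in> J" for j
    proof -
      have "n j \<le> (\<Sum>j\<in>J. n j)" using j by (intro member_le_sum) auto
      then have "real (n j) * (- ln (r j)) \<le> real (\<Sum>j\<in>J. n j) * (- ln (r j))"
        using neg_ln_r[OF j] by (intro mult_right_mono) (auto simp del: of_nat_sum)
      then show ?thesis using n[OF j] by linarith
    qed
    then show ?thesis by blast
  qed
  then obtain N where N: "\<And>j. j \<in> J \<Longrightarrow> ln \<theta> + ln C \<le> real N * (- ln (r j))" by blast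
  have "(\<integral>\<omega>. exp (- \<theta> * VN N \<omega>) \<partial>P) \<le> (\<Prod>i\<in>X N. 1 / sqrt (1 + (sqrt (2 * \<theta> * wt i))\<^sup>2 * (\<Prod>j\<in>J. \<kappa> j (i j))))"
    unfolding laplace_VN[OF less_imp_le[OF \<theta>]]
    by (rule laplace_le_diag[OF finite_X _ psd_cov_diag]) (auto intro!: prod_nonneg \<kappa>)
  also have "\<dots> \<le> (\<Prod>i\<in>X N. 1 / sqrt (1 + \<theta> * C * geo i))"
  proof (intro prod_mono conjI)
    fix i assume i: "i \<in> X N"
    have k: "0 \<le> (\<Prod>j\<in>J. \<kappa> j (i j))" by (intro prod_nonneg) (auto intro: \<kappa>)
    have "C * geo i = (\<Prod>j\<in>J. c1 j * r j ^ fst (i j))" by (simp add: C_def geo_def prod.distrib)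
    also have "\<dots> \<le> (\<Prod>j\<in>J. w j (i j) * \<kappa> j (i j))"
      using X_snd[OF i] c r by (intro prod_mono conjI c1_le) (auto simp: less_imp_le)
    also have "\<dots> = wt i * (\<Prod>j\<in>J. \<kappa> j (i j))" by (simp add: wt_def prod.distrib)
    \<comment> \<open>The factor 2 from \<open>2 * \<theta>\<close> is given away here.\<close>
    also have "\<dots> \<le> 2 * (wt i * (\<Prod>j\<in>J. \<kappa> j (i j)))"
      using wt_pos[OF i] k by simp
    finally have "\<theta> * (C * geo i) \<le> \<theta> * (2 * (wt i * (\<Prod>j\<in>J. \<kappa> j (i j))))"
      using \<theta> by (intro mult_left_mono) auto
    also have "\<dots> = (sqrt (2 * \<theta> * wt i))\<^sup>2 * (\<Prod>j\<in>J. \<kappa> j (i j))"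
      using \<theta> wt_pos[OF i] by simp
    finally have le: "\<theta> * C * geo i \<le> \<dots>" by (simp add: mult.assoc)
    have g: "0 < \<theta> * C * geo i" using \<theta> C geo_pos by simp
    show "1 / sqrt (1 + (sqrt (2 * \<theta> * wt i))\<^sup>2 * (\<Prod>j\<in>J. \<kappa> j (i j))) \<le> 1 / sqrt (1 + \<theta> * C * geo i)"
      using le g by (intro divide_left_mono mult_pos_pos) auto
    show "0 \<le> 1 / sqrt (1 + (sqrt (2 * \<theta> * wt i))\<^sup>2 * (\<Prod>j\<in>J. \<kappa> j (i j)))"
      using le g by simp
  qed
  also have "\<dots> = exp (- (\<Sum>i\<in>X N. ln (1 + \<theta> * C * geo i)) / 2)"
    using \<theta> C geo_pos by (intro prod_inverse_sqrt_eq_exp) (auto simp: less_imp_le)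
  also have "\<dots> \<le> exp (- D * pos_pow (Suc d) (ln \<theta> + ln C) / 2)"
  proof -
    have "D * pos_pow (Suc (card J)) (ln \<theta> + ln C)
      \<le> (\<Sum>i\<in>X N. pos_pow 1 (ln \<theta> + ln C - (\<Sum>j\<in>J. real (fst (i j)) * (- ln (r j)))))"
      unfolding X_def D_def by (rule lattice_sum_pos_pow_ge[OF finite_J neg_ln_r N])
    also have "ln \<theta> + ln C = ln (\<theta> * C)" using \<theta> C by (simp add: ln_mult_pos)
    also have "(\<Sum>i\<in>X N. pos_pow 1 (ln (\<theta> * C) - (\<Sum>j\<in>J. real (fst (i j)) * (- ln (r j)))))
      \<le> (\<Sum>i\<in>X N. ln (1 + \<theta> * C * geo i))"
      using \<theta> C by (intro sum_mono) (simp only: sum_ln_geo mult_pos_pos ln_one_plus_exp_bounds)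
    finally show ?thesis using \<theta> C by (simp add: ln_mult_pos)
  qed
  finally show ?thesis by (auto simp: C_def)
qed

section \<open>From finitely many atoms to the full product measure\<close>

lemma prob_Q: "prob_space Q"
  unfolding Q_def by (intro prob_space_PiM prob)

lemma sets_Q: "sets Q = sets (Pi\<^sub>M J (\<lambda>_. restrict_space borel {0..1::real}))"
  unfolding Q_def by (intro sets_PiM_cong refl sets_\<mu>)

lemma space_Q: "space Q = unit_cube d"
  using sets_eq_imp_space_eq[OF sets_Q]
  by (simp add: space_PiM unit_cube_J space_restrict_space)

lemma measure_atom_Q:
  assumes i: "i \<in> X N"
  shows "{pt i} \<in> sets Q" "measure Q {pt i} = wt i"
proof -
  \<comment> \<open>\<open>product_prob_space\<close> asks for a probability measure at every index.
    Point masses outside \<open>J\<close> do not affect the product over \<open>J\<close>.\<close>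
  define \<nu> where "\<nu> j = (if j \<in> J then \<mu> j else return borel 0)" for j
  have \<nu>: "prob_space (\<nu> j)" for j
    using prob by (auto simp: \<nu>_def intro: prob_space_return)
  interpret product_prob_space \<nu> J by (intro product_prob_spaceI \<nu>)
  have Q: "Q = Pi\<^sub>M J \<nu>" unfolding Q_def by (intro PiM_cong) (auto simp: \<nu>_def)
  have eq: "{pt i} = (\<Pi>\<^sub>E j\<in>J. {pos j (i j)})"
    unfolding pt_def by (auto simp: PiE_iff extensional_def fun_eq_iff)
  have sing: "{pos j (i j)} \<in> sets (\<nu> j)" if "j \<in> J" for j
    using pos[OF that X_snd[OF i that]] that by (auto simp: \<nu>_def sets_\<mu> sets_restrict_space_iff)
  show "{pt i} \<in> sets Q" unfolding eq Q using sing by (intro sets_PiM_I_finite) auto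
  have "emeasure Q {pt i} = (\<Prod>j\<in>J. emeasure (\<nu> j) {pos j (i j)})"
    unfolding eq Q using sing by (intro emeasure_PiM) auto
  also have "\<dots> = (\<Prod>j\<in>J. ennreal (w j (i j)))"
  proof (intro prod.cong refl)
    fix j assume j: "j \<in> J"
    show "emeasure (\<nu> j) {pos j (i j)} = ennreal (w j (i j))"
      using atom[OF j X_snd[OF i j]] j finite_measure.emeasure_eq_measure[OF prob_space.finite_measure[OF \<nu>], of j]
      by (simp add: \<nu>_def)
  qed
  also have "\<dots> = ennreal (wt i)"
    unfolding wt_def using w X_snd[OF i] by (intro prod_ennreal) (auto simp: less_imp_le)
  finally show "measure Q {pt i} = wt i"
    using wt_pos[OF i] by (simp add: measure_def)
qed

lemma AE_Q_atoms: "AE x in Q. \<exists>N. x \<in> pt ` X N"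
proof -
  have "AE x in Q. \<forall>j\<in>J. \<exists>N. x j \<in> pos j ` I N j"
    unfolding Q_def by (intro AE_finite_allI AE_PiM_component prob atomic) auto
  moreover have "AE x in Q. x \<in> unit_cube d" using space_Q by (auto intro!: AE_I2)
  ultimately show ?thesis
  proof eventually_elim
    case (elim x)
    then obtain N where N: "\<And>j. j \<in> J \<Longrightarrow> x j \<in> pos j ` I (N j) j" by metis
    then have "\<forall>j\<in>J. \<exists>u. u \<in> I (N j) j \<and> x j = pos j u" by blast
    from bchoice[OF this] obtain u where u: "\<And>j. j \<in> J \<Longrightarrow> u j \<in> I (N j) j \<and> x j = pos j (u j)"
      by blast
    define i where "i = (\<lambda>j\<in>J. u j)"
    \<comment> \<open>The coordinates have their own depths; their sum is a common bound.\<close>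
    have "i \<in> X (\<Sum>j\<in>J. N j)"
    proof -
      have "N j \<le> (\<Sum>j\<in>J. N j)" if "j \<in> J" for j using that by (intro member_le_sum) auto
      then show ?thesis
        unfolding X_def i_def using u by (force simp: PiE_iff mem_Times_iff intro: less_le_trans)
    qed
    moreover have "x = pt i"
      using elim(2) u by (auto simp: pt_def i_def unit_cube_J PiE_iff extensional_def fun_eq_iff)
    ultimately show ?case by blast
  qed
qed

lemma X_mono: "N \<le> N' \<Longrightarrow> X N \<subseteq> X N'"
  unfolding X_def by (intro PiE_mono) auto

text \<open>The sums are integrals of \<open>h\<close> cut off to the first levels. Almost every
  point is eventually included, and \<open>h\<close> dominates.\<close>

lemma integral_atoms:
  assumes h: "integrable Q h" and nn: "\<And>x. 0 \<le> h x"
  shows "(\<lambda>N. \<Sum>i\<in>X N. wt i * h (pt i)) \<longlonglongrightarrow> (\<integral>x. h x \<partial>Q)"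
    and "(\<Sum>i\<in>X N. wt i * h (pt i)) \<le> (\<integral>x. h x \<partial>Q)"
proof -
  interpret Q: prob_space Q by (rule prob_Q)
  have ind: "(\<Sum>i\<in>X N. indicator {pt i} x * h (pt i)) = indicator (pt ` X N) x * h x" for N x
  proof (cases "x \<in> pt ` X N")
    case True
    then obtain i where i: "i \<in> X N" "x = pt i" by auto
    have "(\<Sum>k\<in>X N. indicator {pt k} x * h (pt k)) = (\<Sum>k\<in>X N. if k = i then h x else 0)"
    proof (intro sum.cong refl)
      fix k assume "k \<in> X N"
      then have "pt k = x \<longleftrightarrow> k = i" using inj_on_eq_iff[OF pt_inj _ i(1)] i(2) by simp
      then show "indicator {pt k} x * h (pt k) = (if k = i then h x else 0)"
        by (auto simp: indicator_def)
    qed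
    then show ?thesis using i True by simp
  qed (auto intro: sum.neutral)
  have fin: "(\<integral>x. indicator (pt ` X N) x * h x \<partial>Q) = (\<Sum>i\<in>X N. wt i * h (pt i))"
    and intN: "integrable Q (\<lambda>x. indicator (pt ` X N) x * h x)" for N
  proof -
    have int: "integrable Q (\<lambda>x. indicator {pt i} x * h (pt i))" if "i \<in> X N" for i
      using measure_atom_Q(1)[OF that] by (intro integrable_mult_left integrable_real_indicator) (auto simp: Q.emeasure_eq_measure)
    show "integrable Q (\<lambda>x. indicator (pt ` X N) x * h x)"
      unfolding ind[symmetric] by (intro Bochner_Integration.integrable_sum int)
    show "(\<integral>x. indicator (pt ` X N) x * h x \<partial>Q) = (\<Sum>i\<in>X N. wt i * h (pt i))"
      unfolding ind[symmetric] using int measure_atom_Q by (subst Bochner_Integration.integral_sum) (auto intro!: sum.cong)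
  qed
  show "(\<Sum>i\<in>X N. wt i * h (pt i)) \<le> (\<integral>x. h x \<partial>Q)"
    unfolding fin[symmetric] using nn by (intro integral_mono intN h) (auto simp: indicator_def)
  show "(\<lambda>N. \<Sum>i\<in>X N. wt i * h (pt i)) \<longlonglongrightarrow> (\<integral>x. h x \<partial>Q)"
    unfolding fin[symmetric]
  proof (rule integral_dominated_convergence[OF _ _ h])
    show "h \<in> borel_measurable Q" using h by auto
    show "(\<lambda>x. indicator (pt ` X N) x * h x) \<in> borel_measurable Q" for N using intN by auto
    show "AE x in Q. norm (indicator (pt ` X N) x * h x) \<le> h x" for N
      using nn by (auto simp: indicator_def)
    show "AE x in Q. (\<lambda>N. indicator (pt ` X N) x * h x) \<longlonglongrightarrow> h x"
      using AE_Q_atoms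
    proof eventually_elim
      case (elim x)
      then obtain N where "x \<in> pt ` X N" by auto
      then have "\<forall>N'\<ge>N. indicator (pt ` X N') x * h x = h x"
        using X_mono by (fastforce simp: indicator_def)
      then show ?case
        by (intro tendsto_eventually) (auto simp: eventually_sequentially)
    qed
  qed
qed

lemma sheet_measurable: "(\<lambda>(\<omega>, x). (W x \<omega>)\<^sup>2) \<in> borel_measurable (P \<Otimes>\<^sub>M Q)"
proof -
  have "(\<lambda>(\<omega>, x). W x \<omega>) \<in> borel_measurable (P \<Otimes>\<^sub>M Q)"
    using sheet_joint measurable_cong_sets[OF sets_pair_measure_cong[OF refl sets_Q] refl] by blast
  then have "(\<lambda>z. (case z of (\<omega>, x) \<Rightarrow> W x \<omega>)\<^sup>2) \<in> borel_measurable (P \<Otimes>\<^sub>M Q)" by measurable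
  then show ?thesis by (simp add: case_prod_unfold)
qed

text \<open>By Tonelli, since the second moment of \<open>W x\<close> is at most 1 on the cube.
  Without this, \<open>V\<close> could be the default value 0 of the integral on a set of positive
  probability.\<close>

lemma AE_integrable: "AE \<omega> in P. integrable Q (\<lambda>x. (W x \<omega>)\<^sup>2)"
proof -
  interpret P: prob_space P by (rule prob_P)
  interpret Q: prob_space Q by (rule prob_Q)
  interpret PQ: pair_prob_space P Q ..
  have m: "(\<lambda>z. ennreal ((W (snd z) (fst z))\<^sup>2)) \<in> borel_measurable (P \<Otimes>\<^sub>M Q)"
    using sheet_measurable by (simp add: case_prod_unfold)
  have "integrable (P \<Otimes>\<^sub>M Q) (\<lambda>(\<omega>, x). (W x \<omega>)\<^sup>2)"
  proof (rule integrableI_nonneg)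
    have "(\<integral>\<^sup>+z. ennreal (case z of (\<omega>, x) \<Rightarrow> (W x \<omega>)\<^sup>2) \<partial>(P \<Otimes>\<^sub>M Q))
        = (\<integral>\<^sup>+x. \<integral>\<^sup>+\<omega>. ennreal ((W x \<omega>)\<^sup>2) \<partial>P \<partial>Q)"
      using PQ.nn_integral_snd[OF m, symmetric] by (simp add: case_prod_unfold)
    also have "\<dots> \<le> (\<integral>\<^sup>+x. 1 \<partial>Q)"
    proof (rule nn_integral_mono)
      fix x assume "x \<in> space Q"
      then have x: "x \<in> unit_cube d" by (simp add: space_Q)
      have "(\<integral>\<omega>. (W x \<omega>)\<^sup>2 \<partial>P) = (\<Prod>j\<in>J. min (x j) (x j))"
        using sheet_cov[OF x x] by (simp add: power2_eq_square)
      also have "\<dots> \<le> 1"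
        using x by (intro prod_le_1) (auto simp: unit_cube_J PiE_iff)
      finally have "ennreal (\<integral>\<omega>. (W x \<omega>)\<^sup>2 \<partial>P) \<le> 1" by simp
      also have "ennreal (\<integral>\<omega>. (W x \<omega>)\<^sup>2 \<partial>P) = (\<integral>\<^sup>+\<omega>. ennreal ((W x \<omega>)\<^sup>2) \<partial>P)"
        by (intro nn_integral_eq_integral[symmetric] W_square_integrable x) auto
      finally show "(\<integral>\<^sup>+\<omega>. ennreal ((W x \<omega>)\<^sup>2) \<partial>P) \<le> 1" .
    qed
    also have "\<dots> < \<infinity>" by (simp add: Q.emeasure_space_1)
    finally show "(\<integral>\<^sup>+z. ennreal (case z of (\<omega>, x) \<Rightarrow> (W x \<omega>)\<^sup>2) \<partial>(P \<Otimes>\<^sub>M Q)) < \<infinity>" .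
  qed (use sheet_measurable in auto)
  from PQ.AE_integrable_fst'[OF this] show ?thesis by simp
qed

lemma V_measurable: "V \<in> borel_measurable P"
proof -
  interpret Q: prob_space Q by (rule prob_Q)
  show ?thesis
    using Q.borel_measurable_lebesgue_integral[OF sheet_measurable] by (simp add: V_def[abs_def])
qed

lemma VN_measurable: "VN N \<in> borel_measurable P"
proof -
  have "(\<lambda>\<omega>. \<Sum>i\<in>X N. wt i * (W (pt i) \<omega>)\<^sup>2) \<in> borel_measurable P"
    by (intro borel_measurable_sum borel_measurable_times borel_measurable_power W_measurable pt_cube) auto
  then show ?thesis by (simp add: VN_def[abs_def])
qed

lemma V_nonneg: "0 \<le> V \<omega>"
  unfolding V_def by (intro Bochner_Integration.integral_nonneg) auto

lemma VN_nonneg: "0 \<le> VN N \<omega>"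
  unfolding VN_def using wt_pos by (intro sum_nonneg mult_nonneg_nonneg) (auto simp: less_imp_le)

lemma VN_le_V: "AE \<omega> in P. VN N \<omega> \<le> V \<omega>"
  using AE_integrable by eventually_elim (auto simp: VN_def V_def intro: integral_atoms)

lemma VN_tendsto_V: "AE \<omega> in P. (\<lambda>N. VN N \<omega>) \<longlonglongrightarrow> V \<omega>"
  using AE_integrable by eventually_elim (auto simp: VN_def V_def intro: integral_atoms)

lemma integrable_exp_neg:
  assumes "f \<in> borel_measurable P" "\<And>\<omega>. 0 \<le> f \<omega>" "0 \<le> (\<theta>::real)"
  shows "integrable P (\<lambda>\<omega>. exp (- \<theta> * f \<omega>))"
proof -
  interpret prob_space P by (rule prob_P)
  show ?thesis
    by (rule integrable_const_bound[where B=1]) (use assms in auto)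
qed

lemma laplace_V_ge:
  assumes \<theta>: "0 < \<theta>"
  shows "exp (- D * exp_poly (Suc d) (ln \<theta> + (ln (2 * (\<Prod>j\<in>J. c2 j)) + (\<Sum>j\<in>J. - ln (r j)))) / 2)
    \<le> (\<integral>\<omega>. exp (- \<theta> * V \<omega>) \<partial>P)"
proof -
  interpret prob_space P by (rule prob_P)
  note [measurable] = V_measurable VN_measurable
  have "(\<lambda>N. \<integral>\<omega>. exp (- \<theta> * VN N \<omega>) \<partial>P) \<longlonglongrightarrow> (\<integral>\<omega>. exp (- \<theta> * V \<omega>) \<partial>P)"
  proof (rule integral_dominated_convergence[where w="\<lambda>_. 1"])
    show "AE \<omega> in P. (\<lambda>N. exp (- \<theta> * VN N \<omega>)) \<longlonglongrightarrow> exp (- \<theta> * V \<omega>)"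
      using VN_tendsto_V by eventually_elim (intro tendsto_intros)
    show "AE \<omega> in P. norm (exp (- \<theta> * VN N \<omega>)) \<le> 1" for N
      using VN_nonneg \<theta> by simp
  qed auto
  then show ?thesis by (rule LIMSEQ_le_const) (use laplace_VN_ge[OF \<theta>] in blast)
qed

lemma small_ball_event:
  assumes "0 < \<epsilon>"
  shows "{\<omega> \<in> space P. field_norm (Pi\<^sub>M J \<mu>) W \<omega> \<le> \<epsilon>} = {\<omega> \<in> space P. V \<omega> \<le> \<epsilon>\<^sup>2}"
proof -
  have "sqrt (V \<omega>) \<le> \<epsilon> \<longleftrightarrow> V \<omega> \<le> \<epsilon>\<^sup>2" for \<omega>
    using assms V_nonneg[of \<omega>] by (metis less_imp_le real_sqrt_le_iff real_sqrt_abs abs_of_nonneg)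
  then show ?thesis by (simp add: field_norm_def V_def Q_def)
qed

theorem small_ball_asymp:
  assumes d: "d \<ge> 1"
  shows "(\<lambda>\<epsilon>. ln (measure P {\<omega> \<in> space P. field_norm (Pi\<^sub>M J \<mu>) W \<omega> \<le> \<epsilon>}))
    \<sim>[at_right 0] (\<lambda>\<epsilon>. - (2 ^ d * D / fact (d + 1)) * ln (1 / \<epsilon>) ^ (d + 1))"
proof -
  interpret prob_space P by (rule prob_P)
  note [measurable] = V_measurable VN_measurable
  let ?p = "\<lambda>\<epsilon>. measure P {\<omega> \<in> space P. field_norm (Pi\<^sub>M J \<mu>) W \<omega> \<le> \<epsilon>}"
  have ev: "{\<omega> \<in> space P. V \<omega> \<le> \<epsilon>\<^sup>2} \<in> sets P" for \<epsilon> by measurable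
  have "(\<lambda>\<epsilon>. ln (?p \<epsilon>)) \<sim>[at_right 0] (\<lambda>\<epsilon>. - (2 ^ (Suc d - 1) * D / fact (Suc d)) * ln (1 / \<epsilon>) ^ Suc d)"
  proof (rule ln_small_ball_asymp[where ?c1.0="ln (\<Prod>j\<in>J. c1 j)"
        and ?c2.0="ln (2 * (\<Prod>j\<in>J. c2 j)) + (\<Sum>j\<in>J. - ln (r j))"])
    show "0 < D" unfolding D_def
    proof (intro prod_pos divide_pos_pos neg_ln_r)
      fix j assume "j \<in> J"
      then show "0 < real (card {2..M j})" using M[of j] by simp
    qed
    show "?p \<epsilon> \<le> exp (1 - D * pos_pow (Suc d) (2 * ln (1 / \<epsilon>) + ln (\<Prod>j\<in>J. c1 j)) / 2)" if \<epsilon>: "0 < \<epsilon>" "\<epsilon> < 1" for \<epsilon>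
    proof -
      \<comment> \<open>Exponential Chebyshev inequality: with
        \<open>\<theta> * \<epsilon>\<^sup>2 = 1\<close> it costs only the factor
        \<open>exp 1\<close>.\<close>
      define \<theta> where "\<theta> = 1 / \<epsilon>\<^sup>2"
      have \<theta>: "0 < \<theta>" "\<theta> * \<epsilon>\<^sup>2 = 1" using \<epsilon> by (auto simp: \<theta>_def)
      have ln\<theta>: "ln \<theta> = 2 * ln (1 / \<epsilon>)"
        using \<epsilon> ln_realpow[of "1 / \<epsilon>" 2] by (simp add: \<theta>_def power_divide)
      obtain N where N: "(\<integral>\<omega>. exp (- \<theta> * VN N \<omega>) \<partial>P) \<le> exp (- D * pos_pow (Suc d) (ln \<theta> + ln (\<Prod>j\<in>J. c1 j)) / 2)"
        using laplace_VN_le[OF \<theta>(1)] by blast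
      have "?p \<epsilon> = (\<integral>\<omega>. indicator {\<omega> \<in> space P. V \<omega> \<le> \<epsilon>\<^sup>2} \<omega> \<partial>P)"
        unfolding small_ball_event[OF \<epsilon>(1)] using ev by simp
      also have "\<dots> \<le> (\<integral>\<omega>. exp 1 * exp (- \<theta> * VN N \<omega>) \<partial>P)"
      proof (rule integral_mono_AE)
        show "integrable P (indicator {\<omega> \<in> space P. V \<omega> \<le> \<epsilon>\<^sup>2} :: 'w \<Rightarrow> real)"
          using ev by (intro integrable_real_indicator) (auto simp: emeasure_eq_measure)
        show "integrable P (\<lambda>\<omega>. exp 1 * exp (- \<theta> * VN N \<omega>))"
          using \<theta> by (intro integrable_mult_right integrable_exp_neg VN_measurable VN_nonneg) auto
        show "AE \<omega> in P. indicator {\<omega> \<in> space P. V \<omega> \<le> \<epsilon>\<^sup>2} \<omega> \<le> exp 1 * exp (- \<theta> * VN N \<omega>)"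
          using VN_le_V[of N]
        proof eventually_elim
          case (elim \<omega>)
          show ?case
          proof (cases "V \<omega> \<le> \<epsilon>\<^sup>2")
            case True
            then have "\<theta> * VN N \<omega> \<le> \<theta> * \<epsilon>\<^sup>2" using elim \<theta> by (intro mult_left_mono) auto
            then have "1 \<le> exp (1 + - \<theta> * VN N \<omega>)" using \<theta> by simp
            then have "1 \<le> exp 1 * exp (- \<theta> * VN N \<omega>)" by (simp only: exp_add)
            then show ?thesis by (simp add: indicator_def)
          qed simp
        qed
      qed
      also have "\<dots> \<le> exp 1 * exp (- D * pos_pow (Suc d) (ln \<theta> + ln (\<Prod>j\<in>J. c1 j)) / 2)"
        using N by simp
      also have "\<dots> = exp (1 - D * pos_pow (Suc d) (2 * ln (1 / \<epsilon>) + ln (\<Prod>j\<in>J. c1 j)) / 2)"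
        unfolding ln\<theta> exp_add[symmetric] by simp
      finally show ?thesis .
    qed
    show "exp (- D * exp_poly (Suc d) (ln \<theta> + (ln (2 * (\<Prod>j\<in>J. c2 j)) + (\<Sum>j\<in>J. - ln (r j)))) / 2) - exp (- \<theta> * \<epsilon>\<^sup>2) \<le> ?p \<epsilon>"
      if \<epsilon>: "0 < \<epsilon>" and \<theta>: "0 < \<theta>" for \<epsilon> \<theta>
    proof -
      let ?A = "{\<omega> \<in> space P. V \<omega> \<le> \<epsilon>\<^sup>2}"
      have intA: "integrable P (indicator ?A :: 'w \<Rightarrow> real)"
        using ev by (intro integrable_real_indicator) (auto simp: emeasure_eq_measure)
      have "(\<integral>\<omega>. exp (- \<theta> * V \<omega>) \<partial>P) \<le> (\<integral>\<omega>. indicator ?A \<omega> + exp (- \<theta> * \<epsilon>\<^sup>2) \<partial>P)"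
      proof (rule integral_mono)
        show "integrable P (\<lambda>\<omega>. exp (- \<theta> * V \<omega>))"
          using \<theta> by (intro integrable_exp_neg V_measurable V_nonneg) auto
        show "integrable P (\<lambda>\<omega>. indicator ?A \<omega> + exp (- \<theta> * \<epsilon>\<^sup>2))" using intA by simp
        fix \<omega> assume \<omega>: "\<omega> \<in> space P"
        have 1: "exp (- \<theta> * V \<omega>) \<le> 1" using \<theta> V_nonneg by simp
        \<comment> \<open>The converse estimate: the exponential is at most 1 on the small ball and
          at most \<open>exp (- \<theta> * \<epsilon>\<^sup>2)\<close> off it.\<close>
        show "exp (- \<theta> * V \<omega>) \<le> indicator ?A \<omega> + exp (- \<theta> * \<epsilon>\<^sup>2)"
        proof (cases "V \<omega> \<le> \<epsilon>\<^sup>2")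
          case True
          then show ?thesis using 1 \<omega> by (simp add: add_increasing2)
        next
          case False
          then show ?thesis using \<theta> by simp
        qed
      qed
      also have "\<dots> = ?p \<epsilon> + exp (- \<theta> * \<epsilon>\<^sup>2)"
        unfolding small_ball_event[OF \<epsilon>] using intA ev by (simp add: prob_space)
      finally show ?thesis using laplace_V_ge[OF \<theta>] by linarith
    qed
  qed simp
  then show ?thesis by simp
qed

end

theorem proposition4p4:
  fixes d :: nat
    and P :: "'w measure" and W :: "(nat \<Rightarrow> real) \<Rightarrow> 'w \<Rightarrow> real"
    and M m :: "nat \<Rightarrow> nat" and \<delta> a :: "nat \<Rightarrow> real" and \<alpha> \<beta> :: "nat \<Rightarrow> nat \<Rightarrow> real"
    and \<mu> :: "nat \<Rightarrow> real measure" and C :: real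
  assumes "d \<ge> 1"
    and "brownian_sheet d P W"
    and "\<And>j. j \<in> {1..d} \<Longrightarrow> dss_measure (M j) (m j) (\<delta> j) (\<alpha> j) (\<beta> j) (\<mu> j)"
    and "\<And>j. j \<in> {1..d} \<Longrightarrow> a j = \<alpha> j (m j + 1) - \<alpha> j (m j)"
    and "C = (\<Prod>j\<in>{1..d}. (real (M j) - 1) / \<bar>ln (a j * \<delta> j)\<bar>)"
  shows "(\<lambda>\<epsilon>. ln (measure P {\<omega> \<in> space P. field_norm (\<Pi>\<^sub>M j\<in>{1..d}. \<mu> j) W \<omega> \<le> \<epsilon>}))
           \<sim>[at_right 0]
         (\<lambda>\<epsilon>. - (2 ^ d * C / fact (d + 1)) * ln (1 / \<epsilon>) ^ (d + 1))"
proof -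
  have dss: "dss (M j) (m j) (\<delta> j) (\<alpha> j) (\<beta> j)" if "j \<in> {1..d}" for j
    using assms(3)[OF that] by (simp add: dss_def dss_measure_def)
  have a: "a j = dss.a (m j) (\<alpha> j)" if "j \<in> {1..d}" for j
    using assms(4)[OF that] by (simp add: dss.a_def[OF dss[OF that]])
  have ad: "0 < a j" "a j < 1" "0 < \<delta> j" "\<delta> j < 1" if "j \<in> {1..d}" for j
    using dss.a[OF dss[OF that]] dss.\<delta>[OF dss[OF that]] a[OF that] by simp_all
  have r: "0 < a j * \<delta> j" "a j * \<delta> j < 1" if "j \<in> {1..d}" for j
    using ad[OF that] mult_strict_mono[of "a j" 1 "\<delta> j" 1] by simp_all
  interpret sheet: atomic_sheet d "{1..d}" P W M \<mu> "\<lambda>j. dss.pos (m j) (\<alpha> j)"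
    "\<lambda>j. dss.wt (m j) (\<delta> j) (\<beta> j)" "\<lambda>j u. dss.rad (M j) (m j) (\<alpha> j) u / 2"
    "\<lambda>j N. dss.maj (M j) (m j) (\<alpha> j)" "\<lambda>j. dss.C1 (M j) (m j) (\<delta> j) (\<alpha> j) (\<beta> j)"
    "\<lambda>j. dss.C2 (M j) (m j) (\<delta> j) (\<alpha> j)" "\<lambda>j. a j * \<delta> j"
  proof (rule atomic_sheet.intro)
    fix j N assume j: "j \<in> {1..d}"
    note D = dss[OF j] and \<mu> = assms(3)[OF j]
    note I = dss.idx_def[OF D, symmetric] and aj = a[OF j]
    show "2 \<le> M j" by (rule dss.M[OF D])
    show "prob_space (\<mu> j)" "sets (\<mu> j) = sets (restrict_space borel {0..1})"
      using \<mu> by (simp_all add: dss_measure_def)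
    show "inj_on (dss.pos (m j) (\<alpha> j)) (UNIV \<times> {2..M j})" by (rule dss.pos_inj[OF D])
    show "AE x in \<mu> j. \<exists>N. x \<in> dss.pos (m j) (\<alpha> j) ` ({..<N} \<times> {2..M j})"
      unfolding I by (rule dss.dss_measure_atoms(2)[OF D \<mu>])
    show "psd ({..<N} \<times> {2..M j}) (\<lambda>u v. min (dss.pos (m j) (\<alpha> j) u) (dss.pos (m j) (\<alpha> j) v)
        - (if u = v then dss.rad (M j) (m j) (\<alpha> j) u / 2 else 0))"
      unfolding I by (rule dss.cov_ge_diag[OF D])
    show "psd ({..<N} \<times> {2..M j}) (\<lambda>u v. (\<Sum>k\<in>{..<N} \<times> {2..M j}. dss.maj (M j) (m j) (\<alpha> j) k u * dss.maj (M j) (m j) (\<alpha> j) k v)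
        - min (dss.pos (m j) (\<alpha> j) u) (dss.pos (m j) (\<alpha> j) v))"
      unfolding I by (rule dss.cov_le_maj[OF D])
    show "psd ({..<N} \<times> {2..M j}) (\<lambda>k l. (if k = l then dss.C2 (M j) (m j) (\<delta> j) (\<alpha> j) * (a j * \<delta> j) ^ fst k else 0)
        - (\<Sum>u\<in>{..<N} \<times> {2..M j}. dss.wt (m j) (\<delta> j) (\<beta> j) u
            * (dss.maj (M j) (m j) (\<alpha> j) k u * dss.maj (M j) (m j) (\<alpha> j) l u)))"
      unfolding I aj by (rule dss.weighted_maj_le[OF D])
    show "0 < dss.C1 (M j) (m j) (\<delta> j) (\<alpha> j) (\<beta> j)" "0 < dss.C2 (M j) (m j) (\<delta> j) (\<alpha> j)"
      by (rule dss.C1_pos[OF D], rule dss.C2_pos[OF D])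
    show "0 < a j * \<delta> j" "a j * \<delta> j < 1" using r[OF j] by auto
    fix u :: "nat \<times> nat"
    show "0 \<le> dss.rad (M j) (m j) (\<alpha> j) u / 2" using dss.rad_pos[OF D, of u] by simp
    assume u: "snd u \<in> {2..M j}"
    show "dss.pos (m j) (\<alpha> j) u \<in> {0..1}" using dss.pos_unit[OF D u] by simp
    show "measure (\<mu> j) {dss.pos (m j) (\<alpha> j) u} = dss.wt (m j) (\<delta> j) (\<beta> j) u"
      by (rule dss.dss_measure_atoms(1)[OF D \<mu> u])
    show "0 < dss.wt (m j) (\<delta> j) (\<beta> j) u" by (rule dss.wt_pos[OF D u])
    show "dss.C1 (M j) (m j) (\<delta> j) (\<alpha> j) (\<beta> j) * (a j * \<delta> j) ^ fst u
        \<le> dss.wt (m j) (\<delta> j) (\<beta> j) u * (dss.rad (M j) (m j) (\<alpha> j) u / 2)"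
      unfolding aj by (rule dss.C1_le[OF D u])
  qed (use assms in simp_all)
  \<comment> \<open>Both \<open>a j\<close> and \<open>\<delta> j\<close> are below 1, so the
    logarithm is negative and its modulus is the lattice step.\<close>
  have "sheet.D = C"
    unfolding sheet.D_def assms(5)
  proof (intro prod.cong refl)
    fix j assume j: "j \<in> {1..d}"
    have "ln (a j * \<delta> j) < 0" using r[OF j] by simp
    moreover have "real (card {2..M j}) = real (M j) - 1" using dss.M[OF dss[OF j]] by simp
    ultimately show "real (card {2..M j}) / - ln (a j * \<delta> j) = (real (M j) - 1) / \<bar>ln (a j * \<delta> j)\<bar>" by simp
  qed
  then show ?thesis using sheet.small_ball_asymp[OF assms(1)] by simp
qed

end
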